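(* Let $n\ge 3$, let $q_*=\frac{2n}{n-2}$, let $2<q\le q_*$, and let $0<a<\frac{n-2}{2}$. Set $\alpha=\frac{q}{q-2}$, \[ C_q=\left[\frac{2\pi^{n/2}}{\Gamma(n/2)}\right]^{1/\alpha}\left(\frac{q}{2}\right)^{2/q}\left[\frac{\Gamma(\alpha)\Gamma(\alpha+1)}{\Gamma(2\alpha)}\right]^{1/\alpha}, \qquad D_{q,a}=(n-2-2a)^{\frac{2}{q}+1}\,C_q . \] Then for every Schwartz function $f\in\mathcal S(\mathbb R^n)$, \[ \int_{\mathbb R^n}|\nabla f|^2\,dx\;\ge\;a(n-2-a)\int_{\mathbb R^n}\frac{1}{|x|^2}|f|^2\,dx\;+\;D_{q,a}\left[\int_{\mathbb R^n}|x|^{-n(q_*-q)/q_*}|f|^q\,dx\right]^{2/q}. \] *)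

theory Defs
  imports "HOL-Analysis.Analysis"
begin

fun iter_pd :: "('a::euclidean_space \<Rightarrow> complex) \<Rightarrow> 'a list \<Rightarrow> ('a \<Rightarrow> complex)" where
  "iter_pd f [] = f"
| "iter_pd f (b # ds) = (\<lambda>x. frechet_derivative (iter_pd f ds) (at x) b)"

definition schwartz :: "('a::euclidean_space \<Rightarrow> complex) \<Rightarrow> bool" where
  "schwartz f \<longleftrightarrow>
     (\<forall>ds. set ds \<subseteq> Basis \<longrightarrow>
        (\<forall>x. iter_pd f ds differentiable (at x)) \<and>
        (\<forall>N::nat. bounded (range (\<lambda>x. (1 + norm x) ^ N * norm (iter_pd f ds x)))))"

definition grad_sq :: "('a::euclidean_space \<Rightarrow> complex) \<Rightarrow> 'a \<Rightarrow> real" where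
  "grad_sq f x = (\<Sum>b\<in>Basis. (cmod (frechet_derivative f (at x) b))\<^sup>2)"

end

theory Submission
  imports Defs "HOL-Probability.Distribution_Functions"
begin

text \<open>
  Write \<open>m = (n - 2) / 2\<close> and \<open>\<lambda> = m - a\<close>. For radial \<open>u\<close> put \<open>G = \<bar>x\<bar>\<^sup>m u\<close>, a function of
  \<open>s = ln \<bar>x\<bar>\<close>; the inequality becomes \<open>\<integral> G'\<^sup>2 + \<lambda>\<^sup>2 G\<^sup>2 ds \<ge> c (\<integral> G\<^sup>q ds)\<^bsup>2/q\<^esup>\<close>. Let \<open>M = max G\<close> and
  \<open>S y = \<lambda> sqrt (1 - (y/M)\<^bsup>q-2\<^esup>)\<close>. Completing the square,
  \<open>G'\<^sup>2 + \<lambda>\<^sup>2 G\<^sup>2 - \<lambda>\<^sup>2 M\<^bsup>2-q\<^esup> G\<^sup>q \<ge> \<plusminus> 2 G' G S(G)\<close>, with the plus sign before a maximum point and the minus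
  sign after it, gives \<open>\<integral> G'\<^sup>2 + \<lambda>\<^sup>2 G\<^sup>2 \<ge> \<lambda>\<^sup>2 M\<^bsup>2-q\<^esup> \<integral> G\<^sup>q + 4 \<integral>\<^sub>0\<^sup>M y S y dy\<close>. Young's inequality
  eliminates \<open>M\<close>, and the last integral is a Beta function.

  A general \<open>f\<close> is compared with the symmetric decreasing rearrangement of \<open>\<bar>f\<bar>\<close>, which does not
  decrease the two weighted integrals. For the gradient, the Brunn--Minkowski inequality for superlevel
  sets and small balls yields \<open>\<integral> \<psi>(\<bar>f\<bar>) \<bar>\<nabla>f\<bar> dx \<ge> \<integral> \<psi>(t) P(t) dt\<close> for all \<open>\<psi> \<ge> 0\<close>, where \<open>P(t)\<close> is the
  perimeter of the ball with the volume of \<open>{\<bar>f\<bar> > t}\<close>. Inserting the slope prescribed by the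
  completed square as \<open>\<psi>\<close> into \<open>\<bar>\<nabla>f\<bar>\<^sup>2 \<ge> 2 \<psi>(\<bar>f\<bar>) \<bar>\<nabla>f\<bar> - \<psi>(\<bar>f\<bar>)\<^sup>2\<close> and exchanging the order of integration
  over levels and radii reproduces the radial computation without any regularity of the rearrangement.
\<close>


section \<open>The Brunn--Minkowski inequality for open sets\<close>

text \<open>The coordinate z = |x|^m makes level and radius symmetric. If \<open>R t\<close> is the
  radius of the rearranged level set {u > t} in this coordinate and \<open>v\<close> is the
  generalised inverse of \<open>R\<close>, then G is both \<open>z * v z\<close> and
  \<open>R t * t\<close>. A kernel k(z t) on the region under the graph can be integrated in either
  order through one and the same primitive, and this replaces every differentiation of the
  rearrangement. The sign change at the maximum is a jump in z, at a fixed radius z0, of the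
  primitive that is exchanged. This jump alone produces the boundary term: one factor 2 is the
  difference of the two signs, the other comes from 2 \<psi> |\<nabla>f|. Two obstacles shape the
  choice of M. The derivative of S is singular at y = M, and no maximum point of G is at hand. So M
  is the supremum of G divided by some \<eta> < 1, z0 is only a near-maximum point, and \<eta> tends
  to 1 after M has been eliminated. Since |f| may fail to be differentiable at zeros of f, only an
  upper bound for its growth near a point enters.\<close>

abbreviation sumset :: "'a::real_normed_vector set \<Rightarrow> 'a set \<Rightarrow> 'a set" where
  "sumset A B \<equiv> (\<Union>x\<in>A. \<Union>y\<in>B. {x + y})"

text \<open>Open boxes may touch along faces, so that a face of one box can serve as the separating
  hyperplane. Empty traces are excluded so that the number of members drops when a half-space misses
  a box.\<close>

definition box_family :: "'a::euclidean_space set set \<Rightarrow> bool" where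
  "box_family P \<longleftrightarrow> finite P \<and> disjoint P \<and> (\<forall>X\<in>P. X \<noteq> {} \<and> (\<exists>a b. X = box a b))"

lemma box_Int_halfspace:
  fixes k :: "'a::euclidean_space"
  assumes "k \<in> Basis"
  shows "\<exists>a' b'. box a b \<inter> {x. x \<bullet> k < c} = box a' b'"
    and "\<exists>a' b'. box a b \<inter> {x. c < x \<bullet> k} = box a' b'"
proof -
  define b' where "b' = (\<Sum>i\<in>Basis. (if i = k then min (b \<bullet> i) c else b \<bullet> i) *\<^sub>R i)"
  have "b' \<bullet> i = (if i = k then min (b \<bullet> i) c else b \<bullet> i)" if "i \<in> Basis" for i
    unfolding b'_def using that by (simp add: inner_sum_left_Basis)
  hence "box a b \<inter> {x. x \<bullet> k < c} = box a b'"
    using assms by (auto simp: mem_box split: if_splits)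
  thus "\<exists>a' b'. box a b \<inter> {x. x \<bullet> k < c} = box a' b'" by blast
  define a' where "a' = (\<Sum>i\<in>Basis. (if i = k then max (a \<bullet> i) c else a \<bullet> i) *\<^sub>R i)"
  have "a' \<bullet> i = (if i = k then max (a \<bullet> i) c else a \<bullet> i)" if "i \<in> Basis" for i
    unfolding a'_def using that by (simp add: inner_sum_left_Basis)
  hence "box a b \<inter> {x. c < x \<bullet> k} = box a' b"
    using assms by (auto simp: mem_box split: if_splits)
  thus "\<exists>a' b'. box a b \<inter> {x. c < x \<bullet> k} = box a' b'" by blast
qed

lemma box_family_Int:
  assumes P: "box_family P" and H: "\<And>a b. \<exists>a' b'. box a b \<inter> H = box a' b'"
  defines "P' \<equiv> (\<lambda>X. X \<inter> H) ` {X\<in>P. X \<inter> H \<noteq> {}}"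
  shows "box_family P'" "\<Union>P' = \<Union>P \<inter> H" "card P' \<le> card P"
    "(\<exists>X\<in>P. X \<inter> H = {}) \<Longrightarrow> card P' < card P"
proof -
  have fin: "finite P" using P by (simp add: box_family_def)
  show "box_family P'"
    unfolding box_family_def
  proof (intro conjI)
    show "finite P'" using fin by (simp add: P'_def)
    show "disjoint P'" using P unfolding P'_def box_family_def disjoint_def by blast
    show "\<forall>X\<in>P'. X \<noteq> {} \<and> (\<exists>a b. X = box a b)"
    proof
      fix Y assume "Y \<in> P'"
      then obtain X where X: "X \<in> P" "Y = X \<inter> H" "Y \<noteq> {}" by (auto simp: P'_def)
      obtain a b where "X = box a b" using P X(1) unfolding box_family_def by metis
      thus "Y \<noteq> {} \<and> (\<exists>a b. Y = box a b)" using H[of a b] X by simp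
    qed
  qed
  show "\<Union>P' = \<Union>P \<inter> H" unfolding P'_def by blast
  have 1: "card P' \<le> card {X\<in>P. X \<inter> H \<noteq> {}}"
    unfolding P'_def using fin by (intro card_image_le) auto
  also have 2: "\<dots> \<le> card P" using fin by (intro card_mono) auto
  finally show "card P' \<le> card P" .
  assume "\<exists>X\<in>P. X \<inter> H = {}"
  hence "card {X\<in>P. X \<inter> H \<noteq> {}} < card P" using fin by (intro psubset_card_mono) auto
  with 1 show "card P' < card P" by simp
qed

lemma open_Union_box_family: "box_family P \<Longrightarrow> open (\<Union>P)"
  unfolding box_family_def by (auto intro!: open_Union open_box)

lemma bounded_Union_box_family: "box_family P \<Longrightarrow> bounded (\<Union>P)"
  unfolding box_family_def by (auto intro!: bounded_Union)

section \<open>Volumes of sets cut by coordinate hyperplanes\<close>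

lemma measure_open_pos:
  fixes A :: "'a::euclidean_space set"
  assumes "open A" "A \<noteq> {}" "emeasure lborel A < \<infinity>"
  shows "0 < measure lborel A"
proof -
  obtain x where "x \<in> A" using assms by auto
  then obtain e where e: "e > 0" "ball x e \<subseteq> A" using assms(1) openE by blast
  have "0 < measure lborel (ball x e)" using e by (simp add: content_ball_gt_0_iff)
  also have "\<dots> \<le> measure lborel A"
    using e assms by (intro measure_mono_fmeasurable) (auto simp: fmeasurable_def borel_open)
  finally show ?thesis .
qed

lemma negligible_borel_null_sets:
  fixes N :: "'a::euclidean_space set"
  assumes "negligible N" "N \<in> sets borel"
  shows "N \<in> null_sets lborel"
  using assms by (auto simp: negligible_iff_null_sets null_sets_completion_iff)

lemma hyperplane_null_sets:
  assumes "k \<in> Basis"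
  shows "{x. x \<bullet> k = d} \<in> null_sets lborel"
proof -
  have "negligible {x. k \<bullet> x = d}" using assms by (intro negligible_hyperplane) auto
  hence "{x. k \<bullet> x = d} \<in> null_sets lborel"
    by (intro negligible_borel_null_sets borel_closed closed_hyperplane)
  thus ?thesis by (simp add: inner_commute)
qed

text \<open>Push the volume of \<open>B\<close> forward along the coordinate \<open>k\<close>.
  Hyperplanes are null, so the distribution function is continuous; it runs from 0 to the volume of
  \<open>B\<close>, and the intermediate value theorem applies.\<close>

lemma measure_halfspace_cut:
  fixes B :: "'a::euclidean_space set"
  assumes B: "open B" "bounded B" and k: "k \<in> Basis" and \<theta>: "0 < \<theta>" "\<theta> < 1" and pos: "measure lborel B > 0"
  shows "\<exists>d. measure lborel (B \<inter> {x. x \<bullet> k < d}) = \<theta> * measure lborel B"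
proof -
  have [measurable]: "B \<in> sets borel" using B by (simp add: borel_open)
  define M where "M = distr (density lborel (indicator B)) borel (\<lambda>x. x \<bullet> k)"
  have em: "emeasure M S = emeasure lborel (B \<inter> {x. x \<bullet> k \<in> S})" if [measurable]: "S \<in> sets borel" for S
  proof -
    have "emeasure M S = emeasure (density lborel (indicator B)) {x. x \<bullet> k \<in> S}"
      unfolding M_def by (subst emeasure_distr) (auto simp: vimage_def)
    also have "\<dots> = (\<integral>\<^sup>+x. indicator B x * indicator {x. x \<bullet> k \<in> S} x \<partial>lborel)"
      by (subst emeasure_density) auto
    also have "\<dots> = (\<integral>\<^sup>+x. indicator (B \<inter> {x. x \<bullet> k \<in> S}) x \<partial>lborel)"
      by (intro nn_integral_cong) (auto simp: indicator_def)
    finally show ?thesis by simp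
  qed
  have fin: "emeasure lborel B < \<infinity>" using B emeasure_bounded_finite by blast
  have sM: "space M = UNIV" "sets M = sets borel" by (simp_all add: M_def)
  have "finite_measure M"
    by (rule finite_measureI) (use em[of UNIV] fin sM in simp)
  then interpret M: finite_borel_measure M
    by (intro finite_borel_measure.intro finite_borel_measure_axioms.intro sM)
  have null: "measure M {d} = 0" for d
  proof -
    have "emeasure M {d} \<le> emeasure lborel {x. x \<bullet> k = d}"
      by (subst em) (auto intro!: emeasure_mono)
    also have "\<dots> = 0" using hyperplane_null_sets[OF k] by (simp add: null_sets_def)
    finally show ?thesis by (simp add: measure_def)
  qed
  have cont: "isCont (cdf M) d" for d using null M.isCont_cdf by blast
  have tot: "measure M (space M) = measure lborel B"
    using em[of UNIV] by (simp add: measure_def M_def)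
  have "eventually (\<lambda>d. cdf M d < \<theta> * measure lborel B) at_bot"
    using M.cdf_lim_at_bot \<theta> pos by (intro order_tendstoD(2)) auto
  then obtain d1 where d1: "\<And>d. d \<le> d1 \<Longrightarrow> cdf M d < \<theta> * measure lborel B"
    by (auto simp: eventually_at_bot_linorder)
  have "eventually (\<lambda>d. cdf M d > \<theta> * measure lborel B) at_top"
    using M.cdf_lim_at_top \<theta> pos tot by (intro order_tendstoD(1)) auto
  then obtain d2 where d2: "\<And>d. d \<ge> d2 \<Longrightarrow> cdf M d > \<theta> * measure lborel B"
    by (auto simp: eventually_at_top_linorder)
  have "\<exists>d. min d1 d2 \<le> d \<and> d \<le> max d1 d2 \<and> cdf M d = \<theta> * measure lborel B"
    using cont d1[of "min d1 d2"] d2[of "max d1 d2"] by (intro IVT) auto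
  then obtain d where d: "cdf M d = \<theta> * measure lborel B" by blast
  \<comment> \<open>\<open>cdf\<close> counts the closed half-line; passing to the open half-space
    costs only a null hyperplane.\<close>
  have "measure M {..d} = measure M {..<d} + measure M {d}"
    unfolding ivl_disj_un(2)[symmetric] by (intro M.finite_measure_Union) (auto simp: M_def)
  hence "measure M {..<d} = \<theta> * measure lborel B"
    using d null[of d] by (simp add: cdf_def)
  moreover have "measure M {..<d} = measure lborel (B \<inter> {x. x \<bullet> k < d})"
    using em[of "{..<d}"] by (simp add: measure_def)
  ultimately show ?thesis by metis
qed

lemma measure_halfspace_split:
  fixes B :: "'a::euclidean_space set"
  assumes B: "open B" "emeasure lborel B < \<infinity>" and k: "k \<in> Basis"
  shows "measure lborel B = measure lborel (B \<inter> {x. x \<bullet> k < d}) + measure lborel (B \<inter> {x. d < x \<bullet> k})"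
proof -
  let ?L = "B \<inter> {x. x \<bullet> k < d}" and ?R = "B \<inter> {x. d < x \<bullet> k}"
  have [measurable]: "B \<in> sets borel" using B by (simp add: borel_open)
  have "AE x in lborel. \<not> (x \<bullet> k = d)" using AE_not_in[OF hyperplane_null_sets[OF k, of d]] by simp
  hence "AE x in lborel. x \<in> B \<longleftrightarrow> x \<in> ?L \<union> ?R"
    by eventually_elim auto
  hence "measure lborel B = measure lborel (?L \<union> ?R)"
    by (intro measure_eq_AE) auto
  also have "\<dots> = measure lborel ?L + measure lborel ?R"
  proof (rule measure_Union)
    have "emeasure lborel ?L \<le> emeasure lborel B" "emeasure lborel ?R \<le> emeasure lborel B"
      by (auto intro!: emeasure_mono)
    thus "emeasure lborel ?L \<noteq> \<infinity>" "emeasure lborel ?R \<noteq> \<infinity>" using B by (auto simp: top_unique)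
  qed auto
  finally show ?thesis .
qed

text \<open>Brunn-Minkowski for two boxes with edge lengths \<open>l i\<close> and
  \<open>m i\<close>. AM-GM is applied to the ratios l/(l+m) and m/(l+m), whose arithmetic means add
  up to 1.\<close>

lemma root_prod_add_le:
  fixes l m :: "'i \<Rightarrow> real"
  assumes I: "finite I" "I \<noteq> {}" and l: "\<And>i. i \<in> I \<Longrightarrow> 0 < l i" and m: "\<And>i. i \<in> I \<Longrightarrow> 0 < m i"
  shows "root (card I) (\<Prod>i\<in>I. l i) + root (card I) (\<Prod>i\<in>I. m i) \<le> root (card I) (\<Prod>i\<in>I. l i + m i)"
proof -
  let ?n = "card I"
  have n: "?n > 0" using I by (simp add: card_gt_0_iff)
  have amgm: "root ?n (\<Prod>i\<in>I. x i) \<le> (\<Sum>i\<in>I. x i / ?n)" if x: "\<And>i. i \<in> I \<Longrightarrow> 0 < x i" for x :: "'i \<Rightarrow> real"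
  proof -
    have p: "0 < (\<Prod>i\<in>I. x i)" using x by (intro prod_pos) auto
    have "(\<Prod>i\<in>I. x i) powr (1 / ?n) \<le> (\<Sum>i\<in>I. x i / ?n)"
      using x less_imp_le by (intro arith_geom_mean[OF I]) blast
    moreover have "(\<Prod>i\<in>I. x i) powr (1 / ?n) = root ?n (\<Prod>i\<in>I. x i)"
      using p n by (simp add: root_powr_inverse)
    ultimately show ?thesis by simp
  qed
  define S where "S = (\<Prod>i\<in>I. l i + m i)"
  have S: "S > 0" unfolding S_def using l m by (intro prod_pos) (auto intro: add_pos_pos)
  have "root ?n (\<Prod>i\<in>I. l i / (l i + m i)) + root ?n (\<Prod>i\<in>I. m i / (l i + m i))
        \<le> (\<Sum>i\<in>I. l i / (l i + m i) / ?n) + (\<Sum>i\<in>I. m i / (l i + m i) / ?n)"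
    using l m by (intro add_mono amgm) (auto intro!: divide_pos_pos add_pos_pos)
  also have "\<dots> = (\<Sum>i\<in>I. 1 / ?n)"
    unfolding sum.distrib[symmetric]
  proof (rule sum.cong)
    fix i assume i: "i \<in> I"
    have "l i + m i \<noteq> 0" using l[OF i] m[OF i] by linarith
    thus "l i / (l i + m i) / ?n + m i / (l i + m i) / ?n = 1 / ?n"
      by (metis add_divide_distrib divide_self)
  qed auto
  also have "\<dots> = 1" using n by simp
  finally have "root ?n ((\<Prod>i\<in>I. l i) / S) + root ?n ((\<Prod>i\<in>I. m i) / S) \<le> 1"
    by (simp add: prod_dividef S_def)
  hence "(root ?n (\<Prod>i\<in>I. l i) + root ?n (\<Prod>i\<in>I. m i)) / root ?n S \<le> 1"
    by (simp add: real_root_divide add_divide_distrib)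
  thus ?thesis using S n by (simp add: S_def field_simps)
qed

lemma box_add_subset_sumset:
  fixes a b c d :: "'a::euclidean_space"
  assumes "box a b \<noteq> {}" "box c d \<noteq> {}"
  shows "box (a + c) (b + d) \<subseteq> sumset (box a b) (box c d)"
proof
  fix z assume z: "z \<in> box (a + c) (b + d)"
  have ab: "a \<bullet> i < b \<bullet> i" "c \<bullet> i < d \<bullet> i" if "i \<in> Basis" for i
    using assms that by (auto simp: box_ne_empty)
  \<comment> \<open>\<open>\<theta> i\<close> is the relative position of \<open>z\<close> along
    edge \<open>i\<close> of the sum box. The point \<open>x\<close> is put at the same relative
    position in \<open>box a b\<close>, and then \<open>z - x\<close> has it in
    \<open>box c d\<close>.\<close>
  define \<theta> where "\<theta> i = (z \<bullet> i - a \<bullet> i - c \<bullet> i) / ((b \<bullet> i - a \<bullet> i) + (d \<bullet> i - c \<bullet> i))" for i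
  have \<theta>: "0 < \<theta> i" "\<theta> i < 1" "z \<bullet> i = a \<bullet> i + c \<bullet> i + \<theta> i * ((b \<bullet> i - a \<bullet> i) + (d \<bullet> i - c \<bullet> i))"
    if i: "i \<in> Basis" for i
  proof -
    have "a \<bullet> i + c \<bullet> i < z \<bullet> i" "z \<bullet> i < b \<bullet> i + d \<bullet> i"
      using z i by (auto simp: mem_box inner_add_left)
    thus "0 < \<theta> i" "\<theta> i < 1" "z \<bullet> i = a \<bullet> i + c \<bullet> i + \<theta> i * ((b \<bullet> i - a \<bullet> i) + (d \<bullet> i - c \<bullet> i))"
      using ab[OF i] by (simp_all add: \<theta>_def)
  qed
  define x where "x = (\<Sum>i\<in>Basis. (a \<bullet> i + \<theta> i * (b \<bullet> i - a \<bullet> i)) *\<^sub>R i)"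
  have xi: "x \<bullet> i = a \<bullet> i + \<theta> i * (b \<bullet> i - a \<bullet> i)" if "i \<in> Basis" for i
    unfolding x_def using that by (simp add: inner_sum_left_Basis)
  have lt: "0 < \<theta> i * w \<and> \<theta> i * w < w" if "i \<in> Basis" "w > 0" for i w
    using \<theta>[OF that(1)] that(2) by simp
  have "x \<in> box a b"
    unfolding mem_box
  proof
    fix i :: 'a assume i: "i \<in> Basis"
    show "a \<bullet> i < x \<bullet> i \<and> x \<bullet> i < b \<bullet> i" using lt[OF i, of "b \<bullet> i - a \<bullet> i"] ab[OF i] xi[OF i] by linarith
  qed
  moreover have "z - x \<in> box c d"
    unfolding mem_box
  proof
    fix i :: 'a assume i: "i \<in> Basis"
    have "(z - x) \<bullet> i = c \<bullet> i + \<theta> i * (d \<bullet> i - c \<bullet> i)"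
      using \<theta>(3)[OF i] xi[OF i] by (simp add: inner_diff_left algebra_simps)
    thus "c \<bullet> i < (z - x) \<bullet> i \<and> (z - x) \<bullet> i < d \<bullet> i"
      using lt[OF i, of "d \<bullet> i - c \<bullet> i"] ab[OF i] by linarith
  qed
  ultimately show "z \<in> sumset (box a b) (box c d)"
    by (intro UN_I[of x] UN_I[of "z - x"]) auto
qed

lemma sumset_commute: "sumset A B = sumset B A"
proof -
  have "sumset A B \<subseteq> sumset B A" for A B :: "'a set"
  proof
    fix z assume "z \<in> sumset A B"
    then obtain x y where "x \<in> A" "y \<in> B" "z = y + x" by (auto simp: add.commute)
    thus "z \<in> sumset B A" by blast
  qed
  thus ?thesis by (intro equalityI)
qed

text \<open>Hadwiger and Ohmann: a coordinate hyperplane separating two boxes of one family strictly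
  decreases the number of boxes on each side; the other set is cut in the same volume ratio.\<close>
lemma Brunn_Minkowski_box_families:
  fixes P Q :: "'a::euclidean_space set set"
  assumes "box_family P" "box_family Q" "P \<noteq> {}" "Q \<noteq> {}"
  shows "(root DIM('a) (measure lborel (\<Union>P)) + root DIM('a) (measure lborel (\<Union>Q))) ^ DIM('a)
           \<le> measure lborel (sumset (\<Union>P) (\<Union>Q))"
  using assms
proof (induction "card P + card Q" arbitrary: P Q rule: less_induct)
  case (less P Q)
  let ?n = "DIM('a)" and ?m = "measure lborel :: 'a set \<Rightarrow> real"
  \<comment> \<open>Stated for arbitrary families with the induction hypothesis as a premise, so
    that it can be used again with the two families interchanged when only the second one has two
    boxes.\<close>
  have main: "(root ?n (?m (\<Union>P)) + root ?n (?m (\<Union>Q))) ^ ?n \<le> ?m (sumset (\<Union>P) (\<Union>Q))"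
    if P: "box_family P" and Q: "box_family Q" and ne: "P \<noteq> {}" "Q \<noteq> {}" and two: "card P \<ge> 2"
      and IH: "\<And>P' Q'. card P' + card Q' < card P + card Q \<Longrightarrow> box_family P' \<Longrightarrow> box_family Q' \<Longrightarrow>
          P' \<noteq> {} \<Longrightarrow> Q' \<noteq> {} \<Longrightarrow>
          (root ?n (?m (\<Union>P')) + root ?n (?m (\<Union>Q'))) ^ ?n \<le> ?m (sumset (\<Union>P') (\<Union>Q'))"
    for P Q :: "'a set set"
  proof -
    let ?A = "\<Union>P" and ?B = "\<Union>Q"
    obtain X Y where XY: "X \<in> P" "Y \<in> P" "X \<noteq> Y"
      using two by (metis One_nat_def Suc_1 card_le_Suc0_iff_eq not_less_eq_eq P box_family_def)
    have Pbox: "Z \<noteq> {} \<and> (\<exists>a b. Z = box a b)" if "Z \<in> P" for Z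
      using P that by (simp add: box_family_def)
    obtain a b where ab: "X = box a b" using Pbox[OF XY(1)] by metis
    obtain c d where cd: "Y = box c d" using Pbox[OF XY(2)] by metis
    have disjXY: "X \<inter> Y = {}" using P XY by (simp add: box_family_def disjoint_def)
    have ne': "box a b \<noteq> {}" "box c d \<noteq> {}" and "box a b \<inter> box c d = {}"
      using Pbox[OF XY(1)] Pbox[OF XY(2)] disjXY unfolding ab cd by auto
    then obtain k where k: "k \<in> Basis" and sep: "b \<bullet> k \<le> c \<bullet> k \<or> d \<bullet> k \<le> a \<bullet> k"
      unfolding disjoint_interval box_ne_empty by (meson not_le)
    \<comment> \<open>Disjoint boxes are separated in some coordinate; as they are open, a face of
      one of them lies on a strictly separating hyperplane.\<close>
    obtain e where e: "(X \<subseteq> {x. x \<bullet> k < e} \<and> Y \<subseteq> {x. e < x \<bullet> k}) \<or> (Y \<subseteq> {x. x \<bullet> k < e} \<and> X \<subseteq> {x. e < x \<bullet> k})"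
    proof (cases "b \<bullet> k \<le> c \<bullet> k")
      case True
      have "X \<subseteq> {x. x \<bullet> k < c \<bullet> k}" "Y \<subseteq> {x. c \<bullet> k < x \<bullet> k}"
        using True k by (auto simp: ab cd mem_box) (meson order_less_le_trans)
      thus ?thesis using that by blast
    next
      case False
      hence "d \<bullet> k \<le> a \<bullet> k" using sep by simp
      hence "Y \<subseteq> {x. x \<bullet> k < a \<bullet> k}" "X \<subseteq> {x. a \<bullet> k < x \<bullet> k}"
        using k by (auto simp: ab cd mem_box) (meson order_less_le_trans)
      thus ?thesis using that by blast
    qed
    let ?L = "\<lambda>e. {x::'a. x \<bullet> k < e}" and ?R = "\<lambda>e. {x::'a. e < x \<bullet> k}"
    define cut where "cut P H = (\<lambda>X. X \<inter> H) ` {X\<in>P. X \<inter> H \<noteq> {}}" for P :: "'a set set" and H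
    have cutL: "box_family (cut P (?L e))" "\<Union>(cut P (?L e)) = \<Union>P \<inter> ?L e" "card (cut P (?L e)) \<le> card P"
        "(\<exists>X\<in>P. X \<inter> ?L e = {}) \<Longrightarrow> card (cut P (?L e)) < card P" if "box_family P" for P e
      unfolding cut_def using box_family_Int[OF that, of "?L e"] box_Int_halfspace(1)[OF k, of _ _ e] by simp_all
    have cutR: "box_family (cut P (?R e))" "\<Union>(cut P (?R e)) = \<Union>P \<inter> ?R e" "card (cut P (?R e)) \<le> card P"
        "(\<exists>X\<in>P. X \<inter> ?R e = {}) \<Longrightarrow> card (cut P (?R e)) < card P" if "box_family P" for P e
      unfolding cut_def using box_family_Int[OF that, of "?R e"] box_Int_halfspace(2)[OF k, of _ _ e] by simp_all
    have dLR: "?L e \<inter> ?R e = {}" by auto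
    have lessL: "card (cut P (?L e)) < card P"
      by (rule cutL(4)[OF P]) (use e XY dLR in blast)
    have lessR: "card (cut P (?R e)) < card P"
      by (rule cutR(4)[OF P]) (use e XY dLR in blast)
    have fA: "emeasure lborel ?A < \<infinity>" "emeasure lborel ?B < \<infinity>" "open ?A" "open ?B" "bounded ?A" "bounded ?B"
      using P Q open_Union_box_family bounded_Union_box_family emeasure_bounded_finite by blast+
    have opL: "open (?L e)" and opR: "open (?R e)" for e
      using open_halfspace_lt[of k e] open_halfspace_gt[of e k] by (simp_all add: inner_commute)
    have fin': "emeasure lborel (A \<inter> H) < \<infinity>" if "bounded A" for A H :: "'a set"
      using that by (intro emeasure_bounded_finite) (auto intro: bounded_subset)
    have ALne: "?A \<inter> ?L e \<noteq> {}" "?A \<inter> ?R e \<noteq> {}"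
      using e XY ne' ab cd by blast+
    have posA: "?m (?A \<inter> ?L e) > 0" "?m (?A \<inter> ?R e) > 0"
      using ALne fA by (auto intro!: measure_open_pos open_Int opL opR fin')
    have "?B \<noteq> {}" using ne Q unfolding box_family_def by auto
    hence posB: "?m ?B > 0" using fA by (intro measure_open_pos) auto
    have splitA: "?m ?A = ?m (?A \<inter> ?L e) + ?m (?A \<inter> ?R e)"
      using fA k by (intro measure_halfspace_split) auto
    \<comment> \<open>The cut of \<open>Q\<close> need not reduce its number of boxes, but it keeps
      the volume ratio. The lower bound is homogeneous of degree one in the pair of volumes
      (\<open>sc\<close>), so the two halves contribute exactly the fractions
      \<open>\<theta>\<close> and \<open>1 - \<theta>\<close> of it.\<close>
    define \<theta> where "\<theta> = ?m (?A \<inter> ?L e) / ?m ?A"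
    have \<theta>: "0 < \<theta>" "\<theta> < 1" using posA splitA by (auto simp: \<theta>_def field_simps)
    obtain g where g: "?m (?B \<inter> ?L g) = \<theta> * ?m ?B"
      using measure_halfspace_cut[OF fA(4,6) k \<theta> posB] by auto
    have splitB: "?m ?B = ?m (?B \<inter> ?L g) + ?m (?B \<inter> ?R g)"
      using fA k by (intro measure_halfspace_split) auto
    have AL: "?m (?A \<inter> ?L e) = \<theta> * ?m ?A" using splitA posA by (simp add: \<theta>_def)
    have AR: "?m (?A \<inter> ?R e) = (1 - \<theta>) * ?m ?A" using splitA AL by (simp add: algebra_simps)
    have BR: "?m (?B \<inter> ?R g) = (1 - \<theta>) * ?m ?B" using splitB g by (simp add: algebra_simps)
    have BLne: "?B \<inter> ?L g \<noteq> {}" "?B \<inter> ?R g \<noteq> {}"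
      using g BR \<theta> posB by (auto intro!: notI)
    let ?r = "(root ?n (?m ?A) + root ?n (?m ?B)) ^ ?n"
    have n: "?n > 0" by simp
    have sc: "(root ?n (t * x) + root ?n (t * y)) ^ ?n = t * (root ?n x + root ?n y) ^ ?n"
      if "t \<ge> 0" for t x y
    proof -
      have "(root ?n (t * x) + root ?n (t * y)) ^ ?n = (root ?n t * (root ?n x + root ?n y)) ^ ?n"
        by (simp add: real_root_mult algebra_simps)
      also have "\<dots> = t * (root ?n x + root ?n y) ^ ?n" using that n by (simp add: power_mult_distrib)
      finally show ?thesis .
    qed
    have "(root ?n (?m (\<Union>(cut P (?L e)))) + root ?n (?m (\<Union>(cut Q (?L g))))) ^ ?n
          \<le> ?m (sumset (\<Union>(cut P (?L e))) (\<Union>(cut Q (?L g))))"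
    proof (rule IH)
      show "card (cut P (?L e)) + card (cut Q (?L g)) < card P + card Q"
        using lessL cutL(3)[OF Q, of g] by linarith
      show "cut P (?L e) \<noteq> {}" "cut Q (?L g) \<noteq> {}" using cutL(2)[OF P, of e] cutL(2)[OF Q, of g] ALne BLne by auto
    qed (use cutL(1) P Q in auto)
    hence 1: "\<theta> * ?r \<le> ?m (sumset (?A \<inter> ?L e) (?B \<inter> ?L g))"
      unfolding cutL(2)[OF P] cutL(2)[OF Q] AL g using sc \<theta> by simp
    have "(root ?n (?m (\<Union>(cut P (?R e)))) + root ?n (?m (\<Union>(cut Q (?R g))))) ^ ?n
          \<le> ?m (sumset (\<Union>(cut P (?R e))) (\<Union>(cut Q (?R g))))"
    proof (rule IH)
      show "card (cut P (?R e)) + card (cut Q (?R g)) < card P + card Q"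
        using lessR cutR(3)[OF Q, of g] by linarith
      show "cut P (?R e) \<noteq> {}" "cut Q (?R g) \<noteq> {}" using cutR(2)[OF P, of e] cutR(2)[OF Q, of g] ALne BLne by auto
    qed (use cutR(1) P Q in auto)
    hence 2: "(1 - \<theta>) * ?r \<le> ?m (sumset (?A \<inter> ?R e) (?B \<inter> ?R g))"
      unfolding cutR(2)[OF P] cutR(2)[OF Q] AR BR using sc \<theta> by simp
    define SL SR T where "SL = sumset (?A \<inter> ?L e) (?B \<inter> ?L g)"
      and "SR = sumset (?A \<inter> ?R e) (?B \<inter> ?R g)" and "T = sumset ?A ?B"
    have op: "open SL" "open SR" "open T"
      unfolding SL_def SR_def T_def by (intro open_sums disjI1 open_Int fA opL opR)+
    have bd: "bounded T" unfolding T_def using fA by (intro bounded_sums)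
    have sub: "SL \<union> SR \<subseteq> T" unfolding SL_def SR_def T_def by (intro Un_least UN_mono) auto
    \<comment> \<open>The two partial sums lie on opposite sides of the hyperplane at height
      \<open>e + g\<close>, so their volumes add.\<close>
    have "SL \<subseteq> ?L (e + g)" "SR \<subseteq> ?R (e + g)"
      unfolding SL_def SR_def by (auto simp: inner_add_left)
    moreover have "?L (e + g) \<inter> ?R (e + g) = {}" by auto
    ultimately have disj: "SL \<inter> SR = {}" by blast
    have "bounded SL" "bounded SR" using bounded_subset[OF bd] sub by blast+
    hence fin: "emeasure lborel SL \<noteq> \<infinity>" "emeasure lborel SR \<noteq> \<infinity>" "emeasure lborel T < \<infinity>"
      using emeasure_bounded_finite[of SL] emeasure_bounded_finite[of SR]
        emeasure_bounded_finite[of T] bd by simp_all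
    have "?r = \<theta> * ?r + (1 - \<theta>) * ?r" by (simp add: algebra_simps)
    also have "\<dots> \<le> ?m SL + ?m SR" unfolding SL_def SR_def using 1 2 by (rule add_mono)
    also have "\<dots> = ?m (SL \<union> SR)"
      using op fin disj by (intro measure_Union[symmetric]) (simp_all add: borel_open)
    also have "\<dots> \<le> ?m T"
      using op fin sub by (intro measure_mono_fmeasurable) (simp_all add: fmeasurable_def borel_open)
    also have "\<dots> = ?m (sumset ?A ?B)" unfolding T_def ..
    finally show ?thesis .
  qed
  have fin: "finite P" "finite Q" using less.prems by (auto simp: box_family_def)
  consider "card P \<ge> 2" | "card Q \<ge> 2" | "card P = 1" "card Q = 1"
  proof -
    have "card P > 0" "card Q > 0" using less.prems fin by (auto simp: card_gt_0_iff)
    thus ?thesis using that by linarith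
  qed
  thus ?case
  proof cases
    case 1
    show ?thesis by (rule main) (use less 1 in auto)
  next
    case 2
    have "sumset (\<Union>Q) (\<Union>P) = sumset (\<Union>P) (\<Union>Q)" by (rule sumset_commute)
    moreover have "(root ?n (?m (\<Union>Q)) + root ?n (?m (\<Union>P))) ^ ?n \<le> ?m (sumset (\<Union>Q) (\<Union>P))"
      by (rule main) (use less 2 in \<open>auto simp: add.commute\<close>)
    ultimately show ?thesis by (simp only: add.commute)
  next
    case 3
    then obtain X Y where "P = {X}" "Q = {Y}" by (auto simp: card_1_singleton_iff)
    moreover from this obtain a b c d where "X = box a b" "Y = box c d"
      using less.prems unfolding box_family_def by auto
    ultimately have PQ: "P = {box a b}" "Q = {box c d}" and ne: "box a b \<noteq> {}" "box c d \<noteq> {}"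
      using less.prems unfolding box_family_def by auto
    have lt: "a \<bullet> i < b \<bullet> i" "c \<bullet> i < d \<bullet> i" if "i \<in> Basis" for i
      using ne that by (auto simp: box_ne_empty)
    have op: "open (sumset (box a b) (box c d))" by (intro open_sums) auto
    have fin: "emeasure lborel (sumset (box a b) (box c d)) < \<infinity>"
      by (intro emeasure_bounded_finite bounded_sums) auto
    have m: "?m (box a b) = (\<Prod>i\<in>Basis. b \<bullet> i - a \<bullet> i)" "?m (box c d) = (\<Prod>i\<in>Basis. d \<bullet> i - c \<bullet> i)"
      "?m (box (a + c) (b + d)) = (\<Prod>i\<in>Basis. (b \<bullet> i - a \<bullet> i) + (d \<bullet> i - c \<bullet> i))"
      using lt by (auto simp: measure_lborel_box_eq less_imp_le inner_add_left inner_diff_left algebra_simps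
            add_mono intro!: prod.cong)
    have "root ?n (?m (box a b)) + root ?n (?m (box c d)) \<le> root ?n (?m (box (a + c) (b + d)))"
      unfolding m using lt by (intro root_prod_add_le) auto
    hence "(root ?n (?m (box a b)) + root ?n (?m (box c d))) ^ ?n \<le> root ?n (?m (box (a + c) (b + d))) ^ ?n"
      by (intro power_mono) (auto simp: real_root_ge_zero)
    also have "\<dots> = ?m (box (a + c) (b + d))" by simp
    also have "\<dots> \<le> ?m (sumset (box a b) (box c d))"
      using box_add_subset_sumset[OF ne] fin op
      by (intro measure_mono_fmeasurable) (auto simp: fmeasurable_def borel_open)
    finally show ?thesis by (simp add: PQ)
  qed
qed

text \<open>An open set is a countable union of closed boxes. A finite part that carries enough
  volume is subdivided into nonoverlapping boxes, and replacing these by their interiors discards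
  only a null set.\<close>

lemma open_approx_box_family:
  fixes S :: "'a::euclidean_space set"
  assumes S: "open S" "emeasure lborel S < \<infinity>" and r: "0 \<le> r" "r < measure lborel S"
  shows "\<exists>P. box_family P \<and> \<Union>P \<subseteq> S \<and> r < measure lborel (\<Union>P)"
proof -
  obtain \<D> where D: "countable \<D>" "\<D> \<subseteq> Pow S" "\<And>X. X \<in> \<D> \<Longrightarrow> \<exists>a b. X = cbox a b" "\<Union>\<D> = S"
    using open_countable_Union_open_cbox[OF S(1)] by metis
  have ne: "\<D> \<noteq> {}" using D r by auto
  define T where "T k = \<Union>(from_nat_into \<D> ` {..k})" for k
  have DT: "from_nat_into \<D> i \<in> \<D>" for i using ne by (rule from_nat_into)
  have [measurable]: "T k \<in> sets borel" for k
  proof -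
    have "closed (T k)" unfolding T_def using D(3) DT by (intro closed_Union) (auto, metis closed_cbox)
    thus ?thesis by (rule borel_closed)
  qed
  have UT: "(\<Union>k. T k) = S"
  proof -
    have "(\<Union>k. T k) = \<Union>(range (from_nat_into \<D>))" unfolding T_def by auto
    thus ?thesis using D(4) range_from_nat_into[OF ne D(1)] by simp
  qed
  have "(\<lambda>k. measure lborel (T k)) \<longlonglongrightarrow> measure lborel (\<Union>k. T k)"
  proof (rule Lim_measure_incseq)
    show "incseq T" unfolding incseq_def T_def by (intro allI impI Union_mono image_mono) auto
  qed (use S UT in auto)
  hence "eventually (\<lambda>k. r < measure lborel (T k)) sequentially"
    using r UT by (intro order_tendstoD(1)) auto
  then obtain k where k: "r < measure lborel (T k)" by (auto simp: eventually_sequentially)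
  obtain p where p: "p division_of (T k)"
  proof -
    have "\<And>s. s \<in> from_nat_into \<D> ` {..k} \<Longrightarrow> \<exists>a b. s = cbox a b" using D(3) DT by auto
    thus ?thesis using that elementary_unions_intervals[of "from_nat_into \<D> ` {..k}"] unfolding T_def by blast
  qed
  define P where "P = interior ` p - {{}}"
  have fp: "finite p" using p by (rule division_ofD)
  have bp: "\<exists>a b. K = cbox a b" if "K \<in> p" for K using division_ofD(4)[OF p that] .
  have "box_family P"
    unfolding box_family_def
  proof (intro conjI ballI)
    show "finite P" using fp by (simp add: P_def)
    show "disjoint P" unfolding disjoint_def
    proof (intro ballI impI)
      fix X Y assume "X \<in> P" "Y \<in> P" "X \<noteq> Y"
      then obtain K L where "K \<in> p" "L \<in> p" "X = interior K" "Y = interior L" "K \<noteq> L" unfolding P_def by auto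
      thus "X \<inter> Y = {}" using division_ofD(5)[OF p, of K L] by simp
    qed
    fix X assume X: "X \<in> P"
    then obtain K where K: "K \<in> p" "X = interior K" "X \<noteq> {}" by (auto simp: P_def)
    obtain a b where "K = cbox a b" using bp[OF K(1)] by metis
    thus "X \<noteq> {}" "\<exists>a b. X = box a b" using K by auto
  qed
  moreover have "\<Union>P \<subseteq> S"
  proof -
    have "\<Union>P \<subseteq> \<Union>p" unfolding P_def using interior_subset by blast
    also have "\<dots> = T k" using division_ofD(6)[OF p] .
    finally show ?thesis using UT by blast
  qed
  moreover have "measure lborel (T k) \<le> measure lborel (\<Union>P)"
  proof -
    define N where "N = (\<Union>K\<in>p. K - interior K)"
    have "K - interior K \<in> null_sets lborel" if K: "K \<in> p" for K
    proof -
      obtain a b where K: "K = cbox a b" using bp[OF K] by metis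
      have "negligible (K - interior K)" unfolding K by (simp add: negligible_frontier_interval)
      thus ?thesis unfolding K by (intro negligible_borel_null_sets) auto
    qed
    hence N: "N \<in> null_sets lborel" unfolding N_def using fp by (intro null_sets.finite_UN) auto
    have oP: "open (\<Union>P)" "bounded (\<Union>P)"
      using \<open>box_family P\<close> open_Union_box_family bounded_Union_box_family by auto
    have "\<Union>p \<subseteq> \<Union>P \<union> N" unfolding P_def N_def by auto
    hence "T k \<subseteq> \<Union>P \<union> N" using division_ofD(6)[OF p] by simp
    hence "emeasure lborel (T k) \<le> emeasure lborel (\<Union>P \<union> N)"
      using oP N by (intro emeasure_mono) (auto simp: borel_open)
    also have "\<dots> = emeasure lborel (\<Union>P)"
      using oP N by (intro emeasure_Un_null_set) (auto simp: borel_open)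
    finally show ?thesis
      using emeasure_bounded_finite[OF oP(2)] unfolding measure_def by (intro enn2real_mono) auto
  qed
  ultimately show ?thesis using k by (intro exI[of _ P]) auto
qed

text \<open>Both sets are exhausted from inside by box families: sums of inner approximations stay
  inside \<open>sumset A B\<close>, and the left side is continuous in the two volumes. Openness
  also settles the measurability of the sum.\<close>

theorem Brunn_Minkowski_open:
  fixes A B :: "'a::euclidean_space set"
  assumes A: "open A" "bounded A" "A \<noteq> {}" and B: "open B" "bounded B" "B \<noteq> {}"
  shows "(root DIM('a) (measure lborel A) + root DIM('a) (measure lborel B)) ^ DIM('a)
           \<le> measure lborel (sumset A B)"
proof -
  let ?n = "DIM('a)" and ?m = "measure lborel :: 'a set \<Rightarrow> real"
  have approx: "\<exists>a. a \<longlonglongrightarrow> ?m C \<and> (\<forall>k. \<exists>P. box_family P \<and> P \<noteq> {} \<and> \<Union>P \<subseteq> C \<and> ?m (\<Union>P) = a k)"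
    if C: "open C" "bounded C" "C \<noteq> {}" for C :: "'a set"
  proof -
    have fin: "emeasure lborel C < \<infinity>" using C emeasure_bounded_finite by blast
    have pos: "?m C > 0" using C fin by (intro measure_open_pos)
    have "\<exists>P. box_family P \<and> \<Union>P \<subseteq> C \<and> max 0 (?m C - 1 / real (Suc k)) < ?m (\<Union>P)" for k
      using pos C fin by (intro open_approx_box_family) auto
    then obtain P where P: "\<And>k. box_family (P k)" "\<And>k. \<Union>(P k) \<subseteq> C" "\<And>k. max 0 (?m C - 1 / real (Suc k)) < ?m (\<Union>(P k))"
      by metis
    have le: "?m (\<Union>(P k)) \<le> ?m C" for k
      using P C fin open_Union_box_family[OF P(1)]
      by (intro measure_mono_fmeasurable) (auto simp: fmeasurable_def borel_open)
    have "(\<lambda>k. ?m (\<Union>(P k))) \<longlonglongrightarrow> ?m C"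
    proof (rule tendsto_sandwich)
      show "(\<lambda>k. ?m C - 1 / real (Suc k)) \<longlonglongrightarrow> ?m C"
        using tendsto_diff[OF tendsto_const LIMSEQ_inverse_real_of_nat, of "?m C"] by (simp add: inverse_eq_divide)
      show "\<forall>\<^sub>F k in sequentially. ?m C - 1 / real (Suc k) \<le> ?m (\<Union>(P k))"
        using P(3) by (intro always_eventually allI) (meson less_imp_le max_less_iff_conj)
    qed (use le in auto)
    moreover have "P k \<noteq> {}" for k using P(3)[of k] by auto
    ultimately show ?thesis using P by (intro exI[of _ "\<lambda>k. ?m (\<Union>(P k))"]) metis
  qed
  obtain a where a: "a \<longlonglongrightarrow> ?m A" "\<And>k. \<exists>P. box_family P \<and> P \<noteq> {} \<and> \<Union>P \<subseteq> A \<and> ?m (\<Union>P) = a k"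
    using approx[OF A] by blast
  obtain b where b: "b \<longlonglongrightarrow> ?m B" "\<And>k. \<exists>P. box_family P \<and> P \<noteq> {} \<and> \<Union>P \<subseteq> B \<and> ?m (\<Union>P) = b k"
    using approx[OF B] by blast
  have fin: "emeasure lborel (sumset A B) < \<infinity>"
    using A B by (intro emeasure_bounded_finite bounded_sums)
  have op: "open (sumset A B)" using A by (intro open_sums disjI1)
  have "(root ?n (a k) + root ?n (b k)) ^ ?n \<le> ?m (sumset A B)" for k
  proof -
    obtain P where P: "box_family P" "P \<noteq> {}" "\<Union>P \<subseteq> A" "?m (\<Union>P) = a k" using a(2) by blast
    obtain Q where Q: "box_family Q" "Q \<noteq> {}" "\<Union>Q \<subseteq> B" "?m (\<Union>Q) = b k" using b(2) by blast
    have "(root ?n (a k) + root ?n (b k)) ^ ?n \<le> ?m (sumset (\<Union>P) (\<Union>Q))"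
      using Brunn_Minkowski_box_families[OF P(1) Q(1) P(2) Q(2)] P(4) Q(4) by simp
    also have "\<dots> \<le> ?m (sumset A B)"
    proof (rule measure_mono_fmeasurable)
      show "sumset (\<Union>P) (\<Union>Q) \<subseteq> sumset A B" using P(3) Q(3) by (intro UN_mono) auto
      have "open (sumset (\<Union>P) (\<Union>Q))" using open_Union_box_family[OF P(1)] by (intro open_sums disjI1)
      thus "sumset (\<Union>P) (\<Union>Q) \<in> sets lborel" by (simp only: sets_lborel borel_open)
      show "sumset A B \<in> fmeasurable lborel" using op fin by (simp only: fmeasurable_def mem_Collect_eq sets_lborel borel_open)
    qed
    finally show ?thesis .
  qed
  moreover have "(\<lambda>k. (root ?n (a k) + root ?n (b k)) ^ ?n) \<longlonglongrightarrow> (root ?n (?m A) + root ?n (?m B)) ^ ?n"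
    using a(1) b(1) by (intro tendsto_intros)
  ultimately show ?thesis by (intro LIMSEQ_le_const2) auto
qed

section \<open>Growth of volume under thickening\<close>

lemma measure_ball_power:
  fixes c :: "'a::euclidean_space"
  assumes "0 \<le> r"
  shows "measure lborel (ball c r) = unit_ball_vol (real DIM('a)) * r ^ DIM('a)"
  using content_ball[OF assms, of c] by simp

text \<open>The factor of \<open>e\<close> is the perimeter of the ball with the volume of
  \<open>A\<close>. Brunn-Minkowski with a ball of radius \<open>e\<close> gives w (r + e)^n, of
  which the first two binomial terms are kept; the bound therefore holds for every \<open>e\<close>
  and not only in the limit.\<close>

lemma measure_parallel_body_ge:
  fixes A :: "'a::euclidean_space set"
  defines "w \<equiv> unit_ball_vol (real DIM('a))"
  assumes A: "open A" "bounded A" "A \<noteq> {}" and r: "0 \<le> r" "measure lborel A = w * r ^ DIM('a)" and e: "0 < e"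
  shows "w * r ^ DIM('a) + e * (real DIM('a) * w * r ^ (DIM('a) - 1)) \<le> measure lborel (sumset A (ball 0 e))"
proof -
  let ?n = "DIM('a)" and ?m = "measure lborel :: 'a set \<Rightarrow> real"
  have n: "?n > 0" by simp
  have w: "w > 0" by (simp add: w_def)
  have rt: "root ?n (w * s ^ ?n) = root ?n w * s" if "s \<ge> 0" for s
    using that n by (simp add: real_root_mult real_root_power_cancel)
  have "w * (r + e) ^ ?n = (root ?n w * (r + e)) ^ ?n" using w by (simp add: power_mult_distrib)
  also have "\<dots> = (root ?n (?m A) + root ?n (?m (ball 0 e))) ^ ?n"
    using r e rt[of r] rt[of e] by (simp add: measure_ball_power w_def algebra_simps)
  also have "\<dots> \<le> ?m (sumset A (ball 0 e))"
    using A e by (intro Brunn_Minkowski_open) auto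
  finally have 1: "w * (r + e) ^ ?n \<le> ?m (sumset A (ball 0 e))" .
  have "r ^ k + e * (real k * r ^ (k - 1)) \<le> (r + e) ^ k" for k
  proof (induction k)
    case (Suc k)
    have "r ^ Suc k + e * (real (Suc k) * r ^ (Suc k - 1)) \<le> (r + e) * (r ^ k + e * (real k * r ^ (k - 1)))"
    proof -
      have "0 \<le> e * (e * (real k * r ^ (k - 1)))" using e r by simp
      thus ?thesis by (cases k) (simp_all add: algebra_simps)
    qed
    also have "\<dots> \<le> (r + e) ^ Suc k" using Suc r e by (simp add: mult_left_mono)
    finally show ?case .
  qed auto
  from mult_left_mono[OF this[of ?n] less_imp_le[OF w]] 1 show ?thesis by (simp add: algebra_simps)
qed

section \<open>Superlevel sets and the isoperimetric inequality\<close>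

text \<open>The rate |x|^(n-2) is |x|^(2m). It bounds the superlevel sets and keeps z^2 v(z)
  bounded, which makes powers of G integrable against dz/z at infinity.\<close>

locale decaying_function =
  fixes u :: "'a::euclidean_space \<Rightarrow> real"
  assumes dim: "DIM('a) \<ge> 3"
    and cont_u: "continuous_on UNIV u"
    and nonneg_u: "0 \<le> u x"
    and decay: "\<exists>K. \<forall>x. norm x ^ (DIM('a) - 2) * u x \<le> K"
begin

lemma bounded_superlevel:
  assumes t: "0 < t"
  shows "bounded {x. t < u x}"
proof -
  obtain K where K: "\<And>x. norm x ^ (DIM('a) - 2) * u x \<le> K" using decay by blast
  have "norm x \<le> max 1 (K / t)" if x: "t < u x" for x
  proof (cases "norm x \<le> 1")
    case False
    have "DIM('a) - 2 \<noteq> 0" using dim by simp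
    hence "norm x \<le> norm x ^ (DIM('a) - 2)" using False by (intro self_le_power) auto
    also have "\<dots> = norm x ^ (DIM('a) - 2) * t / t" using t by simp
    also have "\<dots> \<le> norm x ^ (DIM('a) - 2) * u x / t"
      using t x by (intro divide_right_mono mult_left_mono) auto
    also have "\<dots> \<le> K / t" using t K[of x] by (intro divide_right_mono) auto
    finally show ?thesis by simp
  qed simp
  thus ?thesis unfolding bounded_iff by blast
qed

definition "w = unit_ball_vol (real DIM('a))"

definition "\<mu> t = measure lborel {x. t < u x}"

text \<open>Radius of the ball with the volume of the superlevel set; \<open>perim\<close> is the
  surface area of that ball.\<close>

definition "rad t = root DIM('a) (\<mu> t / w)"

definition "perim t = real DIM('a) * w * rad t ^ (DIM('a) - 1)"

lemma w_pos: "w > 0" by (simp add: w_def)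

lemma open_superlevel: "open {x. t < u x}"
  using cont_u by (intro open_Collect_less) auto

lemma u_borel [measurable]: "u \<in> borel_measurable borel"
  using cont_u by (rule borel_measurable_continuous_onI)

lemma rad_nonneg: "0 \<le> rad t"
  unfolding rad_def \<mu>_def using w_pos by (intro real_root_ge_zero divide_nonneg_nonneg) auto

lemma \<mu>_eq_rad: "\<mu> t = w * rad t ^ DIM('a)"
  using w_pos by (simp add: rad_def \<mu>_def)

lemma emeasure_superlevel: "0 < t \<Longrightarrow> emeasure lborel {x. t < u x} = ennreal (\<mu> t)"
  unfolding \<mu>_def using emeasure_bounded_finite[OF bounded_superlevel[of t]]
  by (intro emeasure_eq_ennreal_measure) auto

lemma \<mu>_antimono: "0 < s \<Longrightarrow> s \<le> t \<Longrightarrow> \<mu> t \<le> \<mu> s"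
  unfolding \<mu>_def using emeasure_bounded_finite[OF bounded_superlevel[of s]]
  by (intro measure_mono_fmeasurable) (auto simp: fmeasurable_def borel_open open_superlevel)

lemma rad_antimono: "0 < s \<Longrightarrow> s \<le> t \<Longrightarrow> rad t \<le> rad s"
  unfolding rad_def using \<mu>_antimono[of s t] w_pos by (simp add: divide_right_mono)

lemma \<mu>_borel [measurable]: "\<mu> \<in> borel_measurable borel"
proof -
  have "(\<lambda>t. emeasure lborel {x. t < u x}) \<in> borel_measurable lborel" by measurable
  thus ?thesis unfolding \<mu>_def measure_def by measurable
qed

lemma rad_borel [measurable]: "rad \<in> borel_measurable borel" "perim \<in> borel_measurable borel"
  unfolding perim_def[abs_def] rad_def[abs_def] by measurable

lemma perim_nonneg: "0 \<le> perim t"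
  unfolding perim_def using w_pos rad_nonneg by simp

text \<open>The outer collar of width \<open>e\<close> around {u > \<tau>}, i.e. what thickening
  adds. The pointwise form makes joint measurability in \<open>x\<close> and \<open>\<tau>\<close>
  visible: the first condition is closed, the second open.\<close>

definition "shell e \<tau> = {x. u x \<le> \<tau> \<and> (\<exists>y. dist x y < e \<and> \<tau> < u y)}"

lemma shell_pair_measurable: "{p::'a \<times> real. fst p \<in> shell e (snd p)} \<in> sets borel"
proof -
  have "{p. \<exists>y. dist (fst p) y < e \<and> snd p < u y} = (\<Union>y. ball y e \<times> {..<u y})"
    by (auto simp: dist_commute)
  hence o: "open {p. \<exists>y. dist (fst p) y < e \<and> snd p < u y}" by (auto intro!: open_Times)
  have "continuous_on UNIV (\<lambda>p::'a \<times> real. u (fst p))"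
    by (intro continuous_on_compose2[OF cont_u]) (auto intro!: continuous_intros)
  hence c: "closed {p::'a \<times> real. u (fst p) \<le> snd p}" by (intro closed_Collect_le) (auto intro!: continuous_intros)
  have "{p::'a \<times> real. fst p \<in> shell e (snd p)} =
      {p. u (fst p) \<le> snd p} \<inter> {p. \<exists>y. dist (fst p) y < e \<and> snd p < u y}"
    by (auto simp: shell_def)
  thus ?thesis using borel_open[OF o] borel_closed[OF c] by simp
qed

lemma emeasure_shell_ge:
  assumes \<tau>: "0 < \<tau>" and e: "0 < e"
  shows "ennreal (e * perim \<tau>) \<le> emeasure lborel (shell e \<tau>)"
proof (cases "{x. \<tau> < u x} = {}")
  case True
  hence "rad \<tau> = 0" by (simp add: rad_def \<mu>_def)
  \<comment> \<open>The exponent has to be positive: \<open>0 ^ 0 = 1\<close> would give an empty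
    level set a positive perimeter.\<close>
  moreover have "DIM('a) - 1 > 0" using dim by linarith
  ultimately show ?thesis by (simp add: perim_def power_0_left)
next
  case False
  let ?A = "{x. \<tau> < u x}"
  have bd: "bounded ?A" using bounded_superlevel[OF \<tau>] .
  have o: "open (sumset ?A (ball 0 e))" by (intro open_sums disjI1 open_superlevel)
  have b: "bounded (sumset ?A (ball 0 e))" using bd by (intro bounded_sums) auto
  have sub: "?A \<subseteq> sumset ?A (ball 0 e)"
  proof
    fix x assume "x \<in> ?A"
    thus "x \<in> sumset ?A (ball 0 e)" using e by (intro UN_I[of x] UN_I[of 0]) auto
  qed
  have "shell e \<tau> = sumset ?A (ball 0 e) - ?A"
  proof (intro set_eqI iffI)
    fix x assume "x \<in> shell e \<tau>"
    then obtain y where "u x \<le> \<tau>" "dist x y < e" "\<tau> < u y" by (auto simp: shell_def)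
    hence "y \<in> ?A" "x - y \<in> ball 0 e" "x = y + (x - y)" "x \<notin> ?A" by (auto simp: dist_norm norm_minus_commute)
    thus "x \<in> sumset ?A (ball 0 e) - ?A" by (intro DiffI UN_I[of y] UN_I[of "x - y"]) auto
  next
    fix x assume "x \<in> sumset ?A (ball 0 e) - ?A"
    then obtain y z where "\<tau> < u y" "norm z < e" "x = y + z" "u x \<le> \<tau>" by auto
    thus "x \<in> shell e \<tau>" by (auto simp: shell_def dist_norm intro!: exI[of _ y])
  qed
  moreover have "measure lborel (sumset ?A (ball 0 e) - ?A) = measure lborel (sumset ?A (ball 0 e)) - measure lborel ?A"
  proof (rule measure_Diff)
    show "emeasure lborel (sumset ?A (ball 0 e)) \<noteq> \<infinity>" using emeasure_bounded_finite[OF b] by (rule less_imp_neq)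
    show "sumset ?A (ball 0 e) \<in> sets lborel" using borel_open[OF o] by (simp only: sets_lborel)
    show "?A \<in> sets lborel" by measurable
    show "?A \<subseteq> sumset ?A (ball 0 e)" by (rule sub)
  qed
  moreover have "w * rad \<tau> ^ DIM('a) + e * perim \<tau> \<le> measure lborel (sumset ?A (ball 0 e))"
    unfolding w_def perim_def
    by (rule measure_parallel_body_ge[OF open_superlevel bd False rad_nonneg])
       (use \<mu>_eq_rad[of \<tau>] e in \<open>auto simp: \<mu>_def w_def\<close>)
  moreover have "measure lborel ?A = w * rad \<tau> ^ DIM('a)" using \<mu>_eq_rad[of \<tau>] by (simp add: \<mu>_def)
  ultimately have "e * perim \<tau> \<le> measure lborel (shell e \<tau>)" by (simp add: perim_def)
  moreover have "emeasure lborel (shell e \<tau>) = ennreal (measure lborel (shell e \<tau>))"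
  proof -
    have "bounded (shell e \<tau>)" using b \<open>shell e \<tau> = _\<close> by (auto intro: bounded_subset)
    thus ?thesis using emeasure_bounded_finite[of "shell e \<tau>"] by (intro emeasure_eq_ennreal_measure) auto
  qed
  ultimately show ?thesis by (simp add: ennreal_leI)
qed

end

text \<open>\<open>g\<close> bounds only how fast \<open>u\<close> can grow away from a point; for u
  = |f| such a bound is available even at zeros of \<open>f\<close>. The integrable \<open>h\<close>
  is a Lipschitz bound at unit scale and supplies domination.\<close>

locale decaying_function_slope = decaying_function u
  for u :: "'a::euclidean_space \<Rightarrow> real" +
  fixes g h :: "'a \<Rightarrow> real"
  assumes g_nonneg: "0 \<le> g x" and g_borel [measurable]: "g \<in> borel_measurable borel"
    and g_slope: "0 < \<delta> \<Longrightarrow> \<forall>\<^sub>F e in at_right 0. \<forall>y. dist x y < e \<longrightarrow> u y \<le> u x + e * (g x + \<delta>)"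
    and h_borel [measurable]: "h \<in> borel_measurable borel"
    and g_le_h: "g x \<le> h x"
    and h_finite: "(\<integral>\<^sup>+x. ennreal (h x) \<partial>lborel) < \<infinity>"
    and h_lip: "dist x y < 1 \<Longrightarrow> u y \<le> u x + dist x y * h x"
begin

lemma h_nonneg: "0 \<le> h x"
  using g_nonneg[of x] g_le_h[of x] by linarith

text \<open>A coarea inequality. Integrate \<open>emeasure_shell_ge\<close> over the levels in [s,
  t) and exchange the integrals: for fixed \<open>x\<close>, the levels whose collar contains
  \<open>x\<close> lie between u(x) and about u(x) + e g(x). Divide by \<open>e\<close> and let it
  tend to 0.\<close>

lemma isoperimetric_interval:
  assumes st: "0 < s" "s < t"
  shows "(\<integral>\<^sup>+\<tau>. ennreal (perim \<tau>) * indicator {s..<t} \<tau> \<partial>lborel)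
         \<le> (\<integral>\<^sup>+x. ennreal (g x) * indicator {x. s \<le> u x \<and> u x < t} x \<partial>lborel)"
    (is "?V \<le> ?G")
proof -
  define e where "e k = 1 / real (Suc (Suc k))" for k
  have e: "0 < e k" "e k < 1" for k by (auto simp: e_def field_simps)
  have e0: "filterlim e (at_right 0) sequentially"
  proof -
    have "e \<longlonglongrightarrow> 0" unfolding e_def
      using LIMSEQ_Suc[OF LIMSEQ_inverse_real_of_nat] by (simp add: inverse_eq_divide)
    moreover have "e k \<noteq> 0" for k using e(1)[of k] by simp
    ultimately show ?thesis using e by (auto simp: filterlim_at intro!: always_eventually)
  qed
  define S where "S k x \<tau> = (indicator {s..<t} \<tau> * indicator {p::'a\<times>real. fst p \<in> shell (e k) (snd p)} (x, \<tau>) :: ennreal)" for k x \<tau>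
  have [measurable]: "{p::'a\<times>real. fst p \<in> shell (e k) (snd p)} \<in> sets (borel \<Otimes>\<^sub>M borel)" for k
    unfolding borel_prod by (rule shell_pair_measurable)
  have Sm [measurable]: "(\<lambda>p. S k (fst p) (snd p)) \<in> borel_measurable (borel \<Otimes>\<^sub>M borel)" for k
    unfolding S_def by measurable
  have Sm1 [measurable]: "S k x \<in> borel_measurable borel" for k x
    using measurable_compose[OF _ Sm, of "\<lambda>y. (x, y)" borel k] by simp
  have Sm2 [measurable]: "(\<lambda>x. S k x \<tau>) \<in> borel_measurable borel" for k \<tau>
    using measurable_compose[OF _ Sm, of "\<lambda>x. (x, \<tau>)" borel k] by simp
  have Sm' [measurable]: "(\<lambda>(x, \<tau>). S k x \<tau>) \<in> borel_measurable (lborel \<Otimes>\<^sub>M lborel)" for k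
  proof -
    have "sets (lborel \<Otimes>\<^sub>M lborel :: ('a \<times> real) measure) = sets (borel \<Otimes>\<^sub>M borel)" by (intro sets_pair_measure_cong) auto
    with Sm show ?thesis by (simp add: case_prod_beta' cong: measurable_cong_sets)
  qed
  \<comment> \<open>The length of the set of levels in [s, t) whose collar of width
    \<open>e k\<close> contains \<open>x\<close>, divided by \<open>e k\<close>.\<close>
  define F where "F k x = ennreal (1 / e k) * (\<integral>\<^sup>+\<tau>. S k x \<tau> \<partial>lborel)" for k x
  have Fm [measurable]: "F k \<in> borel_measurable lborel" for k
  proof -
    have "(\<lambda>x. \<integral>\<^sup>+\<tau>. S k x \<tau> \<partial>lborel) \<in> borel_measurable lborel"
      using Sm' by (rule lborel.borel_measurable_nn_integral)
    thus ?thesis unfolding F_def by measurable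
  qed
  have Vle: "?V \<le> (\<integral>\<^sup>+x. F k x \<partial>lborel)" for k
  proof -
    have "(\<integral>\<^sup>+x. F k x \<partial>lborel) = ennreal (1 / e k) * (\<integral>\<^sup>+x. \<integral>\<^sup>+\<tau>. S k x \<tau> \<partial>lborel \<partial>lborel)"
      unfolding F_def by (intro nn_integral_cmult lborel.borel_measurable_nn_integral Sm')
    also have "(\<integral>\<^sup>+x. \<integral>\<^sup>+\<tau>. S k x \<tau> \<partial>lborel \<partial>lborel) = (\<integral>\<^sup>+\<tau>. \<integral>\<^sup>+x. S k x \<tau> \<partial>lborel \<partial>lborel)"
      using lborel_pair.Fubini'[OF Sm'] by simp
    also have "ennreal (1 / e k) * \<dots> = (\<integral>\<^sup>+\<tau>. ennreal (1 / e k) * (\<integral>\<^sup>+x. S k x \<tau> \<partial>lborel) \<partial>lborel)"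
    proof (rule nn_integral_cmult[symmetric])
      show "(\<lambda>\<tau>. \<integral>\<^sup>+x. S k x \<tau> \<partial>lborel) \<in> borel_measurable lborel"
        using measurable_pair_swap[OF Sm', of k] lborel.borel_measurable_nn_integral[of "\<lambda>\<tau> x. S k x \<tau>" lborel]
        by (simp add: case_prod_beta')
    qed
    finally have eq: "(\<integral>\<^sup>+x. F k x \<partial>lborel) = (\<integral>\<^sup>+\<tau>. ennreal (1 / e k) * (\<integral>\<^sup>+x. S k x \<tau> \<partial>lborel) \<partial>lborel)" .
    show ?thesis unfolding eq
    proof (rule nn_integral_mono)
      fix \<tau> :: real
      show "ennreal (perim \<tau>) * indicator {s..<t} \<tau> \<le> ennreal (1 / e k) * (\<integral>\<^sup>+x. S k x \<tau> \<partial>lborel)"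
      proof (cases "\<tau> \<in> {s..<t}")
        case True
        have sh: "shell (e k) \<tau> \<in> sets lborel"
        proof -
          have "(\<lambda>x. (x, \<tau>)) -` {p::'a\<times>real. fst p \<in> shell (e k) (snd p)} \<inter> space borel \<in> sets (borel::'a measure)"
            by (rule measurable_sets[where A = "borel \<Otimes>\<^sub>M borel"]) auto
          thus ?thesis by (simp add: vimage_def)
        qed
        have "(\<integral>\<^sup>+x. S k x \<tau> \<partial>lborel) = emeasure lborel (shell (e k) \<tau>)"
        proof -
          have "(\<integral>\<^sup>+x. S k x \<tau> \<partial>lborel) = (\<integral>\<^sup>+x. indicator (shell (e k) \<tau>) x \<partial>lborel)"
            using True by (intro nn_integral_cong) (auto simp: S_def indicator_def)
          thus ?thesis using sh by simp
        qed
        moreover have "ennreal (e k * perim \<tau>) \<le> emeasure lborel (shell (e k) \<tau>)"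
          using True st e by (intro emeasure_shell_ge) auto
        ultimately have "ennreal (1 / e k) * ennreal (e k * perim \<tau>) \<le> ennreal (1 / e k) * (\<integral>\<^sup>+x. S k x \<tau> \<partial>lborel)"
          by (intro mult_left_mono) auto
        moreover have "ennreal (1 / e k) * ennreal (e k * perim \<tau>) = ennreal (perim \<tau>)"
          using e[of k] perim_nonneg[of \<tau>] by (subst ennreal_mult[symmetric]) auto
        ultimately show ?thesis using True by simp
      qed auto
    qed
  qed
  have Fle: "F k x \<le> ennreal c" if c: "0 \<le> c" and S: "\<And>\<tau>. s \<le> \<tau> \<Longrightarrow> \<tau> < t \<Longrightarrow> x \<in> shell (e k) \<tau> \<Longrightarrow> \<tau> < u x + e k * c" for k x c
  proof -
    have "(\<integral>\<^sup>+\<tau>. S k x \<tau> \<partial>lborel) \<le> (\<integral>\<^sup>+\<tau>. indicator {u x..<u x + e k * c} \<tau> \<partial>lborel)"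
      using S by (intro nn_integral_mono) (auto simp: S_def indicator_def shell_def)
    also have "\<dots> = ennreal (e k * c)" using e[of k] c by simp
    finally have "F k x \<le> ennreal (1 / e k) * ennreal (e k * c)" unfolding F_def by (intro mult_left_mono) auto
    also have "\<dots> = ennreal c" using e[of k] c by (subst ennreal_mult[symmetric]) auto
    finally show ?thesis .
  qed
  have dom: "F k x \<le> ennreal (h x)" for k x
  proof (rule Fle[OF h_nonneg])
    fix \<tau> assume "x \<in> shell (e k) \<tau>"
    then obtain y where y: "dist x y < e k" "\<tau> < u y" by (auto simp: shell_def)
    have "u y \<le> u x + dist x y * h x" using y e[of k] by (intro h_lip) linarith
    also have "\<dots> \<le> u x + e k * h x" using y h_nonneg[of x] by (intro add_left_mono mult_right_mono) auto
    finally show "\<tau> < u x + e k * h x" using y by linarith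
  qed
  \<comment> \<open>If u(x) \<ge> t no level qualifies, since a collar lies outside its superlevel
    set. If u(x) < s, continuity keeps all nearby values below \<open>s\<close>. The slope matters
    only in between.\<close>
  have lim: "limsup (\<lambda>k. F k x) \<le> ennreal (g x) * indicator {x. s \<le> u x \<and> u x < t} x" for x
  proof -
    consider "u x \<ge> t" | "u x < s" | "s \<le> u x" "u x < t" by linarith
    thus ?thesis
    proof cases
      case 1
      have "F k x \<le> ennreal 0" for k using 1 by (intro Fle) (auto simp: shell_def)
      hence "limsup (\<lambda>k. F k x) \<le> ennreal 0" by (intro Limsup_bounded always_eventually) auto
      thus ?thesis by simp
    next
      case 2
      have "\<forall>\<^sub>F y in nhds x. u y < s"
        using cont_u 2 by (intro order_tendstoD(2)[of u "u x"]) (auto simp: continuous_on_eq_continuous_at isCont_def tendsto_at_iff_tendsto_nhds)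
      then obtain d where d: "d > 0" "\<And>y. dist y x < d \<Longrightarrow> u y < s" by (auto simp: eventually_nhds_metric)
      have "\<forall>\<^sub>F k in sequentially. e k < d"
        using e0 d(1) by (auto simp: filterlim_at intro: order_tendstoD)
      hence "\<forall>\<^sub>F k in sequentially. F k x \<le> ennreal 0"
      proof eventually_elim
        case (elim k)
        show ?case
        proof (rule Fle)
          fix \<tau> assume \<tau>: "s \<le> \<tau>" "x \<in> shell (e k) \<tau>"
          then obtain y where "dist x y < e k" "\<tau> < u y" by (auto simp: shell_def)
          with d(2)[of y] elim \<tau>(1) show "\<tau> < u x + e k * 0" by (simp add: dist_commute)
        qed auto
      qed
      hence "limsup (\<lambda>k. F k x) \<le> ennreal 0" by (intro Limsup_bounded) auto
      thus ?thesis by simp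
    next
      case 3
      have eps: "limsup (\<lambda>k. F k x) \<le> ennreal (g x) + ennreal \<delta>" if "\<delta> > 0" for \<delta>
      proof -
        have "\<forall>\<^sub>F k in sequentially. \<forall>y. dist x y < e k \<longrightarrow> u y \<le> u x + e k * (g x + \<delta>)"
          using g_slope[OF that, of x] e0 by (rule eventually_compose_filterlim)
        hence "\<forall>\<^sub>F k in sequentially. F k x \<le> ennreal (g x + \<delta>)"
        proof eventually_elim
          case (elim k)
          show ?case
          proof (rule Fle)
            show "0 \<le> g x + \<delta>" using g_nonneg[of x] that by simp
            fix \<tau> assume "x \<in> shell (e k) \<tau>"
            then obtain y where "dist x y < e k" "\<tau> < u y" by (auto simp: shell_def)
            with elim show "\<tau> < u x + e k * (g x + \<delta>)" by (meson order_less_le_trans)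
          qed
        qed
        hence "limsup (\<lambda>k. F k x) \<le> ennreal (g x + \<delta>)" by (intro Limsup_bounded)
        thus ?thesis using that g_nonneg[of x] by simp
      qed
      have "limsup (\<lambda>k. F k x) \<le> ennreal (g x)" by (rule ennreal_le_epsilon, rule eps)
      thus ?thesis using 3 by simp
    qed
  qed
  \<comment> \<open>Each \<open>F k\<close> has integral at least \<open>?V\<close>; the limit is
    taken by the reverse Fatou lemma with dominating function \<open>h\<close>.\<close>
  have "?V \<le> limsup (\<lambda>k. \<integral>\<^sup>+x. F k x \<partial>lborel)"
  proof -
    have "limsup (\<lambda>k::nat. ?V) \<le> limsup (\<lambda>k. \<integral>\<^sup>+x. F k x \<partial>lborel)"
      using Vle by (intro Limsup_mono always_eventually) auto
    thus ?thesis by (simp add: Limsup_const)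
  qed
  also have "\<dots> \<le> (\<integral>\<^sup>+x. limsup (\<lambda>k. F k x) \<partial>lborel)"
    using dom h_finite by (intro nn_integral_limsup[where w = "\<lambda>x. ennreal (h x)"]) auto
  also have "\<dots> \<le> ?G" using lim by (intro nn_integral_mono) auto
  finally show ?thesis .
qed

end

text \<open>A compact subset of the positive half-line is covered by finitely many cells of a fine
  half-open grid inside any given neighbourhood; this bounds \<open>M2\<close> on compact sets by
  \<open>M1\<close> on open sets. Outer regularity of \<open>M1\<close> and inner regularity of
  \<open>M2\<close> do the rest.\<close>

lemma measure_le_of_intervals:
  fixes M1 M2 :: "real measure"
  assumes sets: "sets M1 = sets borel" "sets M2 = sets borel"
    and fin: "emeasure M1 UNIV \<noteq> \<infinity>" and null: "emeasure M2 {..0} = 0"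
    and le: "\<And>s t. 0 < s \<Longrightarrow> s < t \<Longrightarrow> emeasure M2 {s..<t} \<le> emeasure M1 {s..<t}"
  shows "M2 \<le> M1"
proof -
  have sp: "space M1 = UNIV" "space M2 = UNIV" using sets by (auto dest!: sets_eq_imp_space_eq)
  have [measurable_cong]: "sets M1 = sets borel" "sets M2 = sets borel" using sets by auto
  have pos: "emeasure M2 A = emeasure M2 (A \<inter> {0<..})" if [measurable]: "A \<in> sets borel" for A
  proof -
    have "emeasure M2 A = emeasure M2 (A \<inter> {0<..} \<union> (A \<inter> {..0}))"
      by (intro arg_cong[where f = "emeasure M2"]) auto
    also have "\<dots> = emeasure M2 (A \<inter> {0<..})"
    proof (rule emeasure_Un_null_set)
      have "emeasure M2 (A \<inter> {..0}) \<le> emeasure M2 {..0}" by (rule emeasure_mono) (auto simp: sets)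
      thus "A \<inter> {..0} \<in> null_sets M2" using null by (auto simp: null_sets_def sets)
    qed (auto simp: sets)
    finally show ?thesis .
  qed
  \<comment> \<open>Inner regularity is applied to the finite measure \<open>M2\<close>; its
    finiteness comes from intervals exhausting the positive half-line.\<close>
  have fin2: "emeasure M2 UNIV \<noteq> \<infinity>"
  proof -
    define J where "J k = {1 / real (Suc k)..<real (Suc (Suc k))}" for k
    have inc: "incseq J"
    proof (rule incseq_SucI)
      fix k show "J k \<subseteq> J (Suc k)" unfolding J_def by (auto intro: order_trans[rotated] simp: field_simps)
    qed
    have UN: "(\<Union>k. J k) = {0<..}"
    proof (intro set_eqI iffI)
      fix x :: real assume x: "x \<in> {0<..}"
      obtain k where k: "1 / x < real k" using reals_Archimedean2 by blast
      obtain l where l: "x < real l" using reals_Archimedean2 by blast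
      have "1 / x \<le> real (Suc (k + l))" using k by simp
      hence "1 / real (Suc (k + l)) \<le> x" using x by (simp add: field_simps)
      hence "x \<in> J (k + l)" using l by (simp add: J_def)
      thus "x \<in> (\<Union>k. J k)" by blast
    qed (auto simp: J_def intro: order_less_le_trans[rotated])
    have "emeasure M2 UNIV = emeasure M2 {0<..}" using pos[of UNIV] by simp
    also have "\<dots> = (SUP k. emeasure M2 (J k))"
    proof -
      have "range J \<subseteq> sets M2" by (auto simp: sets J_def)
      from SUP_emeasure_incseq[OF this inc] UN show ?thesis by simp
    qed
    also have "\<dots> \<le> emeasure M1 UNIV"
    proof (rule SUP_least)
      fix k
      have "1 / real (Suc k) \<le> 1" by simp
      also have "(1::real) < real (Suc (Suc k))" by simp
      finally have "emeasure M2 (J k) \<le> emeasure M1 (J k)" unfolding J_def by (intro le) auto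
      also have "\<dots> \<le> emeasure M1 UNIV" by (intro emeasure_mono) (auto simp: sets)
      finally show "emeasure M2 (J k) \<le> emeasure M1 UNIV" .
    qed
    finally show ?thesis using fin by (auto simp: top_unique)
  qed
  have compact_le: "emeasure M2 K \<le> emeasure M1 K" if K: "compact K" "K \<subseteq> {0<..}" for K
  proof -
    have Kb: "K \<in> sets borel" using K by (simp add: borel_compact)
    have "emeasure M2 K \<le> emeasure M1 U" if U: "K \<subseteq> U" "open U" for U
    proof -
      have "open (U \<inter> {0<..})" "K \<subseteq> U \<inter> {0<..}" using U K by auto
      then obtain d where d: "d > 0" "(\<Union>x\<in>K. ball x d) \<subseteq> U \<inter> {0<..}"
        using compact_subset_open_imp_ball_epsilon_subset[OF K(1)] by metis
      \<comment> \<open>A cell width below \<open>d\<close>, so that a cell meeting \<open>K\<close>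
        stays in the \<open>d\<close>-neighbourhood of \<open>K\<close>.\<close>
      define c where "c = d / 2"
      have c: "0 < c" "c < d" using d by (auto simp: c_def)
      define I where "I k = {real_of_int k * c..<(real_of_int k + 1) * c}" for k
      define F where "F = (\<lambda>x. \<lfloor>x / c\<rfloor>) ` K"
      have xI: "x \<in> I \<lfloor>x / c\<rfloor>" for x
      proof -
        have "real_of_int \<lfloor>x / c\<rfloor> \<le> x / c" "x / c < real_of_int \<lfloor>x / c\<rfloor> + 1" by linarith+
        hence "real_of_int \<lfloor>x / c\<rfloor> * c \<le> x" "x < (real_of_int \<lfloor>x / c\<rfloor> + 1) * c"
          using c by (simp_all only: pos_le_divide_eq pos_divide_less_eq)
        thus ?thesis by (simp add: I_def)
      qed
      obtain B where B: "\<And>x. x \<in> K \<Longrightarrow> \<bar>x\<bar> \<le> B"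
        using compact_imp_bounded[OF K(1)] by (auto simp: bounded_iff)
      have finF: "finite F"
      proof (rule finite_subset)
        show "F \<subseteq> {\<lfloor>- B / c\<rfloor>..\<lfloor>B / c\<rfloor>}"
        proof
          fix k assume "k \<in> F"
          then obtain x where x: "x \<in> K" "k = \<lfloor>x / c\<rfloor>" by (auto simp: F_def)
          have "- B \<le> x" "x \<le> B" using B[OF x(1)] by auto
          hence "- B / c \<le> x / c" "x / c \<le> B / c" using c by (intro divide_right_mono; simp)+
          thus "k \<in> {\<lfloor>- B / c\<rfloor>..\<lfloor>B / c\<rfloor>}" using floor_mono x(2) by auto
        qed
      qed simp
      have IU: "I k \<subseteq> U \<inter> {0<..}" if kF: "k \<in> F" for k
      proof
        fix y assume y: "y \<in> I k"
        obtain x where x: "x \<in> K" "k = \<lfloor>x / c\<rfloor>" using kF by (auto simp: F_def)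
        have "\<bar>x - y\<bar> < d" using xI[of x] y x c by (auto simp: I_def algebra_simps)
        hence "y \<in> ball x d" by (simp add: dist_real_def)
        thus "y \<in> U \<inter> {0<..}" using d x by blast
      qed
      have disj: "disjoint_family_on I F"
        unfolding disjoint_family_on_def
      proof (intro ballI impI)
        fix k l :: int assume "k \<noteq> l"
        show "I k \<inter> I l = {}"
        proof (rule ccontr)
          assume "I k \<inter> I l \<noteq> {}"
          then obtain x where x: "x \<in> I k" "x \<in> I l" by blast
          have "\<lfloor>x / c\<rfloor> = j" if "x \<in> I j" for j
            using that c by (intro floor_unique) (auto simp: I_def field_simps)
          thus False using x \<open>k \<noteq> l\<close> by metis
        qed
      qed
      have Im: "I k \<in> sets M" if "sets M = sets borel" for k M using that by (simp add: I_def)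
      have "emeasure M2 K \<le> emeasure M2 (\<Union>k\<in>F. I k)"
      proof (rule emeasure_mono)
        show "K \<subseteq> (\<Union>k\<in>F. I k)" using xI by (auto simp: F_def)
        show "(\<Union>k\<in>F. I k) \<in> sets M2" using finF Im sets by (intro sets.finite_UN) auto
      qed
      also have "\<dots> = (\<Sum>k\<in>F. emeasure M2 (I k))"
        using finF disj Im sets by (intro sum_emeasure[symmetric]) auto
      also have "\<dots> \<le> (\<Sum>k\<in>F. emeasure M1 (I k))"
      proof (rule sum_mono)
        fix k assume k: "k \<in> F"
        have "real_of_int k * c \<in> I k" using c by (simp add: I_def)
        hence "0 < real_of_int k * c" using IU[OF k] by auto
        thus "emeasure M2 (I k) \<le> emeasure M1 (I k)"
          unfolding I_def using c by (intro le) (auto simp: algebra_simps)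
      qed
      also have "\<dots> = emeasure M1 (\<Union>k\<in>F. I k)"
        using finF disj Im sets by (intro sum_emeasure) auto
      also have "\<dots> \<le> emeasure M1 U"
        using IU U by (intro emeasure_mono) (auto simp: sets borel_open)
      finally show ?thesis .
    qed
    moreover have "emeasure M1 K = (INF U\<in>{U. K \<subseteq> U \<and> open U}. emeasure M1 U)"
      using fin sets sp Kb by (intro outer_regular) auto
    ultimately show ?thesis by (auto intro!: INF_greatest)
  qed
  show ?thesis
  proof (rule less_eq_measure.intros(3))
    show "space M2 = space M1" "sets M2 = sets M1" using sets sp by auto
    show "emeasure M2 \<le> emeasure M1"
    proof (rule le_funI)
      fix A
      show "emeasure M2 A \<le> emeasure M1 A"
      proof (cases "A \<in> sets borel")
        case [measurable]: True
        have "emeasure M2 A = emeasure M2 (A \<inter> {0<..})" by (rule pos) simp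
        also have "\<dots> = (SUP K\<in>{K. K \<subseteq> A \<inter> {0<..} \<and> compact K}. emeasure M2 K)"
          using fin2 sets sp by (intro inner_regular) auto
        also have "\<dots> \<le> emeasure M1 A"
        proof (rule SUP_least)
          fix K assume K: "K \<in> {K. K \<subseteq> A \<inter> {0<..} \<and> compact K}"
          hence "emeasure M2 K \<le> emeasure M1 K" by (intro compact_le) auto
          also have "\<dots> \<le> emeasure M1 A" using K sets by (intro emeasure_mono) auto
          finally show "emeasure M2 K \<le> emeasure M1 A" .
        qed
        finally show ?thesis .
      next
        case False
        thus ?thesis using sets by (simp add: emeasure_notin_sets)
      qed
    qed
  qed
qed

section \<open>The isoperimetric inequality with a weight on levels\<close>

context decaying_function_slope
begin

text \<open>Two measures on the line are compared: the image under \<open>u\<close> of the density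
  \<open>g\<close> on {u > 0}, and the density \<open>perim\<close> on positive levels. Comparison
  on intervals gives comparison of measures, hence the inequality for every measurable weight,
  without monotonicity or continuity of \<psi>.\<close>

lemma isoperimetric:
  assumes \<psi> [measurable]: "\<psi> \<in> borel_measurable borel"
  shows "(\<integral>\<^sup>+t. \<psi> t * (ennreal (perim t) * indicator {0<..} t) \<partial>lborel)
         \<le> (\<integral>\<^sup>+x. \<psi> (u x) * (ennreal (g x) * indicator {x. 0 < u x} x) \<partial>lborel)"
proof -
  define M1 where "M1 = distr (density lborel (\<lambda>x. ennreal (g x) * indicator {x. 0 < u x} x)) borel u"
  define M2 where "M2 = density lborel (\<lambda>t. ennreal (perim t) * indicator {0<..} t)"
  have em1: "emeasure M1 S = (\<integral>\<^sup>+x. ennreal (g x) * indicator {x. 0 < u x} x * indicator {x. u x \<in> S} x \<partial>lborel)"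
    if [measurable]: "S \<in> sets borel" for S
    unfolding M1_def by (subst emeasure_distr) (auto simp: emeasure_density vimage_def)
  have em2: "emeasure M2 S = (\<integral>\<^sup>+t. ennreal (perim t) * indicator {0<..} t * indicator S t \<partial>lborel)"
    if [measurable]: "S \<in> sets borel" for S
    unfolding M2_def by (subst emeasure_density) auto
  have "M2 \<le> M1"
  proof (rule measure_le_of_intervals)
    show "sets M1 = sets borel" "sets M2 = sets borel" by (auto simp: M1_def M2_def)
    have "emeasure M1 UNIV \<le> (\<integral>\<^sup>+x. ennreal (h x) \<partial>lborel)"
      by (subst em1) (auto intro!: nn_integral_mono ennreal_leI g_le_h simp: indicator_def)
    thus "emeasure M1 UNIV \<noteq> \<infinity>" using h_finite by (auto simp: top_unique)
    have "emeasure M2 {..0} = (\<integral>\<^sup>+t. 0 \<partial>(lborel :: real measure))"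
      by (subst em2, simp, intro nn_integral_cong) (simp add: indicator_def)
    thus "emeasure M2 {..0} = 0" by simp
    fix s t :: real assume st: "0 < s" "s < t"
    have "emeasure M2 {s..<t} = (\<integral>\<^sup>+\<tau>. ennreal (perim \<tau>) * indicator {s..<t} \<tau> \<partial>lborel)"
      using st by (subst em2) (auto intro!: nn_integral_cong simp: indicator_def)
    also have "\<dots> \<le> (\<integral>\<^sup>+x. ennreal (g x) * indicator {x. s \<le> u x \<and> u x < t} x \<partial>lborel)"
      by (rule isoperimetric_interval[OF st])
    also have "\<dots> = emeasure M1 {s..<t}"
      using st by (subst em1) (auto intro!: nn_integral_cong simp: indicator_def)
    finally show "emeasure M2 {s..<t} \<le> emeasure M1 {s..<t}" .
  qed
  hence "(\<integral>\<^sup>+t. \<psi> t \<partial>M2) \<le> (\<integral>\<^sup>+t. \<psi> t \<partial>M1)"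
    by (intro nn_integral_mono_measure) (auto simp: M1_def M2_def)
  also have "(\<integral>\<^sup>+t. \<psi> t \<partial>M1) = (\<integral>\<^sup>+x. (ennreal (g x) * indicator {x. 0 < u x} x) * \<psi> (u x) \<partial>lborel)"
    unfolding M1_def by (subst nn_integral_distr) (auto simp: nn_integral_density)
  also have "(\<integral>\<^sup>+t. \<psi> t \<partial>M2) = (\<integral>\<^sup>+t. (ennreal (perim t) * indicator {0<..} t) * \<psi> t \<partial>lborel)"
    unfolding M2_def by (subst nn_integral_density) auto
  finally show ?thesis by (simp add: mult.commute)
qed

end

section \<open>Polar coordinates and layer-cake integration\<close>

lemma has_real_derivative_powr_nonneg:
  fixes p :: real
  assumes p: "1 < p" and y: "0 \<le> y"
  shows "((\<lambda>y. y powr p) has_real_derivative p * y powr (p - 1)) (at y within {0..b})"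
proof (cases "y = 0")
  case False
  have "((\<lambda>y. y powr p) has_real_derivative p * y powr (p - 1)) (at y)"
    using False y by (auto intro!: derivative_eq_intros)
  thus ?thesis by (rule has_field_derivative_at_within)
next
  case True
  have "((\<lambda>y. y powr (p - 1)) \<longlongrightarrow> 0 powr (p - 1)) (at 0 within {0..b})"
    using p by (intro tendsto_powr') (auto simp: eventually_at_filter)
  hence "((\<lambda>y. y powr (p - 1)) \<longlongrightarrow> 0) (at 0 within {0..b})" by simp
  moreover have "\<forall>\<^sub>F y in at 0 within {0..b}. y powr (p - 1) = (y powr p - 0 powr p) / (y - 0)"
    by (auto simp: eventually_at_filter powr_diff intro!: always_eventually)
  ultimately have "((\<lambda>y. (y powr p - 0 powr p) / (y - 0)) \<longlongrightarrow> 0) (at 0 within {0..b})"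
    by (rule Lim_transform_eventually)
  thus ?thesis using True p by (simp add: has_field_derivative_iff)
qed

lemma nn_integral_powr_Icc:
  fixes p b :: real
  assumes "1 < p" "0 \<le> b"
  shows "(\<integral>\<^sup>+y. ennreal (p * y powr (p - 1)) * indicator {0..b} y \<partial>lborel) = ennreal (b powr p)"
proof -
  have "((\<lambda>y. p * y powr (p - 1)) has_integral (b powr p - 0 powr p)) {0..b}"
    using assms has_real_derivative_powr_nonneg[OF assms(1)]
    by (intro fundamental_theorem_of_calculus) (auto simp: has_real_derivative_iff_has_vector_derivative)
  hence "((\<lambda>y. p * y powr (p - 1)) has_integral (b powr p)) {0..b}" using assms by simp
  hence "((\<lambda>y. if y \<in> {0..b} then p * y powr (p - 1) else 0) has_integral (b powr p)) UNIV"
    by (simp only: has_integral_restrict_UNIV)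
  hence "(\<integral>\<^sup>+y. ennreal (if y \<in> {0..b} then p * y powr (p - 1) else 0) \<partial>lborel) = ennreal (b powr p)"
    using assms by (intro nn_integral_has_integral_lborel) auto
  moreover have "(\<integral>\<^sup>+y. ennreal (p * y powr (p - 1)) * indicator {0..b} y \<partial>lborel)
      = (\<integral>\<^sup>+y. ennreal (if y \<in> {0..b} then p * y powr (p - 1) else 0) \<partial>lborel)"
    by (intro nn_integral_cong) (auto simp: indicator_def)
  ultimately show ?thesis by simp
qed

text \<open>For a \<ge> 0 both measures give {z \<le> a} the volume of the ball of radius a^(1/m),
  and half-lines determine the measure. The condition m < n means \<kappa> > 1, so the density can
  be integrated from 0 by \<open>nn_integral_powr_Icc\<close>.\<close>

lemma distr_norm_powr:
  fixes m :: real
  assumes m: "0 < m" "m < real DIM('a::euclidean_space)"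
  defines "\<kappa> \<equiv> real DIM('a) / m"
  shows "distr lborel borel (\<lambda>x::'a. norm x powr m)
         = density lborel (\<lambda>z. ennreal (unit_ball_vol (real DIM('a)) * (\<kappa> * z powr (\<kappa> - 1))) * indicator {0..} z)"
    (is "?M = ?N")
proof (rule measure_eqI_generator_eq[where E = "range (\<lambda>a. {..a})" and A = "\<lambda>i. {..real i}" and \<Omega> = UNIV])
  let ?w = "unit_ball_vol (real DIM('a))"
  have \<kappa>: "1 < \<kappa>" using m by (simp add: \<kappa>_def)
  have M: "emeasure ?M {..a} = (if a < 0 then 0 else ennreal (?w * a powr \<kappa>))" for a
  proof -
    have e1: "emeasure ?M {..a} = emeasure lborel {x::'a. norm x powr m \<le> a}"
      by (subst emeasure_distr) (auto simp: vimage_def)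
    show ?thesis
    proof (cases "a < 0")
      case True
      hence "{x::'a. norm x powr m \<le> a} = {}" using order_less_le_trans[OF True powr_ge_zero] by (auto simp: not_le)
      thus ?thesis using True e1 by simp
    next
      case False
      have nm: "norm x powr m \<le> a \<longleftrightarrow> norm x \<le> a powr (1 / m)" for x :: 'a
      proof -
        have "a = (a powr (1 / m)) powr m" using m False by (cases "a = 0") (auto simp: powr_powr)
        hence "norm x powr m \<le> a \<longleftrightarrow> norm x powr m \<le> (a powr (1 / m)) powr m" by simp
        also have "\<dots> \<longleftrightarrow> norm x \<le> a powr (1 / m)"
          using m powr_less_mono2[of m "a powr (1 / m)" "norm x"] powr_mono2[of m "norm x" "a powr (1 / m)"]
          by (auto simp: not_le[symmetric])
        finally show ?thesis .
      qed
      have "{x::'a. norm x powr m \<le> a} = cball 0 (a powr (1 / m))"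
        by (intro set_eqI) (simp only: nm mem_Collect_eq mem_cball_0)
      hence "emeasure ?M {..a} = ennreal (?w * (a powr (1 / m)) ^ DIM('a))"
        using e1 emeasure_cball[of "a powr (1 / m)" "0::'a"] by simp
      also have "(a powr (1 / m)) ^ DIM('a) = a powr \<kappa>"
        using False by (cases "a = 0") (auto simp: \<kappa>_def powr_powr powr_realpow[symmetric] power_0_left)
      finally show ?thesis using False by simp
    qed
  qed
  have N: "emeasure ?N {..a} = (if a < 0 then 0 else ennreal (?w * a powr \<kappa>))" for a
  proof -
    have "emeasure ?N {..a} = (\<integral>\<^sup>+z. ennreal ?w * (ennreal (\<kappa> * z powr (\<kappa> - 1)) * indicator {0..a} z) \<partial>lborel)"
      using \<kappa> by (subst emeasure_density)
        (auto intro!: nn_integral_cong simp: indicator_def ennreal_mult' split: if_splits)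
    also have "\<dots> = ennreal ?w * (\<integral>\<^sup>+z. (ennreal (\<kappa> * z powr (\<kappa> - 1)) * indicator {0..a} z) \<partial>lborel)"
      by (intro nn_integral_cmult) auto
    also have "\<dots> = (if a < 0 then 0 else ennreal (?w * a powr \<kappa>))"
      using nn_integral_powr_Icc[OF \<kappa>, of a] by (auto simp: ennreal_mult')
    finally show ?thesis .
  qed
  show "Int_stable (range (\<lambda>a::real. {..a}))"
    by (auto simp: Int_stable_def)
  show "emeasure ?M X = emeasure ?N X" if "X \<in> range (\<lambda>a. {..a})" for X
    using that M N by auto
  show "sets ?M = sigma_sets UNIV (range (\<lambda>a. {..a}))" "sets ?N = sigma_sets UNIV (range (\<lambda>a. {..a}))"
    by (simp_all add: borel_eq_atMost)
  show "(\<Union>i. {..real i}) = UNIV" using real_arch_simple by blast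
  show "emeasure ?M {..real i} \<noteq> \<infinity>" for i using M[of "real i"] by simp
qed auto

text \<open>The weight |x|^(-n) absorbs the Jacobian and leaves the scale-invariant measure (n w /
  m) dz/z, where w is the volume of the unit ball; this is n w ds in the logarithmic variable s = ln
  |x|.\<close>

lemma nn_integral_polar:
  fixes m :: real
  assumes m: "0 < m" "m < real DIM('a::euclidean_space)" and \<Phi> [measurable]: "\<Phi> \<in> borel_measurable borel"
  shows "(\<integral>\<^sup>+x. ennreal (norm (x::'a) powr (- real DIM('a))) * \<Phi> (norm x powr m) \<partial>lborel)
       = (\<integral>\<^sup>+z. ennreal (real DIM('a) * unit_ball_vol (real DIM('a)) / m / z) * \<Phi> z * indicator {0<..} z \<partial>lborel)"
proof -
  let ?w = "unit_ball_vol (real DIM('a))"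
  define \<kappa> where "\<kappa> = real DIM('a) / m"
  have "(\<integral>\<^sup>+x. ennreal (norm (x::'a) powr (- real DIM('a))) * \<Phi> (norm x powr m) \<partial>lborel)
      = (\<integral>\<^sup>+x. (\<lambda>z. ennreal (z powr (- \<kappa>)) * \<Phi> z) (norm (x::'a) powr m) \<partial>lborel)"
    using m by (simp add: powr_powr \<kappa>_def)
  also have "\<dots> = (\<integral>\<^sup>+z. ennreal (z powr (- \<kappa>)) * \<Phi> z \<partial>distr lborel borel (\<lambda>x::'a. norm x powr m))"
    by (subst nn_integral_distr) auto
  also have "\<dots> = (\<integral>\<^sup>+z. (ennreal (?w * (\<kappa> * z powr (\<kappa> - 1))) * indicator {0..} z)
                     * (ennreal (z powr (- \<kappa>)) * \<Phi> z) \<partial>lborel)"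
    unfolding distr_norm_powr[OF m] \<kappa>_def by (subst nn_integral_density) auto
  also have "\<dots> = (\<integral>\<^sup>+z. ennreal (real DIM('a) * ?w / m / z) * \<Phi> z * indicator {0<..} z \<partial>lborel)"
  proof (rule nn_integral_cong)
    fix z :: real
    show "(ennreal (?w * (\<kappa> * z powr (\<kappa> - 1))) * indicator {0..} z) * (ennreal (z powr (- \<kappa>)) * \<Phi> z)
       = ennreal (real DIM('a) * ?w / m / z) * \<Phi> z * indicator {0<..} z"
    proof (cases "z > 0")
      case True
      have zz: "z powr (\<kappa> - 1) * z powr (- \<kappa>) = 1 / z"
        using True by (simp add: powr_diff powr_minus field_simps)
      have "?w * (\<kappa> * z powr (\<kappa> - 1)) * z powr (- \<kappa>)
          = ?w * \<kappa> * (z powr (\<kappa> - 1) * z powr (- \<kappa>))" by (simp only: mult.assoc)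
      also have "\<dots> = real DIM('a) * ?w / m / z" unfolding zz by (simp add: \<kappa>_def)
      finally have "?w * (\<kappa> * z powr (\<kappa> - 1)) * z powr (- \<kappa>)
          = real DIM('a) * ?w / m / z" .
      hence "ennreal (?w * (\<kappa> * z powr (\<kappa> - 1))) * ennreal (z powr (- \<kappa>))
             = ennreal (real DIM('a) * ?w / m / z)"
        by (subst ennreal_mult''[symmetric]) auto
      thus ?thesis using True by (simp add: mult.assoc[symmetric])
    next
      case False
      thus ?thesis by (cases "z = 0") auto
    qed
  qed
  finally show ?thesis .
qed

text \<open>\<phi>^p is the integral of p t^(p-1) over 0 < t < \<phi>. The weight \<open>W\<close>
  stays inside the inner integral, so that rearrangement can be done level by level.\<close>

lemma nn_integral_layer_cake:
  fixes \<phi> :: "'a::euclidean_space \<Rightarrow> real" and p :: real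
  assumes p: "1 < p" and [measurable]: "\<phi> \<in> borel_measurable borel" "W \<in> borel_measurable borel"
    and nonneg: "\<And>x. 0 \<le> \<phi> x"
  shows "(\<integral>\<^sup>+x. W x * ennreal (\<phi> x powr p) \<partial>lborel)
       = (\<integral>\<^sup>+t. ennreal (p * t powr (p - 1)) * indicator {0<..} t * (\<integral>\<^sup>+x. W x * indicator {x. t < \<phi> x} x \<partial>lborel) \<partial>lborel)"
proof -
  define F where "F x t = W x * (ennreal (p * t powr (p - 1)) * (indicator {0<..} t * indicator {p. snd p < \<phi> (fst p)} (x, t)))" for x t
  have [measurable]: "(\<lambda>(x, t). F x t) \<in> borel_measurable (lborel \<Otimes>\<^sub>M lborel)"
    unfolding F_def by measurable
  have "(\<integral>\<^sup>+x. W x * ennreal (\<phi> x powr p) \<partial>lborel) = (\<integral>\<^sup>+x. \<integral>\<^sup>+t. F x t \<partial>lborel \<partial>lborel)"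
  proof (rule nn_integral_cong)
    fix x :: 'a
    have "AE t in lborel. t \<noteq> 0 \<and> t \<noteq> \<phi> x"
      using AE_lborel_singleton[of 0] AE_lborel_singleton[of "\<phi> x"] by eventually_elim auto
    hence "(\<integral>\<^sup>+t. ennreal (p * t powr (p - 1)) * (indicator {0<..} t * indicator {p. snd p < \<phi> (fst p)} (x, t)) \<partial>lborel)
        = (\<integral>\<^sup>+t. ennreal (p * t powr (p - 1)) * indicator {0..\<phi> x} t \<partial>lborel)"
      by (intro nn_integral_cong_AE, eventually_elim) (auto simp: indicator_def)
    also have "\<dots> = ennreal (\<phi> x powr p)" using p nonneg by (rule nn_integral_powr_Icc)
    finally show "W x * ennreal (\<phi> x powr p) = (\<integral>\<^sup>+t. F x t \<partial>lborel)"
      unfolding F_def by (subst nn_integral_cmult) auto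
  qed
  also have "\<dots> = (\<integral>\<^sup>+t. \<integral>\<^sup>+x. F x t \<partial>lborel \<partial>lborel)"
    by (rule lborel_pair.Fubini') measurable
  also have "\<dots> = (\<integral>\<^sup>+t. ennreal (p * t powr (p - 1)) * indicator {0<..} t * (\<integral>\<^sup>+x. W x * indicator {x. t < \<phi> x} x \<partial>lborel) \<partial>lborel)"
  proof (rule nn_integral_cong)
    fix t :: real
    show "(\<integral>\<^sup>+x. F x t \<partial>lborel) = ennreal (p * t powr (p - 1)) * indicator {0<..} t * (\<integral>\<^sup>+x. W x * indicator {x. t < \<phi> x} x \<partial>lborel)"
      by (subst nn_integral_cmult[symmetric]) (auto simp: F_def indicator_def mult.commute intro!: nn_integral_cong)
  qed
  finally show ?thesis .
qed

text \<open>Bathtub principle: \<open>A\<close> minus the ball and the ball minus \<open>A\<close>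
  have equal volume, and the weight is at most r^(-s) on the first and at least r^(-s) on the
  second.\<close>

lemma nn_integral_weight_le_ball:
  fixes A :: "'a::euclidean_space set" and s r :: real
  assumes s: "0 \<le> s" and r: "0 \<le> r" and [measurable]: "A \<in> sets borel"
    and A: "emeasure lborel A = emeasure lborel (ball (0::'a) r)"
  shows "(\<integral>\<^sup>+x. ennreal (norm x powr (- s)) * indicator A x \<partial>lborel)
       \<le> (\<integral>\<^sup>+x. ennreal (norm x powr (- s)) * indicator (ball (0::'a) r) x \<partial>lborel)"
proof (cases "r = 0")
  case True
  hence "A \<in> null_sets lborel" using A by (auto simp: null_sets_def)
  hence "AE x in lborel. x \<notin> A" by (rule AE_not_in)
  hence "(\<integral>\<^sup>+x. ennreal (norm x powr (- s)) * indicator A x \<partial>lborel) = (\<integral>\<^sup>+x. 0 \<partial>(lborel::'a measure))"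
    by (intro nn_integral_cong_AE, eventually_elim) auto
  thus ?thesis by simp
next
  case False
  hence r: "0 < r" using r by simp
  let ?B = "ball (0::'a) r" and ?W = "\<lambda>x::'a. ennreal (norm x powr (- s))"
  have fin: "emeasure lborel ?B < \<infinity>" by (intro emeasure_bounded_finite) auto
  have split: "(\<integral>\<^sup>+x. ?W x * indicator C x \<partial>lborel)
      = (\<integral>\<^sup>+x. ?W x * indicator (C \<inter> D) x \<partial>lborel) + (\<integral>\<^sup>+x. ?W x * indicator (C - D) x \<partial>lborel)"
    if [measurable]: "C \<in> sets borel" "D \<in> sets borel" for C D :: "'a set"
    by (subst nn_integral_add[symmetric]) (auto intro!: nn_integral_cong simp: indicator_def)
  have eq: "emeasure lborel (A - ?B) = emeasure lborel (?B - A)"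
  proof -
    have *: "emeasure lborel (C - D) = emeasure lborel C - emeasure lborel (C \<inter> D)"
      if [measurable]: "C \<in> sets borel" "D \<in> sets borel" and C: "emeasure lborel C < \<infinity>" for C D :: "'a set"
    proof -
      have "emeasure lborel (C \<inter> D) \<le> emeasure lborel C" by (intro emeasure_mono) auto
      hence "emeasure lborel (C \<inter> D) \<noteq> \<infinity>" using C by (auto simp: top_unique)
      hence "emeasure lborel (C - C \<inter> D) = emeasure lborel C - emeasure lborel (C \<inter> D)"
        by (intro emeasure_Diff) auto
      thus ?thesis by (simp add: Diff_Int_distrib Diff_Int)
    qed
    have "emeasure lborel (A - ?B) = emeasure lborel A - emeasure lborel (A \<inter> ?B)"
      using A fin by (intro *) auto
    also have "\<dots> = emeasure lborel ?B - emeasure lborel (?B \<inter> A)" by (simp add: A Int_commute)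
    also have "\<dots> = emeasure lborel (?B - A)" using fin by (intro *[symmetric]) auto
    finally show ?thesis .
  qed
  have "(\<integral>\<^sup>+x. ?W x * indicator (A - ?B) x \<partial>lborel) \<le> (\<integral>\<^sup>+x. ennreal (r powr (- s)) * indicator (A - ?B) x \<partial>lborel)"
    using r s by (intro nn_integral_mono) (auto simp: indicator_def intro!: ennreal_leI powr_mono2')
  also have "\<dots> = (\<integral>\<^sup>+x. ennreal (r powr (- s)) * indicator (?B - A) x \<partial>lborel)"
    using eq by (simp add: nn_integral_cmult_indicator)
  also have "\<dots> \<le> (\<integral>\<^sup>+x. ?W x * indicator (?B - A) x \<partial>lborel)"
  proof (rule nn_integral_mono_AE)
    \<comment> \<open>The convention \<open>0 powr (- s) = 0\<close> makes the weight too small at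
      the origin, which is therefore discarded.\<close>
    have "AE x in lborel. x \<noteq> (0::'a)" by (rule AE_lborel_singleton)
    thus "AE x in lborel. ennreal (r powr (- s)) * indicator (?B - A) x \<le> ?W x * indicator (?B - A) x"
      by eventually_elim (use r s in \<open>auto simp: indicator_def intro!: ennreal_leI powr_mono2'\<close>)
  qed
  finally have "(\<integral>\<^sup>+x. ?W x * indicator (A - ?B) x \<partial>lborel) \<le> (\<integral>\<^sup>+x. ?W x * indicator (?B - A) x \<partial>lborel)" .
  hence le: "(\<integral>\<^sup>+x. ?W x * indicator (A \<inter> ?B) x \<partial>lborel) + (\<integral>\<^sup>+x. ?W x * indicator (A - ?B) x \<partial>lborel)
      \<le> (\<integral>\<^sup>+x. ?W x * indicator (A \<inter> ?B) x \<partial>lborel) + (\<integral>\<^sup>+x. ?W x * indicator (?B - A) x \<partial>lborel)"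
    by (rule add_left_mono)
  have "(\<integral>\<^sup>+x. ?W x * indicator A x \<partial>lborel)
      = (\<integral>\<^sup>+x. ?W x * indicator (A \<inter> ?B) x \<partial>lborel) + (\<integral>\<^sup>+x. ?W x * indicator (A - ?B) x \<partial>lborel)"
    by (rule split) auto
  also note le
  also have "(\<integral>\<^sup>+x. ?W x * indicator (A \<inter> ?B) x \<partial>lborel) + (\<integral>\<^sup>+x. ?W x * indicator (?B - A) x \<partial>lborel)
      = (\<integral>\<^sup>+x. ?W x * indicator ?B x \<partial>lborel)"
    by (subst Int_commute, rule split[symmetric]) auto
  finally show ?thesis .
qed

section \<open>The radial rearrangement\<close>

context decaying_function
begin

definition "m = (real DIM('a) - 2) / 2"

text \<open>The radius of the superlevel set in the coordinate z = |x|^m. On the sphere bounding the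
  rearranged set of level \<open>t\<close>, the product \<open>R t * t\<close> plays the role of
  G.\<close>

definition "R t = rad t powr m"

text \<open>The symmetric decreasing rearrangement of \<open>u\<close>, as a function of \<open>z = \<bar>x\<bar>\<^sup>m\<close>.\<close>

definition "v z = Inf {t. 0 < t \<and> R t \<le> max z 0}"

definition U :: "'a \<Rightarrow> real" where "U x = v (norm x powr m)"

lemma m_pos: "0 < m" and m_less: "m < real DIM('a)"
  using dim by (auto simp: m_def)

lemma u_bounded: "\<exists>T>0. \<forall>x. u x \<le> T"
proof -
  have "compact (closure {x. 1 < u x})" using bounded_superlevel[of 1] by (simp add: compact_closure)
  hence "bounded (u ` closure {x. 1 < u x})"
    using cont_u by (intro compact_imp_bounded compact_continuous_image) (auto intro: continuous_on_subset)
  then obtain B where B: "\<And>x. x \<in> closure {x. 1 < u x} \<Longrightarrow> \<bar>u x\<bar> \<le> B" by (auto simp: bounded_iff)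
  have "u x \<le> max 1 B" for x
  proof (cases "1 < u x")
    case True
    hence "x \<in> closure {x. 1 < u x}" by (intro subsetD[OF closure_subset]) simp
    thus ?thesis using B[of x] by auto
  qed auto
  thus ?thesis by (intro exI[of _ "max 1 B"]) auto
qed

lemma R_nonneg: "0 \<le> R t" by (simp add: R_def)

lemma R_antimono: "0 < s \<Longrightarrow> s \<le> t \<Longrightarrow> R t \<le> R s"
  unfolding R_def using rad_antimono[of s t] rad_nonneg m_pos by (intro powr_mono2) auto

lemma R_borel [measurable]: "R \<in> borel_measurable borel"
  unfolding R_def by measurable

lemma R_eventually_zero: "\<exists>T>0. \<forall>t\<ge>T. R t = 0"
proof -
  obtain T where T: "T > 0" "\<And>x. u x \<le> T" using u_bounded by blast
  have "R t = 0" if "t \<ge> T" for t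
  proof -
    have "{x. t < u x} = {}" using order_trans[OF T(2) that] by (simp add: not_less)
    thus ?thesis by (simp add: R_def rad_def \<mu>_def)
  qed
  thus ?thesis using T by blast
qed

text \<open>{u > t} is the increasing union of {u > s} over s > t. This one-sided continuity turns
  \<open>less_v_iff\<close> into an equivalence of strict inequalities.\<close>

lemma R_right_continuous:
  assumes t: "0 < t" and z: "z < R t"
  shows "\<exists>t'>t. z < R t'"
proof -
  define s where "s k = t + 1 / real (Suc k)" for k
  have ts: "t < s k" for k by (simp add: s_def)
  have "(\<lambda>k. measure lborel {x. s k < u x}) \<longlonglongrightarrow> measure lborel (\<Union>k. {x. s k < u x})"
  proof (rule Lim_measure_incseq)
    show "incseq (\<lambda>k. {x. s k < u x})"
    proof (intro incseq_SucI Collect_mono impI)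
      fix k x assume "s k < u x"
      moreover have "s (Suc k) \<le> s k" by (simp add: s_def field_simps)
      ultimately show "s (Suc k) < u x" by linarith
    qed
    show "range (\<lambda>k. {x. s k < u x}) \<subseteq> sets lborel" by auto
    have "emeasure lborel (\<Union>k. {x. s k < u x}) \<le> emeasure lborel {x. t < u x}"
      by (intro emeasure_mono UN_least Collect_mono impI less_trans[OF ts]) auto
    thus "emeasure lborel (\<Union>k. {x. s k < u x}) \<noteq> \<infinity>"
      using emeasure_superlevel[OF t] by (auto simp: top_unique)
  qed
  also have "(\<Union>k. {x. s k < u x}) = {x. t < u x}"
  proof (intro set_eqI iffI)
    fix x assume "x \<in> (\<Union>k. {x. s k < u x})"
    then obtain k where "s k < u x" by blast
    thus "x \<in> {x. t < u x}" using ts[of k] by simp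
  next
    fix x assume "x \<in> {x. t < u x}"
    then obtain k where "inverse (real (Suc k)) < u x - t" using reals_Archimedean[of "u x - t"] by auto
    hence "s k < u x" by (simp add: s_def inverse_eq_divide)
    thus "x \<in> (\<Union>k. {x. s k < u x})" by blast
  qed
  finally have "(\<lambda>k. \<mu> (s k)) \<longlonglongrightarrow> \<mu> t" by (simp add: \<mu>_def)
  hence "(\<lambda>k. rad (s k)) \<longlonglongrightarrow> rad t" unfolding rad_def using w_pos by (intro tendsto_intros) auto
  hence "(\<lambda>k. R (s k)) \<longlonglongrightarrow> R t" unfolding R_def
    using m_pos rad_nonneg by (intro tendsto_powr') auto
  hence "\<forall>\<^sub>F k in sequentially. z < R (s k)" using z by (rule order_tendstoD)
  then obtain k where "z < R (s k)" by (auto simp: eventually_sequentially)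
  thus ?thesis by (intro exI[of _ "s k"]) (auto simp: s_def)
qed

text \<open>The maximum with 0 in the definition of \<open>v\<close> keeps this set nonempty for
  negative \<open>z\<close>, so that \<open>v\<close> is antitone on the whole line and thereby
  measurable.\<close>

lemma v_set: "{t. 0 < t \<and> R t \<le> max z 0} \<noteq> {}" "bdd_below {t. 0 < t \<and> R t \<le> max z 0}"
proof -
  obtain T where "T > 0" "R T = 0" using R_eventually_zero by blast
  hence "T \<in> {t. 0 < t \<and> R t \<le> max z 0}" by simp
  thus "{t. 0 < t \<and> R t \<le> max z 0} \<noteq> {}" by blast
  show "bdd_below {t. 0 < t \<and> R t \<le> max z 0}" by (rule bdd_belowI[of _ 0]) auto
qed

lemma v_nonneg: "0 \<le> v z"
  unfolding v_def using v_set(1)[of z] by (intro cInf_greatest) auto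

text \<open>\<open>v\<close> and \<open>R\<close> are generalised inverses: the same region under
  the graph is described once by radius and once by level. Every exchange of the two variables rests
  on this.\<close>

lemma less_v_iff:
  assumes t: "0 < t" and z: "0 \<le> z"
  shows "t < v z \<longleftrightarrow> z < R t"
proof
  assume "t < v z"
  show "z < R t"
  proof (rule ccontr)
    assume "\<not> z < R t"
    hence "v z \<le> t" unfolding v_def using t z v_set(2)[of z] by (intro cInf_lower) auto
    thus False using \<open>t < v z\<close> by simp
  qed
next
  assume "z < R t"
  then obtain t' where t': "t < t'" "z < R t'" using R_right_continuous[OF t] by blast
  have "t' \<le> v z"
    unfolding v_def
  proof (rule cInf_greatest[OF v_set(1)])
    fix s assume s: "s \<in> {t. 0 < t \<and> R t \<le> max z 0}"
    show "t' \<le> s"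
    proof (rule ccontr)
      assume "\<not> t' \<le> s"
      hence "R t' \<le> R s" using s by (intro R_antimono) auto
      thus False using s t' z by auto
    qed
  qed
  thus "t < v z" using t' by simp
qed

lemma v_antimono: "z \<le> z' \<Longrightarrow> v z' \<le> v z"
  unfolding v_def using v_set[of z] v_set[of z'] by (intro cInf_superset_mono) auto

lemma v_borel [measurable]: "v \<in> borel_measurable borel"
proof -
  have "(\<lambda>z. - v z) \<in> borel_measurable borel"
    by (rule borel_measurable_mono) (auto simp: mono_def intro: v_antimono)
  hence "(\<lambda>z. - (- v z)) \<in> borel_measurable borel" by measurable
  thus ?thesis by simp
qed

lemma U_borel [measurable]: "U \<in> borel_measurable borel"
  unfolding U_def by measurable

lemma superlevel_U:
  assumes t: "0 < t"
  shows "{x. t < U x} = ball 0 (rad t)"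
proof -
  have "t < U x \<longleftrightarrow> norm x < rad t" for x
  proof -
    have "t < U x \<longleftrightarrow> norm x powr m < rad t powr m"
      unfolding U_def using t by (subst less_v_iff) (auto simp: R_def)
    also have "\<dots> \<longleftrightarrow> norm x < rad t"
      using m_pos rad_nonneg[of t] powr_less_mono2[of m "norm x" "rad t"] powr_mono2[of m "rad t" "norm x"]
      by (auto simp: not_le[symmetric])
    finally show ?thesis .
  qed
  thus ?thesis by (intro set_eqI) (simp only: mem_Collect_eq mem_ball_0)
qed

lemma emeasure_superlevel_U:
  assumes t: "0 < t"
  shows "emeasure lborel {x. t < U x} = emeasure lborel {x. t < u x}"
  using superlevel_U[OF t] emeasure_ball[OF rad_nonneg[of t], of "0::'a"] emeasure_superlevel[OF t] \<mu>_eq_rad[of t]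
  by (simp add: w_def)

text \<open>{u > 0} may have infinite volume, so the functions are first cut off below
  \<open>\<delta> k\<close>. The image measures then agree because they agree, with finite values,
  on half-lines; monotone convergence removes the cutoff.\<close>

lemma nn_integral_equimeasurable:
  assumes [measurable]: "\<Phi> \<in> borel_measurable borel"
  shows "(\<integral>\<^sup>+x. \<Phi> (u x) * indicator {x. 0 < u x} x \<partial>lborel) = (\<integral>\<^sup>+x. \<Phi> (U x) * indicator {x. 0 < U x} x \<partial>lborel)"
proof -
  define P where "P (f :: 'a \<Rightarrow> real) \<delta> = distr (density lborel (\<lambda>x. indicator {x. \<delta> < f x} x)) borel f" for f \<delta>
  define \<delta> where "\<delta> k = 1 / real (Suc k)" for k
  have \<delta>: "0 < \<delta> k" for k by (simp add: \<delta>_def)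
  have em: "emeasure (P f d) {a<..} = emeasure lborel {x. max a d < f x}" if [measurable]: "f \<in> borel_measurable borel" for f a d
  proof -
    have "emeasure (P f d) {a<..} = (\<integral>\<^sup>+x. indicator {x. d < f x} x * indicator {x. a < f x} x \<partial>lborel)"
      unfolding P_def by (subst emeasure_distr) (auto simp: emeasure_density vimage_def)
    also have "\<dots> = (\<integral>\<^sup>+x. indicator {x. max a d < f x} x \<partial>lborel)"
      by (intro nn_integral_cong) (auto simp: indicator_def)
    also have "\<dots> = emeasure lborel {x. max a d < f x}" by (rule nn_integral_indicator) auto
    finally show ?thesis .
  qed
  have "P u (\<delta> k) = P U (\<delta> k)" for k
  proof (rule measure_eqI_lessThan)
    show "sets (P u (\<delta> k)) = sets borel" "sets (P U (\<delta> k)) = sets borel" by (auto simp: P_def)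
    fix a
    have pos: "0 < max a (\<delta> k)" using \<delta>[of k] by auto
    show "emeasure (P u (\<delta> k)) {a<..} < \<infinity>"
      using emeasure_superlevel[OF pos] by (simp add: em)
    show "emeasure (P u (\<delta> k)) {a<..} = emeasure (P U (\<delta> k)) {a<..}"
      using emeasure_superlevel_U[OF pos] by (simp add: em)
  qed
  hence eq: "(\<integral>\<^sup>+y. \<Phi> y \<partial>P u (\<delta> k)) = (\<integral>\<^sup>+y. \<Phi> y \<partial>P U (\<delta> k))" for k by simp
  have int: "(\<integral>\<^sup>+y. \<Phi> y \<partial>P f d) = (\<integral>\<^sup>+x. \<Phi> (f x) * indicator {x. d < f x} x \<partial>lborel)"
    if [measurable]: "f \<in> borel_measurable borel" for f d
    unfolding P_def by (subst nn_integral_distr) (auto simp: nn_integral_density mult.commute)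
  have lim: "(\<integral>\<^sup>+x. \<Phi> (f x) * indicator {x. 0 < f x} x \<partial>lborel) = (SUP k. \<integral>\<^sup>+x. \<Phi> (f x) * indicator {x. \<delta> k < f x} x \<partial>lborel)"
    if [measurable]: "f \<in> borel_measurable borel" for f
  proof -
    have sup: "\<Phi> (f x) * indicator {x. 0 < f x} x = (SUP k. \<Phi> (f x) * indicator {x. \<delta> k < f x} x)" for x
    proof (cases "0 < f x")
      case True
      then obtain k where "inverse (real (Suc k)) < f x" using reals_Archimedean by blast
      hence k: "\<delta> k < f x" by (simp add: \<delta>_def inverse_eq_divide)
      show ?thesis
      proof (rule antisym)
        show "\<Phi> (f x) * indicator {x. 0 < f x} x \<le> (SUP k. \<Phi> (f x) * indicator {x. \<delta> k < f x} x)"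
          using k True by (intro SUP_upper2[of k]) auto
        show "(SUP k. \<Phi> (f x) * indicator {x. \<delta> k < f x} x) \<le> \<Phi> (f x) * indicator {x. 0 < f x} x"
          using True by (intro SUP_least) (auto simp: indicator_def)
      qed
    next
      case False
      hence "\<not> \<delta> k < f x" for k using \<delta>[of k] by linarith
      thus ?thesis using False by simp
    qed
    have "(\<integral>\<^sup>+x. (SUP k. \<Phi> (f x) * indicator {x. \<delta> k < f x} x) \<partial>lborel) = (SUP k. \<integral>\<^sup>+x. \<Phi> (f x) * indicator {x. \<delta> k < f x} x \<partial>lborel)"
    proof (rule nn_integral_monotone_convergence_SUP)
      have "\<delta> (Suc k) \<le> \<delta> k" for k by (simp add: \<delta>_def field_simps)
      thus "incseq (\<lambda>k x. \<Phi> (f x) * indicator {x. \<delta> k < f x} x)"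
        by (intro incseq_SucI le_funI mult_left_mono) (auto simp: indicator_def intro: order_le_less_trans)
    qed auto
    thus ?thesis using sup by simp
  qed
  show ?thesis unfolding lim[OF u_borel] lim[OF U_borel] using eq int by simp
qed

text \<open>Layer cake in the level, then the bathtub bound on each superlevel set, which for
  \<open>U\<close> is a centred ball.\<close>

lemma nn_integral_weight_le_rearrangement:
  assumes s: "0 \<le> s" and p: "1 < p"
  shows "(\<integral>\<^sup>+x. ennreal (norm x powr (- s)) * ennreal (u x powr p) \<partial>lborel)
       \<le> (\<integral>\<^sup>+x. ennreal (norm x powr (- s)) * ennreal (U x powr p) \<partial>lborel)"
proof -
  have *: "(\<integral>\<^sup>+x. ennreal (norm x powr (- s)) * indicator {x. t < u x} x \<partial>lborel)
      \<le> (\<integral>\<^sup>+x. ennreal (norm x powr (- s)) * indicator {x. t < U x} x \<partial>lborel)" if t: "0 < t" for t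
    unfolding superlevel_U[OF t]
    using s rad_nonneg[of t] emeasure_superlevel_U[OF t] superlevel_U[OF t]
    by (intro nn_integral_weight_le_ball) auto
  have U0: "0 \<le> U x" for x by (simp add: U_def v_nonneg)
  have lu: "(\<integral>\<^sup>+x. ennreal (norm x powr (- s)) * ennreal (u x powr p) \<partial>lborel) = (\<integral>\<^sup>+t. ennreal (p * t powr (p - 1))
        * indicator {0<..} t * (\<integral>\<^sup>+x. ennreal (norm x powr (- s)) * indicator {x. t < u x} x \<partial>lborel) \<partial>lborel)"
    by (rule nn_integral_layer_cake[OF p]) (auto simp: nonneg_u)
  have lU: "(\<integral>\<^sup>+x. ennreal (norm x powr (- s)) * ennreal (U x powr p) \<partial>lborel) = (\<integral>\<^sup>+t. ennreal (p * t powr (p - 1))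
        * indicator {0<..} t * (\<integral>\<^sup>+x. ennreal (norm x powr (- s)) * indicator {x. t < U x} x \<partial>lborel) \<partial>lborel)"
    by (rule nn_integral_layer_cake[OF p]) (auto simp: U0)
  show ?thesis unfolding lu lU
  proof (rule nn_integral_mono)
    fix t :: real
    show "ennreal (p * t powr (p - 1)) * indicator {0<..} t * (\<integral>\<^sup>+x. ennreal (norm x powr (- s)) * indicator {x. t < u x} x \<partial>lborel)
        \<le> ennreal (p * t powr (p - 1)) * indicator {0<..} t * (\<integral>\<^sup>+x. ennreal (norm x powr (- s)) * indicator {x. t < U x} x \<partial>lborel)"
      by (cases "0 < t") (auto intro!: mult_left_mono[OF *])
  qed
qed

text \<open>Boundedness of \<open>u\<close> governs small \<open>z\<close>. For large
  \<open>z\<close>, the decay of \<open>u\<close> puts {u > t} into a ball, which bounds R(t)^2 t;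
  inverting \<open>R\<close> turns this into a bound on z^2 v(z).\<close>

lemma v_decay: "\<exists>K>0. \<forall>z>0. z * v z \<le> K * z \<and> z * v z \<le> K / z"
proof -
  obtain T where T: "T > 0" "\<And>t. t \<ge> T \<Longrightarrow> R t = 0" using R_eventually_zero by blast
  obtain L where L: "\<And>x. norm x ^ (DIM('a) - 2) * u x \<le> L" using decay by blast
  \<comment> \<open>Positive, so that \<open>L' / z ^ 2\<close> is an admissible level in
    \<open>less_v_iff\<close>.\<close>
  define L' where "L' = max 1 L"
  have vT: "v z \<le> T" if "z > 0" for z
    using less_v_iff[of T z] T that by (force simp: not_less)
  have RL: "R t ^ 2 * t \<le> L'" if t: "t > 0" for t
  proof -
    have sub: "{x. t < u x} \<subseteq> cball 0 ((L' / t) powr (1 / (2 * m)))"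
    proof
      fix x assume "x \<in> {x. t < u x}"
      hence x: "t < u x" by simp
      have "norm x powr (2 * m) * t \<le> L'"
      proof (cases "x = 0")
        case False
        have "2 * m = real (DIM('a) - 2)" using dim by (simp add: m_def of_nat_diff)
        hence "norm x powr (2 * m) = norm x ^ (DIM('a) - 2)" using False by (metis powr_realpow zero_less_norm_iff)
        hence "norm x powr (2 * m) * t \<le> norm x ^ (DIM('a) - 2) * u x" using x by (simp add: mult_left_mono)
        thus ?thesis using L[of x] by (simp add: L'_def)
      qed (simp add: L'_def)
      hence "norm x powr (2 * m) \<le> L' / t" using t by (simp add: field_simps)
      hence "(norm x powr (2 * m)) powr (1 / (2 * m)) \<le> (L' / t) powr (1 / (2 * m))"
        using m_pos by (intro powr_mono2) auto
      thus "x \<in> cball 0 ((L' / t) powr (1 / (2 * m)))" using m_pos by (simp add: powr_powr)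
    qed
    have "\<mu> t \<le> measure lborel (cball (0::'a) ((L' / t) powr (1 / (2 * m))))"
      unfolding \<mu>_def using sub emeasure_bounded_finite[OF bounded_cball]
      by (intro measure_mono_fmeasurable) (auto simp: fmeasurable_def)
    also have "\<dots> = w * ((L' / t) powr (1 / (2 * m))) ^ DIM('a)"
      using content_cball[of "(L' / t) powr (1 / (2 * m))" "0::'a"] by (simp add: w_def)
    finally have "rad t ^ DIM('a) \<le> ((L' / t) powr (1 / (2 * m))) ^ DIM('a)"
      using \<mu>_eq_rad[of t] w_pos by simp
    hence "rad t \<le> (L' / t) powr (1 / (2 * m))" using rad_nonneg[of t] by (subst (asm) power_mono_iff) auto
    hence "R t \<le> ((L' / t) powr (1 / (2 * m))) powr m" unfolding R_def using m_pos rad_nonneg by (intro powr_mono2) auto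
    also have "\<dots> = (L' / t) powr (1 / 2)" using m_pos by (simp add: powr_powr)
    also have "\<dots> = sqrt (L' / t)" using t by (simp add: powr_half_sqrt L'_def)
    finally have "R t ^ 2 \<le> (sqrt (L' / t)) ^ 2" using R_nonneg by (intro power_mono)
    also have "\<dots> = L' / t" using t by (simp add: L'_def)
    finally show ?thesis using t by (simp add: field_simps)
  qed
  have vL: "v z \<le> L' / z ^ 2" if z: "z > 0" for z
  proof (rule ccontr)
    assume "\<not> v z \<le> L' / z ^ 2"
    hence "L' / z ^ 2 < v z" by simp
    moreover have "0 < L' / z ^ 2" using z by (simp add: L'_def)
    ultimately have "z < R (L' / z ^ 2)" using less_v_iff[of "L' / z ^ 2" z] z by simp
    hence "z ^ 2 < R (L' / z ^ 2) ^ 2" using z by (intro power_strict_mono) auto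
    hence "z ^ 2 * (L' / z ^ 2) < R (L' / z ^ 2) ^ 2 * (L' / z ^ 2)"
      using \<open>0 < L' / z ^ 2\<close> by (intro mult_strict_right_mono)
    also have "\<dots> \<le> L'" using RL[OF \<open>0 < L' / z ^ 2\<close>] .
    finally show False using z by simp
  qed
  have "0 < max T L' \<and> (\<forall>z>0. z * v z \<le> max T L' * z \<and> z * v z \<le> max T L' / z)"
  proof (intro conjI allI impI)
    show "0 < max T L'" using T by simp
    fix z :: real assume z: "z > 0"
    have "z * v z \<le> z * max T L'" using vT[OF z] z by (intro mult_left_mono) auto
    thus "z * v z \<le> max T L' * z" by (simp add: mult.commute)
    have "z * v z \<le> z * (L' / z ^ 2)" using vL[OF z] z by (intro mult_left_mono) auto
    also have "\<dots> = L' / z" using z by (simp add: power2_eq_square)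
    also have "\<dots> \<le> max T L' / z" using z by (intro divide_right_mono) auto
    finally show "z * v z \<le> max T L' / z" .
  qed
  thus ?thesis by blast
qed

end

section \<open>Exchanging levels and radii\<close>

lemma has_bochner_integral_FTC_scaled:
  fixes Q k :: "real \<Rightarrow> real"
  assumes deriv: "\<And>y. 0 \<le> y \<Longrightarrow> y \<le> b \<Longrightarrow> (Q has_real_derivative k y) (at y within {0..b})"
    and cont: "continuous_on {0..b} k"
    and ab: "0 \<le> \<alpha>" "\<alpha> \<le> \<beta>" and c: "0 < c" "\<beta> * c \<le> b"
  shows "has_bochner_integral lborel (\<lambda>z. indicator {\<alpha><..<\<beta>} z * k (z * c)) ((Q (\<beta> * c) - Q (\<alpha> * c)) / c)"
proof -
  have sub: "z * c \<in> {0..b}" if "z \<in> {\<alpha>..\<beta>}" for z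
  proof -
    have "z * c \<le> \<beta> * c" using that c by (intro mult_right_mono) auto
    hence "z * c \<le> b" using c by linarith
    thus ?thesis using that ab c by simp
  qed
  have "has_bochner_integral lborel (\<lambda>z. indicator {\<alpha>..\<beta>} z *\<^sub>R k (z * c)) (Q (\<beta> * c) / c - Q (\<alpha> * c) / c)"
  proof (rule has_bochner_integral_FTC_Icc[OF ab(2)])
    show "continuous_on {\<alpha>..\<beta>} (\<lambda>z. k (z * c))"
      using sub by (intro continuous_on_compose2[OF cont]) (auto intro!: continuous_intros)
    fix z assume z: "\<alpha> \<le> z" "z \<le> \<beta>"
    have "(Q has_real_derivative k (z * c)) (at (z * c) within (\<lambda>z. z * c) ` {\<alpha>..\<beta>})"
      using sub z by (intro DERIV_subset[OF deriv]) auto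
    moreover have "((\<lambda>z. z * c) has_real_derivative c) (at z within {\<alpha>..\<beta>})"
      by (auto intro!: derivative_eq_intros)
    ultimately have "((\<lambda>z. Q (z * c)) has_real_derivative k (z * c) * c) (at z within {\<alpha>..\<beta>})"
      by (rule DERIV_image_chain[unfolded o_def])
    hence "((\<lambda>z. Q (z * c) / c) has_real_derivative k (z * c) * c / c) (at z within {\<alpha>..\<beta>})"
      by (rule DERIV_cdivide)
    thus "((\<lambda>z. Q (z * c) / c) has_vector_derivative k (z * c)) (at z within {\<alpha>..\<beta>})"
      using c by (simp add: has_real_derivative_iff_has_vector_derivative)
  qed
  moreover have "AE z in lborel. indicator {\<alpha>..\<beta>} z *\<^sub>R k (z * c) = indicator {\<alpha><..<\<beta>} z * k (z * c)"
    using AE_lborel_singleton[of \<alpha>] AE_lborel_singleton[of \<beta>]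
    by eventually_elim (auto simp: indicator_def)
  moreover have "(\<lambda>z. indicator {\<alpha><..<\<beta>} z * k (z * c)) \<in> borel_measurable lborel"
  proof -
    have "continuous_on {\<alpha><..<\<beta>} (\<lambda>z. k (z * c))"
      using sub by (intro continuous_on_compose2[OF cont]) (auto intro!: continuous_intros)
    from borel_measurable_continuous_on_indicator[OF _ this] show ?thesis by simp
  qed
  ultimately show ?thesis
    by (subst has_bochner_integral_cong_AE[symmetric]) (auto simp: diff_divide_distrib dest: has_bochner_integral_integrable borel_measurable_integrable)
qed

context decaying_function
begin

text \<open>The bound G \<le> K z gives convergence at 0, and G \<le> K / z gives convergence at
  infinity.\<close>

lemma nn_integral_v_powr_finite:
  assumes p: "1 < p"
  shows "(\<integral>\<^sup>+z. ennreal ((z * v z) powr p / z) * indicator {0<..} z \<partial>lborel) < \<infinity>"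
proof -
  obtain K where K: "0 < K" and K_le: "\<And>z. 0 < z \<Longrightarrow> z * v z \<le> K * z" "\<And>z. 0 < z \<Longrightarrow> z * v z \<le> K / z"
    using v_decay by blast
  have "(\<integral>\<^sup>+z. ennreal ((z * v z) powr p / z) * indicator {0<..} z \<partial>lborel)
     \<le> (\<integral>\<^sup>+z. ennreal (K powr p) * (ennreal (p * z powr (p - 1)) * indicator {0..1} z) + ennreal (K powr p) * (ennreal (z powr (- p - 1)) * indicator {1..} z) \<partial>lborel)"
  proof (rule nn_integral_mono)
    fix z :: real
    show "ennreal ((z * v z) powr p / z) * indicator {0<..} z
      \<le> ennreal (K powr p) * (ennreal (p * z powr (p - 1)) * indicator {0..1} z) + ennreal (K powr p) * (ennreal (z powr (- p - 1)) * indicator {1..} z)"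
    proof (cases "z > 0")
      case True
      show ?thesis
      proof (cases "z \<le> 1")
        case z1: True
        have "(z * v z) powr p / z \<le> (K * z) powr p / z"
          using True K_le(1)[OF True] p v_nonneg[of z] by (intro divide_right_mono powr_mono2) auto
        also have "\<dots> = K powr p * z powr (p - 1)" using True K by (simp add: powr_mult powr_diff)
        also have "\<dots> \<le> K powr p * (p * z powr (p - 1))" using p by (intro mult_left_mono) (auto simp: mult_le_cancel_right1)
        finally have "ennreal ((z * v z) powr p / z) \<le> ennreal (K powr p) * ennreal (p * z powr (p - 1))"
          using p by (simp add: ennreal_mult'[symmetric] ennreal_leI)
        thus ?thesis using True z1 by (auto simp: indicator_def intro: order_trans add_increasing2)
      next
        case z1: False
        have "(z * v z) powr p / z \<le> (K / z) powr p / z"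
          using True K_le(2)[OF True] p v_nonneg[of z] by (intro divide_right_mono powr_mono2) auto
        also have "\<dots> = K powr p * z powr (- p - 1)" using True K by (simp add: powr_divide powr_diff powr_minus field_simps)
        finally have "ennreal ((z * v z) powr p / z) \<le> ennreal (K powr p) * ennreal (z powr (- p - 1))"
          by (simp add: ennreal_mult'[symmetric] ennreal_leI)
        thus ?thesis using True z1 by (auto simp: indicator_def)
      qed
    qed auto
  qed
  also have "\<dots> = ennreal (K powr p) * (\<integral>\<^sup>+z. ennreal (p * z powr (p - 1)) * indicator {0..1} z \<partial>lborel)
       + ennreal (K powr p) * (\<integral>\<^sup>+z. ennreal (z powr (- p - 1)) * indicator {1..} z \<partial>lborel)"
    by (simp add: nn_integral_add nn_integral_cmult)
  also have "(\<integral>\<^sup>+z. ennreal (p * z powr (p - 1)) * indicator {0..1::real} z \<partial>lborel) = ennreal (1 powr p)"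
    using p by (intro nn_integral_powr_Icc) auto
  also have "(\<integral>\<^sup>+z. ennreal (z powr (- p - 1)) * indicator {1..} z \<partial>lborel) = ennreal (0 - (- (1 powr (- p) / p)))"
  proof (rule nn_integral_FTC_atLeast)
    show "(\<lambda>z. z powr (- p - 1)) \<in> borel_measurable borel" by measurable
    have "((\<lambda>z. z powr (- p)) \<longlongrightarrow> 0) at_top" using p by (intro tendsto_neg_powr filterlim_ident) auto
    from tendsto_mult[OF this tendsto_const[of "- (1 / p)"]]
    show "((\<lambda>z. - (z powr (- p) / p)) \<longlongrightarrow> 0) at_top" by simp
    fix z :: real assume "1 \<le> z"
    thus "((\<lambda>z. - (z powr (- p) / p)) has_real_derivative z powr (- p - 1)) (at z)"
      using p by (auto intro!: derivative_eq_intros)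
  qed auto
  finally show ?thesis by (auto simp: ennreal_mult_less_top order_le_less_trans)
qed

text \<open>The kernel k(z t) is symmetric in radius and level, and the region \<alpha> < z < R(t),
  t > 0 is also 0 < t < v(z), z > \<alpha>. Integrating first in z or first in t uses the same
  primitive and gives the two sides. The linear bound on \<open>k\<close> makes the double integral
  absolutely convergent, being dominated by a multiple of the integral of G^2 dz/z.\<close>

lemma levels_radii_exchange:
  fixes Q k :: "real \<Rightarrow> real"
  assumes deriv: "\<And>y. 0 \<le> y \<Longrightarrow> y \<le> b \<Longrightarrow> (Q has_real_derivative k y) (at y within {0..b})"
    and cont: "continuous_on {0..b} k" and k [measurable]: "k \<in> borel_measurable borel"
    and bd: "\<And>y. 0 \<le> y \<Longrightarrow> y \<le> b \<Longrightarrow> \<bar>k y\<bar> \<le> C * y"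
    and Q0: "Q 0 = 0" and \<alpha>: "0 \<le> \<alpha>"
    and Rb: "\<And>t. 0 < t \<Longrightarrow> R t * t \<le> b"
    and vb: "\<And>z. 0 < z \<Longrightarrow> z * v z \<le> b"
  shows "integrable lborel (\<lambda>t. indicator {t. 0 < t \<and> \<alpha> < R t} t * ((Q (R t * t) - Q (\<alpha> * t)) / t))"
    and "integrable lborel (\<lambda>z. indicator {\<alpha><..} z * (Q (z * v z) / z))"
    and "(\<integral>t. indicator {t. 0 < t \<and> \<alpha> < R t} t * ((Q (R t * t) - Q (\<alpha> * t)) / t) \<partial>lborel)
       = (\<integral>z. indicator {\<alpha><..} z * (Q (z * v z) / z) \<partial>lborel)"
proof -
  define D where "D t z = indicator {p. 0 < fst p \<and> \<alpha> < snd p \<and> snd p < R (fst p)} (t, z) * k (z * t)" for t z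
  have Dm [measurable]: "(\<lambda>(t, z). D t z) \<in> borel_measurable (lborel \<Otimes>\<^sub>M lborel)"
    unfolding D_def by measurable
  have D1: "D t z = (if 0 < t \<and> \<alpha> < R t then indicator {\<alpha><..<R t} z * k (z * t) else 0)" for t z
    by (auto simp: D_def indicator_def)
  have D2: "D t z = (if \<alpha> < z then indicator {0<..<v z} t * k (t * z) else 0)" for t z
    using less_v_iff[of t z] \<alpha> by (auto simp: D_def indicator_def mult.commute)
  have int1: "has_bochner_integral lborel (D t) (indicator {t. 0 < t \<and> \<alpha> < R t} t * ((Q (R t * t) - Q (\<alpha> * t)) / t))" for t
  proof (cases "0 < t \<and> \<alpha> < R t")
    case True
    have "has_bochner_integral lborel (\<lambda>z. indicator {\<alpha><..<R t} z * k (z * t)) ((Q (R t * t) - Q (\<alpha> * t)) / t)"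
      using True \<alpha> Rb by (intro has_bochner_integral_FTC_scaled[OF deriv cont]) auto
    moreover have "D t = (\<lambda>z. indicator {\<alpha><..<R t} z * k (z * t))" using True by (intro ext) (simp add: D1)
    ultimately show ?thesis using True by simp
  next
    case False
    hence "D t = (\<lambda>z. 0)" by (intro ext) (auto simp: D1)
    thus ?thesis using False by (simp add: has_bochner_integral_zero)
  qed
  have int2: "has_bochner_integral lborel (\<lambda>t. D t z) (indicator {\<alpha><..} z * (Q (z * v z) / z))" for z
  proof (cases "\<alpha> < z")
    case True
    have "has_bochner_integral lborel (\<lambda>t. indicator {0<..<v z} t * k (t * z)) ((Q (v z * z) - Q (0 * z)) / z)"
      using True \<alpha> vb[of z] v_nonneg[of z]
      by (intro has_bochner_integral_FTC_scaled[OF deriv cont]) (auto simp: mult.commute)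
    thus ?thesis using True by (simp add: D2 Q0 mult.commute)
  next
    case False
    thus ?thesis by (simp add: D2 has_bochner_integral_zero)
  qed
  have "integrable (lborel \<Otimes>\<^sub>M lborel) (\<lambda>(t, z). D t z)"
  proof (rule integrableI_bounded)
    have "(\<integral>\<^sup>+p. ennreal (norm (case p of (t, z) \<Rightarrow> D t z)) \<partial>(lborel \<Otimes>\<^sub>M lborel))
        = (\<integral>\<^sup>+z. \<integral>\<^sup>+t. ennreal (norm (D t z)) \<partial>lborel \<partial>lborel)"
      by (subst lborel_pair.nn_integral_snd[symmetric]) auto
    also have "\<dots> \<le> (\<integral>\<^sup>+z. ennreal \<bar>C\<bar> * (ennreal ((z * v z) powr 2 / z) * indicator {0<..} z) \<partial>lborel)"
    proof (rule nn_integral_mono)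
      fix z :: real
      show "(\<integral>\<^sup>+t. ennreal (norm (D t z)) \<partial>lborel) \<le> ennreal \<bar>C\<bar> * (ennreal ((z * v z) powr 2 / z) * indicator {0<..} z)"
      proof (cases "\<alpha> < z")
        case True
        hence z: "z > 0" using \<alpha> by simp
        have "(\<integral>\<^sup>+t. ennreal (norm (D t z)) \<partial>lborel) \<le> (\<integral>\<^sup>+t. ennreal (\<bar>C\<bar> * (z * v z)) * indicator {0..v z} t \<partial>lborel)"
        proof (rule nn_integral_mono)
          fix t :: real
          show "ennreal (norm (D t z)) \<le> ennreal (\<bar>C\<bar> * (z * v z)) * indicator {0..v z} t"
          proof (cases "0 < t \<and> t < v z")
            case t: True
            have tz: "t * z \<le> z * v z" using t z by (simp add: mult.commute)
            have "\<bar>k (t * z)\<bar> \<le> C * (t * z)" using t z order_trans[OF tz vb[OF z]] by (intro bd) auto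
            also have "\<dots> \<le> \<bar>C\<bar> * (t * z)" using t z by (intro mult_right_mono) auto
            also have "\<dots> \<le> \<bar>C\<bar> * (z * v z)" using tz by (intro mult_left_mono) auto
            finally show ?thesis using True t by (simp add: D2 ennreal_leI)
          next
            case False
            hence "D t z = 0" by (auto simp: D2)
            thus ?thesis by simp
          qed
        qed
        also have "\<dots> = ennreal (\<bar>C\<bar> * (z * v z)) * ennreal (v z)"
          using v_nonneg[of z] by (simp add: nn_integral_cmult_indicator)
        also have "\<dots> = ennreal \<bar>C\<bar> * ennreal ((z * v z) powr 2 / z)"
          using v_nonneg[of z] z by (simp add: ennreal_mult'[symmetric] powr_numeral power2_eq_square mult.assoc)
        finally show ?thesis using z by simp
      next
        case False
        thus ?thesis by (simp add: D2)
      qed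
    qed
    also have "\<dots> = ennreal \<bar>C\<bar> * (\<integral>\<^sup>+z. ennreal ((z * v z) powr 2 / z) * indicator {0<..} z \<partial>lborel)"
      by (intro nn_integral_cmult) measurable
    also have "\<dots> < \<infinity>" using nn_integral_v_powr_finite[of 2] by (simp add: ennreal_mult_less_top)
    finally show "(\<integral>\<^sup>+p. ennreal (norm (case p of (t, z) \<Rightarrow> D t z)) \<partial>(lborel \<Otimes>\<^sub>M lborel)) < \<infinity>" .
  qed measurable
  note int = this
  have e1: "(\<integral>z. D t z \<partial>lborel) = indicator {t. 0 < t \<and> \<alpha> < R t} t * ((Q (R t * t) - Q (\<alpha> * t)) / t)" for t
    using int1 by (rule has_bochner_integral_integral_eq)
  have e2: "(\<integral>t. D t z \<partial>lborel) = indicator {\<alpha><..} z * (Q (z * v z) / z)" for z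
    using int2 by (rule has_bochner_integral_integral_eq)
  show "integrable lborel (\<lambda>t. indicator {t. 0 < t \<and> \<alpha> < R t} t * ((Q (R t * t) - Q (\<alpha> * t)) / t))"
    using lborel_pair.integrable_fst[OF int] by (simp add: e1)
  show "integrable lborel (\<lambda>z. indicator {\<alpha><..} z * (Q (z * v z) / z))"
    using lborel_pair.integrable_snd[OF int] by (simp add: e2)
  show "(\<integral>t. indicator {t. 0 < t \<and> \<alpha> < R t} t * ((Q (R t * t) - Q (\<alpha> * t)) / t) \<partial>lborel)
       = (\<integral>z. indicator {\<alpha><..} z * (Q (z * v z) / z) \<partial>lborel)"
    using lborel_pair.Fubini_integral[OF int] by (simp add: e1 e2)
qed

end

section \<open>The calibration\<close>

text \<open>The extremal \<open>G\<close> of the one-dimensional problem solves \<open>dG/ds = \<plusminus> G S(G)\<close>, where \<open>S\<close> is the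
  following function and \<open>M = max G\<close>.\<close>

definition profile :: "real \<Rightarrow> real \<Rightarrow> real \<Rightarrow> real \<Rightarrow> real" where
  "profile lam M q y = lam * sqrt (1 - (y / M) powr (q - 2))"

text \<open>The derivative of y^2 S(y). The derivative of (y/M)^(q-2) appears only multiplied by y,
  so no negative power of y remains when q < 3 and the formula extends continuously to y =
  0.\<close>

definition profile_deriv :: "real \<Rightarrow> real \<Rightarrow> real \<Rightarrow> real \<Rightarrow> real" where
  "profile_deriv lam M q y = 2 * y * profile lam M q y
     - lam * (q - 2) / 2 * y * (y / M) powr (q - 2) / sqrt (1 - (y / M) powr (q - 2))"

lemma profile_measurable [measurable]:
  "profile lam M q \<in> borel_measurable borel" "profile_deriv lam M q \<in> borel_measurable borel"
  unfolding profile_deriv_def[abs_def] profile_def[abs_def] by measurable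

context
  fixes lam M q \<eta> :: real
  assumes lam: "0 < lam" and M: "0 < M" and q: "2 < q" and \<eta>: "0 < \<eta>" "\<eta> < 1"
begin

text \<open>Up to \<open>\<eta> * M\<close> the radicand 1 - (y/M)^(q-2) stays above a positive
  constant. This margin is the reason for \<eta>, as the derivative of \<open>profile\<close> is
  singular at y = M.\<close>

lemma ratio_powr_le:
  assumes "0 \<le> y" "y \<le> \<eta> * M"
  shows "(y / M) powr (q - 2) \<le> \<eta> powr (q - 2)" "\<eta> powr (q - 2) < 1"
proof -
  have "y / M \<le> \<eta>" using assms M by (simp add: field_simps)
  thus "(y / M) powr (q - 2) \<le> \<eta> powr (q - 2)" using assms M q by (intro powr_mono2) auto
  have "\<eta> powr (q - 2) < 1 powr (q - 2)" using \<eta> q by (intro powr_less_mono2) auto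
  thus "\<eta> powr (q - 2) < 1" by simp
qed

lemma profile_nonneg: "0 \<le> y \<Longrightarrow> y \<le> \<eta> * M \<Longrightarrow> 0 \<le> profile lam M q y"
  using ratio_powr_le[of y] lam by (simp add: profile_def)

lemma profile_le: "0 \<le> y \<Longrightarrow> y \<le> \<eta> * M \<Longrightarrow> profile lam M q y \<le> lam"
  using ratio_powr_le[of y] lam by (auto simp: profile_def mult_le_cancel_left1)

lemma profile_power2:
  assumes "0 \<le> y" "y \<le> \<eta> * M"
  shows "(profile lam M q y)\<^sup>2 = lam\<^sup>2 * (1 - (y / M) powr (q - 2))"
  using ratio_powr_le[OF assms] by (simp add: profile_def power_mult_distrib)

lemma continuous_on_ratio_powr: "continuous_on {0..\<eta> * M} (\<lambda>y. (y / M) powr (q - 2))"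
  using M q by (intro continuous_on_powr') (auto intro!: continuous_intros)

lemma continuous_on_profile: "continuous_on {0..\<eta> * M} (profile lam M q)"
  unfolding profile_def[abs_def]
  by (intro continuous_on_mult continuous_on_const continuous_on_real_sqrt continuous_on_diff continuous_on_ratio_powr)

lemma continuous_on_profile_deriv: "continuous_on {0..\<eta> * M} (profile_deriv lam M q)"
  unfolding profile_deriv_def[abs_def]
proof (intro continuous_on_const continuous_on_id continuous_on_diff continuous_on_divide continuous_on_mult
    continuous_on_real_sqrt continuous_on_profile continuous_on_ratio_powr)
  show "\<forall>y\<in>{0..\<eta> * M}. sqrt (1 - (y / M) powr (q - 2)) \<noteq> 0"
  proof
    fix y assume "y \<in> {0..\<eta> * M}"
    hence "(y / M) powr (q - 2) < 1" using ratio_powr_le[of y] by auto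
    thus "sqrt (1 - (y / M) powr (q - 2)) \<noteq> 0" by simp
  qed
qed

text \<open>The point 0 is separate: for q < 3 the inner power y^(q-2) has no finite derivative
  there, but the difference quotient of the whole function is y S(y), which tends to 0.\<close>

lemma has_real_derivative_profile:
  assumes y: "0 \<le> y" "y \<le> \<eta> * M"
  shows "((\<lambda>y. y\<^sup>2 * profile lam M q y) has_real_derivative profile_deriv lam M q y) (at y within {0..\<eta> * M})"
proof (cases "y = 0")
  case True
  have "((\<lambda>y. y * profile lam M q y) \<longlongrightarrow> 0 * profile lam M q 0) (at 0 within {0..\<eta> * M})"
    using continuous_on_profile M \<eta> by (intro tendsto_mult tendsto_ident_at) (auto simp: continuous_on_def)
  hence "((\<lambda>y. y * profile lam M q y) \<longlongrightarrow> 0) (at 0 within {0..\<eta> * M})" by simp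
  moreover have "\<forall>\<^sub>F y in at 0 within {0..\<eta> * M}. y * profile lam M q y = (y\<^sup>2 * profile lam M q y - 0\<^sup>2 * profile lam M q 0) / (y - 0)"
    by (simp add: eventually_at_filter power2_eq_square)
  ultimately have "((\<lambda>y. (y\<^sup>2 * profile lam M q y - 0\<^sup>2 * profile lam M q 0) / (y - 0)) \<longlongrightarrow> 0) (at 0 within {0..\<eta> * M})"
    by (rule Lim_transform_eventually)
  moreover have "profile_deriv lam M q 0 = 0" by (simp add: profile_deriv_def)
  ultimately show ?thesis using True by (simp add: has_field_derivative_iff)
next
  case False
  hence y0: "0 < y" using y by simp
  define X where "X = (y / M) powr (q - 2)"
  define X' where "X' = (q - 2) * (y / M) powr (q - 2 - 1) * (1 / M)"
  have X: "X < 1" using ratio_powr_le[OF y] by (simp add: X_def)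
  have yX: "y * X' = (q - 2) * X"
  proof -
    have "X = (y / M) powr (q - 2 - 1) * (y / M)"
      unfolding X_def using powr_add[of "y / M" "q - 2 - 1" 1] y0 M by simp
    thus ?thesis by (simp add: X'_def)
  qed
  have "((\<lambda>y. (y / M) powr (q - 2)) has_real_derivative X') (at y)"
    unfolding X'_def
  proof (rule DERIV_chain2[where f = "\<lambda>z. z powr (q - 2)" and g = "\<lambda>y. y / M"])
    show "((\<lambda>z. z powr (q - 2)) has_real_derivative (q - 2) * (y / M) powr (q - 2 - 1)) (at (y / M))"
      using y0 M by (intro has_real_derivative_powr) auto
    show "((\<lambda>y. y / M) has_real_derivative 1 / M) (at y)" by (rule DERIV_cdivide[OF DERIV_ident])
  qed
  from DERIV_diff[OF DERIV_const[of 1] this]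
  have "((\<lambda>y. 1 - (y / M) powr (q - 2)) has_real_derivative - X') (at y)" by simp
  moreover have "(sqrt has_real_derivative inverse (sqrt (1 - X)) / 2) (at (1 - (y / M) powr (q - 2)))"
    using X by (auto intro!: DERIV_real_sqrt simp: X_def)
  ultimately have "((\<lambda>y. sqrt (1 - (y / M) powr (q - 2))) has_real_derivative (inverse (sqrt (1 - X)) / 2) * (- X')) (at y)"
    by (rule DERIV_chain2[rotated])
  from DERIV_mult[OF _ DERIV_cmult[OF this, of lam], of "\<lambda>y. y\<^sup>2" "2 * y"]
  have "((\<lambda>y. y\<^sup>2 * (lam * sqrt (1 - (y / M) powr (q - 2)))) has_real_derivative
      (2 * y) * (lam * sqrt (1 - X)) + (lam * ((inverse (sqrt (1 - X)) / 2) * (- X'))) * y\<^sup>2) (at y)"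
    using DERIV_power[OF DERIV_ident, of 2 y] by (simp add: X_def)
  moreover have "(2 * y) * (lam * sqrt (1 - X)) + (lam * ((inverse (sqrt (1 - X)) / 2) * (- X'))) * y\<^sup>2 = profile_deriv lam M q y"
  proof -
    have "(lam * ((inverse (sqrt (1 - X)) / 2) * (- X'))) * y\<^sup>2 = - (lam / 2 * y * (y * X') / sqrt (1 - X))"
      by (simp add: power2_eq_square inverse_eq_divide mult_ac)
    also have "\<dots> = - (lam * (q - 2) / 2 * y * X / sqrt (1 - X))" unfolding yX by simp
    finally show ?thesis by (simp add: profile_deriv_def profile_def X_def)
  qed
  ultimately show ?thesis
    unfolding profile_def by (simp add: has_field_derivative_at_within)
qed

text \<open>The linear growth bound that \<open>levels_radii_exchange\<close> asks of its kernel;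
  its constant blows up as \<eta> tends to 1 and enters only through integrability.\<close>

lemma profile_deriv_bound:
  assumes y: "0 \<le> y" "y \<le> \<eta> * M"
  shows "\<bar>profile_deriv lam M q y\<bar> \<le> (2 * lam + lam * (q - 2) / 2 / sqrt (1 - \<eta> powr (q - 2))) * y"
proof -
  define X where "X = (y / M) powr (q - 2)"
  have X: "0 \<le> X" "X \<le> \<eta> powr (q - 2)" "X < 1" "\<eta> powr (q - 2) < 1"
    using ratio_powr_le[OF y] by (auto simp: X_def)
  have "X / sqrt (1 - X) \<le> 1 / sqrt (1 - \<eta> powr (q - 2))" using X by (intro frac_le) auto
  hence "lam * (q - 2) / 2 * y * (X / sqrt (1 - X)) \<le> lam * (q - 2) / 2 * y * (1 / sqrt (1 - \<eta> powr (q - 2)))"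
    using lam q y by (intro mult_left_mono) auto
  moreover have "0 \<le> lam * (q - 2) / 2 * y * (X / sqrt (1 - X))" using lam q y X by simp
  moreover have "0 \<le> 2 * y * profile lam M q y" "2 * y * profile lam M q y \<le> 2 * y * lam"
    using y profile_nonneg[OF y] profile_le[OF y] by (auto intro!: mult_left_mono)
  moreover have "profile_deriv lam M q y = 2 * y * profile lam M q y - lam * (q - 2) / 2 * y * (X / sqrt (1 - X))"
    by (simp add: profile_deriv_def X_def)
  ultimately have "\<bar>profile_deriv lam M q y\<bar> \<le> 2 * y * lam + lam * (q - 2) / 2 * y * (1 / sqrt (1 - \<eta> powr (q - 2)))"
    by linarith
  also have "\<dots> = (2 * lam + lam * (q - 2) / 2 / sqrt (1 - \<eta> powr (q - 2))) * y"
  proof -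
    have "2 * y * lam + A * y * (1 / r) = (2 * lam + A / r) * y" for A r :: real by (simp add: algebra_simps)
    thus ?thesis .
  qed
  finally show ?thesis .
qed

end

section \<open>Level and radius as mutually inverse variables\<close>

context decaying_function
begin

lemma rad_power_eq_R: "rad t ^ (DIM('a) - 2) = (R t)\<^sup>2"
proof (cases "rad t = 0")
  case True
  have "DIM('a) - 2 > 0" using dim by simp
  thus ?thesis using True m_pos by (simp add: R_def power_0_left)
next
  case False
  hence pos: "0 < rad t" using rad_nonneg[of t] by simp
  have "(R t)\<^sup>2 = rad t powr (2 * m)" by (simp only: R_def power2_eq_square powr_add mult_2)
  also have "2 * m = real (DIM('a) - 2)" using dim by (simp add: m_def of_nat_diff)
  also have "rad t powr real (DIM('a) - 2) = rad t ^ (DIM('a) - 2)" using pos by (rule powr_realpow)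
  finally show ?thesis by simp
qed

text \<open>R(v(z)) \<le> z always holds, while every positive level below v(z) has R > z. Only a
  jump of \<open>R\<close> at v(z) could keep the two apart.\<close>

lemma R_v_eq:
  assumes z: "0 < z" and t: "0 < v z" and cont: "isCont R (v z)"
  shows "R (v z) = z"
proof (rule antisym)
  show "R (v z) \<le> z" using less_v_iff[of "v z" z] z t by auto
  have "(R \<longlongrightarrow> R (v z)) (at_left (v z))"
    using cont by (auto simp: isCont_def intro: tendsto_mono at_within_le_at)
  moreover have "\<forall>\<^sub>F s in at_left (v z). z \<le> R s"
    using eventually_at_left_real[OF t]
  proof eventually_elim
    case (elim s)
    thus ?case using less_v_iff[of s z] z by auto
  qed
  ultimately show "z \<le> R (v z)" by (rule tendsto_lowerbound) auto
qed

lemma countable_discont_R: "countable {t\<in>{0<..}. \<not> isCont R t}"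
proof -
  have "mono_on {0<..} (\<lambda>t. - R t)" by (auto simp: mono_on_def intro: R_antimono)
  hence "countable {t\<in>{0<..}. \<not> isCont (\<lambda>t. - R t) t}" by (intro mono_on_ctble_discont_open) auto
  moreover have "isCont (\<lambda>t. - R t) t \<longleftrightarrow> isCont R t" for t
    using isCont_minus[of t R] isCont_minus[of t "\<lambda>t. - R t"] by auto
  ultimately show ?thesis by simp
qed

text \<open>Translates powers of G in polar coordinates into the weights of the inequality; for p =
  2 the weight is |x|^(-2), because n - 2 m = 2.\<close>

lemma norm_powr_rearrangement:
  assumes p: "0 < p"
  shows "norm x powr (- real DIM('a)) * (norm x powr m * v (norm x powr m)) powr p = norm x powr (- (real DIM('a) - p * m)) * U x powr p"
proof -
  have "(norm x powr m * v (norm x powr m)) powr p = norm x powr (p * m) * U x powr p"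
    using v_nonneg by (simp add: U_def powr_mult powr_powr mult.commute)
  thus ?thesis by (simp add: powr_add[symmetric] mult.assoc[symmetric])
qed

end

context decaying_function_slope
begin

text \<open>The slope \<open>\<psi>\<close> below is set to zero at the countably many levels where \<open>R\<close> jumps: these are the
  plateaus of \<open>u\<close>, where level and radius do not determine each other.\<close>
lemma calibrated_energy_bound:
  fixes lam M q \<eta> z0 :: real
  assumes lam: "0 < lam" "lam \<le> m" and M: "0 < M" and q: "2 < q" "q * m \<le> real DIM('a)"
    and \<eta>: "0 < \<eta>" "\<eta> < 1" and vb: "\<And>z. 0 < z \<Longrightarrow> z * v z \<le> \<eta> * M" and z0: "0 < z0"
  defines "Bd \<equiv> (\<integral>t. indicator {0<..<v z0} t * (z0\<^sup>2 * t * profile lam M q (z0 * t)) \<partial>lborel)"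
  shows "ennreal (m\<^sup>2 - lam\<^sup>2) * (\<integral>\<^sup>+x. ennreal (norm x powr (- 2)) * ennreal (u x powr 2) \<partial>lborel)
       + ennreal (lam\<^sup>2 * M powr (2 - q)) * (\<integral>\<^sup>+x. ennreal (norm x powr (- (real DIM('a) - q * m))) * ennreal (u x powr q) \<partial>lborel)
       + ennreal (4 * (real DIM('a) * w) * Bd)
       \<le> (\<integral>\<^sup>+x. ennreal ((g x)\<^sup>2) \<partial>lborel)"
proof -
  let ?n = "real DIM('a)"
  define \<sigma> where "\<sigma> = ?n * w"
  have \<sigma>: "\<sigma> > 0" using w_pos by (simp add: \<sigma>_def)
  define S where "S = profile lam M q"
  define k0 where "k0 = profile_deriv lam M q"
  define b where "b = \<eta> * M"
  have b: "0 < b" using \<eta> M by (simp add: b_def)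
  note prof = profile_nonneg[OF lam(1) M q(1) \<eta>] profile_le[OF lam(1) M q(1) \<eta>]
  \<comment> \<open>The calibrating field is dG/ds = - e G S(G): G increases up to the radius
    \<open>z0\<close> and decreases beyond it.\<close>
  define e where "e z = (if z \<le> z0 then -1 else 1 :: real)" for z
  define Q where "Q z y = y\<^sup>2 * (m + e z * S y)" for z y
  have [measurable]: "S \<in> borel_measurable borel" "k0 \<in> borel_measurable borel" "e \<in> borel_measurable borel"
    unfolding S_def k0_def e_def[abs_def] by measurable
  have Sb: "0 \<le> S y" "S y \<le> m" if "0 \<le> y" "y \<le> b" for y
    using prof[of y] that lam unfolding S_def b_def by auto
  have eS: "0 \<le> m + e z * S y" "m + e z * S y \<le> 2 * m" if "0 \<le> y" "y \<le> b" for y z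
    using Sb[OF that] by (auto simp: e_def)
  have vb': "0 \<le> z * v z" "z * v z \<le> b" if "0 < z" for z
    using vb[OF that] v_nonneg[of z] that by (auto simp: b_def)
  \<comment> \<open>The bound on G carries over from radii to levels: otherwise a radius slightly
    below \<open>R t\<close> would violate it.\<close>
  have Rb: "R t * t \<le> b" if t: "0 < t" for t
  proof (rule ccontr)
    assume "\<not> R t * t \<le> b"
    hence "b / t < R t" using t by (simp add: field_simps)
    then obtain z where z: "b / t < z" "z < R t" using dense by blast
    have "0 < b / t" using b t by simp
    hence z0: "0 < z" using z by linarith
    hence "t < v z" using less_v_iff[of t z] t z by simp
    hence "z * t < z * v z" using z0 by simp
    moreover have "b < z * t" using z t by (simp add: field_simps)
    ultimately show False using vb'[OF z0] by linarith
  qed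

  have dL: "((\<lambda>y. y\<^sup>2 * S y) has_real_derivative k0 y) (at y within {0..b})" if "0 \<le> y" "y \<le> b" for y
    using has_real_derivative_profile[OF lam(1) M q(1) \<eta>, of y] that unfolding S_def k0_def b_def by simp
  have cL: "continuous_on {0..b} k0"
    using continuous_on_profile_deriv[OF lam(1) M q(1) \<eta>] unfolding k0_def b_def .
  define C where "C = 2 * lam + lam * (q - 2) / 2 / sqrt (1 - \<eta> powr (q - 2))"
  have bL: "\<bar>k0 y\<bar> \<le> C * y" if "0 \<le> y" "y \<le> b" for y
    using profile_deriv_bound[OF lam(1) M q(1) \<eta>, of y] that unfolding C_def k0_def b_def by simp
  \<comment> \<open>The branch of \<open>Q\<close> with sign -1, used at all radii. The other branch
    exceeds it by 2 y^2 S(y); this surplus occurs only beyond \<open>z0\<close> and is exchanged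
    separately with lower limit \<open>z0\<close>.\<close>
  define Q1 where "Q1 y = m * y\<^sup>2 - y\<^sup>2 * S y" for y
  have dQ1: "(Q1 has_real_derivative (2 * m * y - k0 y)) (at y within {0..b})" if "0 \<le> y" "y \<le> b" for y
  proof -
    have "((\<lambda>y. m * y\<^sup>2) has_real_derivative 2 * m * y) (at y within {0..b})"
      by (auto intro!: derivative_eq_intros)
    from DERIV_diff[OF this dL[OF that]] show ?thesis unfolding Q1_def .
  qed
  have cQ1: "continuous_on {0..b} (\<lambda>y. 2 * m * y - k0 y)"
    by (intro continuous_on_diff cL continuous_on_mult continuous_on_const continuous_on_id)
  have bQ1: "\<bar>2 * m * y - k0 y\<bar> \<le> (2 * m + C) * y" if "0 \<le> y" "y \<le> b" for y
  proof -
    have "\<bar>2 * m * y - k0 y\<bar> \<le> \<bar>2 * m * y\<bar> + \<bar>k0 y\<bar>" by (rule abs_triangle_ineq4)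
    also have "\<dots> \<le> 2 * m * y + C * y" using bL[OF that] that m_pos by simp
    finally show ?thesis by (simp add: algebra_simps)
  qed
  have z0': "0 \<le> z0" using z0 by simp
  have mQ1: "(\<lambda>y. 2 * m * y - k0 y) \<in> borel_measurable borel" by measurable
  have Q10: "Q1 0 = 0" by (simp add: Q1_def)
  have L0: "(0::real)\<^sup>2 * S 0 = 0" by simp
  note ex1' = levels_radii_exchange[OF dQ1 cQ1 mQ1 bQ1 Q10 order_refl Rb vb'(2)]
  note ex2' = levels_radii_exchange[OF dL cL \<open>k0 \<in> _\<close> bL L0 z0' Rb vb'(2)]

  define f1 where "f1 t = indicator {t. 0 < t \<and> 0 < R t} t * ((Q1 (R t * t) - Q1 (0 * t)) / t)" for t
  define f2 where "f2 t = indicator {t. 0 < t \<and> z0 < R t} t * (((R t * t)\<^sup>2 * S (R t * t) - (z0 * t)\<^sup>2 * S (z0 * t)) / t)" for t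
  define f3 where "f3 t = indicator {0<..<v z0} t * (z0\<^sup>2 * t * S (z0 * t))" for t
  define g1 where "g1 z = indicator {0<..} z * (Q1 (z * v z) / z)" for z
  define g2 where "g2 z = indicator {z0<..} z * ((z * v z)\<^sup>2 * S (z * v z) / z)" for z
  define FF where "FF t = indicator {0<..} t * (Q (R t) (R t * t) / t)" for t
  define GG where "GG z = indicator {0<..} z * (Q z (z * v z) / z)" for z
  note ex1 = ex1'[folded f1_def g1_def]
  note ex2 = ex2'[folded f2_def g2_def]
  \<comment> \<open>The exchange with lower limit \<open>z0\<close> yields differences from the
    value at \<open>z0 * t\<close>; \<open>f3\<close> restores that value. With y = z0 t its
    integral is that of y S(y) from 0 to z0 v(z0): this is the boundary term
    \<open>Bd\<close>.\<close>
  have Fsum: "FF t = f1 t + 2 * f2 t + 2 * f3 t" for t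
  proof (cases "0 < t")
    case True
    show ?thesis
    proof (cases "z0 < R t")
      case zR: True
      hence "t < v z0" using less_v_iff[OF True z0'] by simp
      moreover have "0 < R t" using zR z0 by simp
      ultimately show ?thesis using True zR
        by (simp add: FF_def f1_def f2_def f3_def Q_def Q1_def e_def field_simps power2_eq_square)
    next
      case zR: False
      hence "\<not> t < v z0" using less_v_iff[OF True z0'] by simp
      moreover have "R t = 0 \<or> 0 < R t" using R_nonneg[of t] by auto
      ultimately show ?thesis using True zR
        by (auto simp: FF_def f1_def f2_def f3_def Q_def Q1_def e_def indicator_def algebra_simps)
    qed
  qed (simp add: FF_def f1_def f2_def f3_def)
  have Gsum: "GG z = g1 z + 2 * g2 z" for z
    using z0 by (auto simp: GG_def g1_def g2_def Q_def Q1_def e_def indicator_def field_simps)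
  have i3: "integrable lborel f3"
  proof -
    have "continuous_on {0..v z0} (\<lambda>t. z0\<^sup>2 * t * S (z0 * t))"
    proof (intro continuous_on_mult continuous_on_const continuous_on_id)
      have zt: "z0 * t \<in> {0..b}" if "t \<in> {0..v z0}" for t
      proof -
        have "z0 * t \<le> z0 * v z0" using that z0 by (intro mult_left_mono) auto
        hence "z0 * t \<le> b" using vb'[OF z0] by linarith
        thus ?thesis using that z0 by simp
      qed
      have cS: "continuous_on {0..b} S"
        using continuous_on_profile[OF lam(1) M q(1) \<eta>] unfolding S_def b_def .
      show "continuous_on {0..v z0} (\<lambda>t. S (z0 * t))"
        by (rule continuous_on_compose2[OF cS continuous_on_mult[OF continuous_on_const continuous_on_id]])
           (use zt in blast)
    qed
    hence "integrable lborel (\<lambda>t. indicator {0..v z0} t *\<^sub>R (z0\<^sup>2 * t * S (z0 * t)))"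
      by (intro borel_integrable_compact) auto
    moreover have "AE t in lborel. indicator {0..v z0} t *\<^sub>R (z0\<^sup>2 * t * S (z0 * t)) = f3 t"
      using AE_lborel_singleton[of 0] AE_lborel_singleton[of "v z0"] by eventually_elim (auto simp: f3_def indicator_def)
    ultimately show ?thesis unfolding f3_def by (subst (asm) integrable_cong_AE) auto
  qed
  have FF: "FF = (\<lambda>t. f1 t + 2 * f2 t + 2 * f3 t)" and GG: "GG = (\<lambda>z. g1 z + 2 * g2 z)"
    using Fsum Gsum by auto
  have iF: "integrable lborel FF"
    unfolding FF by (intro Bochner_Integration.integrable_add integrable_mult_right ex1(1) ex2(1) i3)
  have iG: "integrable lborel GG"
    unfolding GG by (intro Bochner_Integration.integrable_add integrable_mult_right ex1(2) ex2(2))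
  have "(\<integral>t. FF t \<partial>lborel) = (\<integral>t. f1 t \<partial>lborel) + 2 * (\<integral>t. f2 t \<partial>lborel) + 2 * (\<integral>t. f3 t \<partial>lborel)"
    unfolding Fsum using ex1(1) ex2(1) i3 by simp
  also have "\<dots> = (\<integral>z. g1 z \<partial>lborel) + 2 * (\<integral>z. g2 z \<partial>lborel) + 2 * Bd"
    using ex1(3) ex2(3) by (simp add: Bd_def S_def f3_def)
  also have "\<dots> = (\<integral>z. GG z \<partial>lborel) + 2 * Bd"
    unfolding Gsum using ex1(2) ex2(2) by simp
  finally have FG: "(\<integral>t. FF t \<partial>lborel) = (\<integral>z. GG z \<partial>lborel) + 2 * Bd" .
  have F0: "0 \<le> FF t" for t
    using Rb[of t] eS(1)[of "R t * t"] R_nonneg[of t] by (auto simp: FF_def Q_def indicator_def)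
  have G0: "0 \<le> GG z" for z
    using vb'[of z] eS(1)[of "z * v z"] by (auto simp: GG_def Q_def indicator_def)
  have B0: "0 \<le> Bd"
    unfolding Bd_def
  proof (rule integral_nonneg_AE, rule AE_I2)
    fix t :: real
    have "0 \<le> S (z0 * t)" if "0 < t" "t < v z0"
    proof (rule Sb(1))
      have "z0 * t \<le> z0 * v z0" using that z0 by (intro mult_left_mono) auto
      thus "z0 * t \<le> b" using vb'[OF z0] by linarith
    qed (use that z0 in auto)
    thus "0 \<le> indicator {0<..<v z0} t * (z0\<^sup>2 * t * profile lam M q (z0 * t))"
      by (auto simp: indicator_def S_def)
  qed

  define Nd where "Nd = {t\<in>{0<..}. \<not> isCont R t}"
  have Nd: "countable Nd" "Nd \<in> sets borel"
    using countable_discont_R by (auto simp: Nd_def intro: sets.countable[of _ borel])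
  \<comment> \<open>For a radial function u = |x|^(-m) G one has -u' = (u / r) (m - (dG/ds) / G).
    Inserting the calibrating field gives the slope at level \<open>t\<close>.\<close>
  define \<psi> where "\<psi> t = indicator ({0<..} - Nd) t * (t / rad t * (m + e (R t) * S (R t * t)))" for t
  have [measurable]: "\<psi> \<in> borel_measurable borel" unfolding \<psi>_def using Nd(2) by measurable
  have \<psi>0: "0 \<le> \<psi> t" for t
    using Rb[of t] eS(1)[of "R t * t"] R_nonneg[of t] rad_nonneg[of t] by (auto simp: \<psi>_def indicator_def)

  define T1 where "T1 = (\<integral>\<^sup>+t. ennreal (\<psi> t) * (ennreal (perim t) * indicator {0<..} t) \<partial>lborel)"
  define T2 where "T2 = (\<integral>\<^sup>+x. ennreal ((\<psi> (u x))\<^sup>2) \<partial>lborel)"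
  define G2 where "G2 = (\<integral>\<^sup>+x. ennreal ((g x)\<^sup>2) \<partial>lborel)"
  have "ennreal 2 * T1 \<le> ennreal 2 * (\<integral>\<^sup>+x. ennreal (\<psi> (u x)) * (ennreal (g x) * indicator {x. 0 < u x} x) \<partial>lborel)"
    unfolding T1_def by (intro mult_left_mono isoperimetric) auto
  also have "\<dots> = (\<integral>\<^sup>+x. ennreal 2 * (ennreal (\<psi> (u x)) * (ennreal (g x) * indicator {x. 0 < u x} x)) \<partial>lborel)"
    by (intro nn_integral_cmult[symmetric]) measurable
  also have "\<dots> \<le> (\<integral>\<^sup>+x. ennreal ((g x)\<^sup>2) + ennreal ((\<psi> (u x))\<^sup>2) \<partial>lborel)"
  proof (rule nn_integral_mono)
    fix x
    have "ennreal 2 * (ennreal (\<psi> (u x)) * (ennreal (g x) * indicator {x. 0 < u x} x)) \<le> ennreal (2 * \<psi> (u x) * g x)"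
      using \<psi>0 g_nonneg by (auto simp: indicator_def ennreal_mult mult.assoc)
    also have "\<dots> \<le> ennreal ((g x)\<^sup>2 + (\<psi> (u x))\<^sup>2)"
      using sum_squares_bound[of "\<psi> (u x)" "g x"] by (intro ennreal_leI) (simp add: add.commute)
    finally show "ennreal 2 * (ennreal (\<psi> (u x)) * (ennreal (g x) * indicator {x. 0 < u x} x)) \<le> ennreal ((g x)\<^sup>2) + ennreal ((\<psi> (u x))\<^sup>2)"
      by simp
  qed
  also have "\<dots> = G2 + T2" unfolding G2_def T2_def by (intro nn_integral_add) measurable
  finally have main: "ennreal 2 * T1 \<le> G2 + T2" .

  have "T1 = (\<integral>\<^sup>+t. ennreal (\<sigma> * FF t) \<partial>lborel)"
    unfolding T1_def
  proof (rule nn_integral_cong_AE)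
    \<comment> \<open>Setting \<psi> to 0 on a countable set of levels is invisible to an integral
      over levels, even though {u = t} may have positive volume for such \<open>t\<close>.\<close>
    have "AE t in lborel. t \<notin> Nd" using Nd by (intro AE_not_in countable_imp_null_set_lborel)
    thus "AE t in lborel. ennreal (\<psi> t) * (ennreal (perim t) * indicator {0<..} t) = ennreal (\<sigma> * FF t)"
    proof eventually_elim
      case (elim t)
      show ?case
      proof (cases "0 < t")
        case True
        have "\<psi> t * rad t ^ (DIM('a) - 1) = Q (R t) (R t * t) / t"
        proof (cases "rad t = 0")
          case True
          thus ?thesis using m_pos by (simp add: \<psi>_def Q_def R_def)
        next
          case False
          have "DIM('a) - 1 = Suc (DIM('a) - 2)" using dim by simp
          hence "rad t ^ (DIM('a) - 1) = rad t * (R t)\<^sup>2" using rad_power_eq_R[of t] by simp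
          thus ?thesis using True False elim by (simp add: \<psi>_def Q_def power_mult_distrib power2_eq_square)
        qed
        hence "FF t = \<psi> t * rad t ^ (DIM('a) - 1)" using True by (simp add: FF_def)
        hence "\<psi> t * perim t = \<sigma> * FF t"
          by (simp add: \<sigma>_def perim_def)
        thus ?thesis using True \<psi>0[of t] by (simp add: ennreal_mult'[symmetric])
      qed (simp add: FF_def)
    qed
  qed
  also have "\<dots> = ennreal (\<integral>t. \<sigma> * FF t \<partial>lborel)"
    using iF F0 \<sigma> by (intro nn_integral_eq_integral integrable_mult_right) auto
  also have "\<dots> = ennreal (\<sigma> * ((\<integral>z. GG z \<partial>lborel) + 2 * Bd))" using FG by simp
  finally have T1: "T1 = ennreal (\<sigma> * ((\<integral>z. GG z \<partial>lborel) + 2 * Bd))" .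
  have "ennreal 2 * T1 = ennreal (2 * \<sigma> * (\<integral>z. GG z \<partial>lborel)) + ennreal (4 * \<sigma> * Bd)"
  proof -
    define I where "I = (\<integral>z. GG z \<partial>lborel)"
    have "0 \<le> I" unfolding I_def using G0 by (intro integral_nonneg_AE) auto
    hence "ennreal 2 * ennreal (\<sigma> * (I + 2 * Bd)) = ennreal (2 * \<sigma> * I) + ennreal (4 * \<sigma> * Bd)"
      using \<sigma> B0 by (subst ennreal_mult[symmetric], simp_all del: ennreal_plus add: ennreal_plus[symmetric] algebra_simps)
    thus ?thesis unfolding T1 by (simp add: I_def)
  qed
  also have "ennreal (2 * \<sigma> * (\<integral>z. GG z \<partial>lborel)) = (\<integral>\<^sup>+z. ennreal (2 * \<sigma> * GG z) \<partial>lborel)"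
    using iG G0 \<sigma> by (subst nn_integral_eq_integral) auto
  finally have T1_eq: "ennreal 2 * T1 = (\<integral>\<^sup>+z. ennreal (2 * \<sigma> * GG z) \<partial>lborel) + ennreal (4 * \<sigma> * Bd)" .

  \<comment> \<open>Away from the plateaus this is |x|^n \<psi>(U)^2 at z = |x|^m;
    \<open>pol\<close> puts the weight |x|^(-n) back.\<close>
  define \<Phi>1 where "\<Phi>1 z = (z * v z)\<^sup>2 * (m + e z * S (z * v z))\<^sup>2" for z
  have [measurable]: "\<Phi>1 \<in> borel_measurable borel" unfolding \<Phi>1_def by measurable
  define pol where "pol \<Phi> = (\<integral>\<^sup>+z. ennreal (?n * unit_ball_vol ?n / m / z) * \<Phi> z * indicator {0<..} z \<partial>lborel)" for \<Phi>
  have split: "(\<integral>\<^sup>+z. ennreal (2 * \<sigma> * GG z) \<partial>lborel) = pol (\<lambda>z. ennreal (\<Phi>1 z))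
      + ennreal (m\<^sup>2 - lam\<^sup>2) * pol (\<lambda>z. ennreal ((z * v z) powr 2))
      + ennreal (lam\<^sup>2 * M powr (2 - q)) * pol (\<lambda>z. ennreal ((z * v z) powr q))"
  proof -
    let ?c = "\<lambda>z. ennreal (?n * unit_ball_vol ?n / m / z)"
    have ml: "0 \<le> m\<^sup>2 - lam\<^sup>2" using lam by (simp add: power_mono)
    have "(\<integral>\<^sup>+z. ennreal (2 * \<sigma> * GG z) \<partial>lborel) = (\<integral>\<^sup>+z. ?c z * ennreal (\<Phi>1 z) * indicator {0<..} z
      + ennreal (m\<^sup>2 - lam\<^sup>2) * (?c z * ennreal ((z * v z) powr 2) * indicator {0<..} z)
      + ennreal (lam\<^sup>2 * M powr (2 - q)) * (?c z * ennreal ((z * v z) powr q) * indicator {0<..} z) \<partial>lborel)"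
    proof (rule nn_integral_cong)
      fix z :: real
      show "ennreal (2 * \<sigma> * GG z) = ?c z * ennreal (\<Phi>1 z) * indicator {0<..} z
        + ennreal (m\<^sup>2 - lam\<^sup>2) * (?c z * ennreal ((z * v z) powr 2) * indicator {0<..} z)
        + ennreal (lam\<^sup>2 * M powr (2 - q)) * (?c z * ennreal ((z * v z) powr q) * indicator {0<..} z)"
      proof (cases "0 < z")
        case True
        define y where "y = z * v z"
        have y: "0 \<le> y" "y \<le> b" using vb'[OF True] by (auto simp: y_def)
        define c where "c = \<sigma> / m / z"
        have c: "0 \<le> c" using \<sigma> m_pos True by (simp add: c_def)
        have S2: "(S y)\<^sup>2 = lam\<^sup>2 * (1 - (y / M) powr (q - 2))"
          using profile_power2[OF lam(1) M q(1) \<eta>, of y] y unfolding S_def b_def by simp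
        have e2: "(e z)\<^sup>2 = 1" by (simp add: e_def)
        have "y\<^sup>2 * (y / M) powr (q - 2) = M powr (2 - q) * y powr q"
        proof (cases "y = 0")
          case False
          hence "0 < y" using y by simp
          thus ?thesis using M by (simp add: powr_divide powr_diff powr_numeral field_simps)
        qed simp
        hence yq: "lam\<^sup>2 * (y\<^sup>2 * (y / M) powr (q - 2)) = lam\<^sup>2 * M powr (2 - q) * y powr q" by simp
        \<comment> \<open>Because \<open>e z\<close> is a sign, the linear term is the square plus
          m^2 - S^2, where the sign no longer occurs. The formula for S^2 splits the remainder into
          the multiples of y^2 and y^q that become the two weighted integrals.\<close>
        have sq: "2 * m * (m + e z * S y) = (m + e z * S y)\<^sup>2 + (m\<^sup>2 - (S y)\<^sup>2)"
        proof -
          have "(m + e z * S y)\<^sup>2 = m\<^sup>2 + 2 * m * (e z * S y) + (e z)\<^sup>2 * (S y)\<^sup>2"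
            by (simp add: power2_sum power_mult_distrib)
          thus ?thesis unfolding e2 by (simp add: algebra_simps power2_eq_square)
        qed
        have "2 * \<sigma> * (Q z y / z) = c * (y\<^sup>2 * (2 * m * (m + e z * S y)))"
          using m_pos by (simp add: Q_def c_def)
        also have "\<dots> = c * (y\<^sup>2 * (m + e z * S y)\<^sup>2) + (m\<^sup>2 - lam\<^sup>2) * (c * y\<^sup>2) + c * (lam\<^sup>2 * (y\<^sup>2 * (y / M) powr (q - 2)))"
          unfolding sq S2 by (simp add: algebra_simps)
        also have "\<dots> = c * \<Phi>1 z + (m\<^sup>2 - lam\<^sup>2) * (c * y powr 2) + lam\<^sup>2 * M powr (2 - q) * (c * y powr q)"
          unfolding yq using y by (simp add: \<Phi>1_def y_def[symmetric] powr_numeral)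
        finally have "ennreal (2 * \<sigma> * (Q z y / z)) = ennreal (c * \<Phi>1 z) + ennreal ((m\<^sup>2 - lam\<^sup>2) * (c * y powr 2)) + ennreal (lam\<^sup>2 * M powr (2 - q) * (c * y powr q))"
          using c ml by (simp add: \<Phi>1_def)
        also have "\<dots> = ennreal c * ennreal (\<Phi>1 z) + ennreal (m\<^sup>2 - lam\<^sup>2) * (ennreal c * ennreal (y powr 2)) + ennreal (lam\<^sup>2 * M powr (2 - q)) * (ennreal c * ennreal (y powr q))"
          using c ml by (simp add: ennreal_mult \<Phi>1_def)
        finally show ?thesis using True by (simp add: GG_def y_def c_def \<sigma>_def w_def)
      qed (simp add: GG_def)
    qed
    also have "\<dots> = pol (\<lambda>z. ennreal (\<Phi>1 z))
      + ennreal (m\<^sup>2 - lam\<^sup>2) * pol (\<lambda>z. ennreal ((z * v z) powr 2))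
      + ennreal (lam\<^sup>2 * M powr (2 - q)) * pol (\<lambda>z. ennreal ((z * v z) powr q))"
      unfolding pol_def by (subst nn_integral_add, measurable)+ (simp add: nn_integral_cmult)
    finally show ?thesis .
  qed
  have pol: "pol \<Phi> = (\<integral>\<^sup>+x. ennreal (norm x powr (- ?n)) * \<Phi> (norm (x::'a) powr m) \<partial>lborel)"
    if "\<Phi> \<in> borel_measurable borel" for \<Phi>
    unfolding pol_def by (rule nn_integral_polar[OF m_pos m_less that, symmetric])
  have polp: "pol (\<lambda>z. ennreal ((z * v z) powr p)) = (\<integral>\<^sup>+x. ennreal (norm x powr (- (?n - p * m))) * ennreal (U x powr p) \<partial>lborel)"
    if "0 < p" for p
  proof (subst pol)
    show "(\<integral>\<^sup>+x. ennreal (norm x powr (- ?n)) * ennreal ((norm (x::'a) powr m * v (norm x powr m)) powr p) \<partial>lborel)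
       = (\<integral>\<^sup>+x. ennreal (norm x powr (- (?n - p * m))) * ennreal (U x powr p) \<partial>lborel)"
      using norm_powr_rearrangement[OF that] by (intro nn_integral_cong) (simp add: ennreal_mult'[symmetric])
  qed measurable
  \<comment> \<open>Finiteness is what allows this common term to be cancelled from an inequality
    between extended nonnegative numbers.\<close>
  have fin: "pol (\<lambda>z. ennreal (\<Phi>1 z)) < \<infinity>"
  proof -
    have "pol (\<lambda>z. ennreal (\<Phi>1 z)) \<le> (\<integral>\<^sup>+z. ennreal (\<sigma> / m * (2 * m)\<^sup>2) * (ennreal ((z * v z) powr 2 / z) * indicator {0<..} z) \<partial>lborel)"
      unfolding pol_def
    proof (rule nn_integral_mono)
      fix z :: real
      show "ennreal (?n * unit_ball_vol ?n / m / z) * ennreal (\<Phi>1 z) * indicator {0<..} z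
          \<le> ennreal (\<sigma> / m * (2 * m)\<^sup>2) * (ennreal ((z * v z) powr 2 / z) * indicator {0<..} z)"
      proof (cases "0 < z")
        case True
        have "(m + e z * S (z * v z))\<^sup>2 \<le> (2 * m)\<^sup>2" using eS[OF vb'[OF True]] by (intro power_mono) auto
        hence "\<Phi>1 z \<le> (z * v z)\<^sup>2 * (2 * m)\<^sup>2" unfolding \<Phi>1_def by (intro mult_left_mono) auto
        hence "\<sigma> / m / z * \<Phi>1 z \<le> \<sigma> / m / z * ((z * v z)\<^sup>2 * (2 * m)\<^sup>2)" using \<sigma> m_pos True by (intro mult_left_mono) auto
        also have "\<dots> = \<sigma> / m * (2 * m)\<^sup>2 * ((z * v z) powr 2 / z)" using vb'(1)[OF True] by (simp add: powr_numeral)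
        finally have "ennreal (\<sigma> / m / z * \<Phi>1 z) \<le> ennreal (\<sigma> / m * (2 * m)\<^sup>2 * ((z * v z) powr 2 / z))" by (rule ennreal_leI)
        moreover have "ennreal (\<sigma> / m / z * \<Phi>1 z) = ennreal (\<sigma> / m / z) * ennreal (\<Phi>1 z)"
          by (rule ennreal_mult'') (simp add: \<Phi>1_def)
        moreover have "ennreal (\<sigma> / m * (2 * m)\<^sup>2 * ((z * v z) powr 2 / z)) = ennreal (\<sigma> / m * (2 * m)\<^sup>2) * ennreal ((z * v z) powr 2 / z)"
          using True by (intro ennreal_mult'') simp
        ultimately show ?thesis using True by (simp add: \<sigma>_def w_def)
      qed simp
    qed
    also have "\<dots> = ennreal (\<sigma> / m * (2 * m)\<^sup>2) * (\<integral>\<^sup>+z. ennreal ((z * v z) powr 2 / z) * indicator {0<..} z \<partial>lborel)"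
      by (intro nn_integral_cmult) measurable
    also have "\<dots> < \<infinity>" using nn_integral_v_powr_finite[of 2] by (simp add: ennreal_mult_less_top)
    finally show ?thesis .
  qed
  \<comment> \<open>Only an upper bound: on a plateau of \<open>U\<close> the weight \<psi>
    vanishes, while \<open>\<Phi>1\<close> need not.\<close>
  have T2_le: "T2 \<le> pol (\<lambda>z. ennreal (\<Phi>1 z))"
  proof -
    have "T2 = (\<integral>\<^sup>+x. ennreal ((\<psi> (u x))\<^sup>2) * indicator {x. 0 < u x} x \<partial>lborel)"
      unfolding T2_def by (intro nn_integral_cong) (auto simp: indicator_def \<psi>_def)
    also have "\<dots> = (\<integral>\<^sup>+x. ennreal ((\<psi> (U x))\<^sup>2) * indicator {x. 0 < U x} x \<partial>lborel)"
      by (rule nn_integral_equimeasurable) measurable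
    also have "\<dots> \<le> (\<integral>\<^sup>+x. ennreal (norm x powr (- ?n)) * ennreal (\<Phi>1 (norm (x::'a) powr m)) \<partial>lborel)"
    proof (rule nn_integral_mono_AE)
      have "AE x in lborel. x \<noteq> (0::'a)" by (rule AE_lborel_singleton)
      thus "AE x in lborel. ennreal ((\<psi> (U x))\<^sup>2) * indicator {x. 0 < U x} x \<le> ennreal (norm x powr (- ?n)) * ennreal (\<Phi>1 (norm x powr m))"
      proof eventually_elim
        case (elim x)
        show ?case
        proof (cases "0 < U x \<and> U x \<notin> Nd")
          case True
          define z where "z = norm x powr m"
          have z: "0 < z" using elim by (simp add: z_def)
          have Ux: "U x = v z" by (simp add: U_def z_def)
          have Rz: "R (v z) = z" using True z unfolding Ux Nd_def by (intro R_v_eq) auto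
          have "rad (v z) = (rad (v z) powr m) powr (1 / m)" using m_pos rad_nonneg by (simp add: powr_powr)
          also have "\<dots> = (norm x powr m) powr (1 / m)" using Rz by (simp add: R_def z_def)
          also have "\<dots> = norm x" using m_pos by (simp add: powr_powr)
          finally have rz: "rad (v z) = norm x" .
          have "norm x powr (- ?n) * z\<^sup>2 = norm x powr (- 2)"
          proof -
            have "z\<^sup>2 = norm x powr (2 * m)" by (simp only: z_def power2_eq_square powr_add mult_2)
            hence "norm x powr (- ?n) * z\<^sup>2 = norm x powr (- ?n + 2 * m)" by (simp only: powr_add)
            also have "- ?n + 2 * m = - 2" by (simp add: m_def field_simps)
            finally show ?thesis .
          qed
          hence nz: "norm x powr (- ?n) * z\<^sup>2 = 1 / (norm x)\<^sup>2" using elim by (simp add: powr_minus powr_numeral inverse_eq_divide)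
          have "(\<psi> (U x))\<^sup>2 = (v z / norm x * (m + e z * S (z * v z)))\<^sup>2"
            using True unfolding Ux by (simp add: \<psi>_def Rz rz)
          also have "\<dots> = (1 / (norm x)\<^sup>2) * ((v z)\<^sup>2 * (m + e z * S (z * v z))\<^sup>2)"
            by (simp add: power_mult_distrib power_divide)
          also have "\<dots> = norm x powr (- ?n) * \<Phi>1 z" unfolding nz[symmetric] \<Phi>1_def by (simp add: power_mult_distrib)
          finally have "ennreal ((\<psi> (U x))\<^sup>2) = ennreal (norm x powr (- ?n)) * ennreal (\<Phi>1 z)"
            by (simp add: ennreal_mult')
          thus ?thesis using True by (simp add: z_def)
        next
          case False
          thus ?thesis by (auto simp: \<psi>_def indicator_def)
        qed
      qed
    qed
    also have "\<dots> = pol (\<lambda>z. ennreal (\<Phi>1 z))" by (rule pol[symmetric]) measurable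
    finally show ?thesis .
  qed
  define A1 where "A1 = pol (\<lambda>z. ennreal (\<Phi>1 z))"
  define rest where "rest = ennreal (m\<^sup>2 - lam\<^sup>2) * pol (\<lambda>z. ennreal ((z * v z) powr 2))
      + ennreal (lam\<^sup>2 * M powr (2 - q)) * pol (\<lambda>z. ennreal ((z * v z) powr q)) + ennreal (4 * \<sigma> * Bd)"
  have "A1 + rest = ennreal 2 * T1" unfolding T1_eq split A1_def rest_def by (simp add: add.assoc)
  also have "\<dots> \<le> G2 + A1" using main T2_le unfolding A1_def by (meson add_left_mono order_trans)
  finally have "A1 + rest \<le> A1 + G2" by (simp add: add.commute)
  hence "rest \<le> G2" using fin unfolding A1_def by (auto simp: ennreal_add_left_cancel_le)
  moreover have "ennreal (m\<^sup>2 - lam\<^sup>2) * (\<integral>\<^sup>+x. ennreal (norm x powr (- 2)) * ennreal (u x powr 2) \<partial>lborel)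
       + ennreal (lam\<^sup>2 * M powr (2 - q)) * (\<integral>\<^sup>+x. ennreal (norm x powr (- (?n - q * m))) * ennreal (u x powr q) \<partial>lborel)
       + ennreal (4 * (?n * w) * Bd) \<le> rest"
  proof -
    have "(\<integral>\<^sup>+x. ennreal (norm x powr (- 2)) * ennreal (u x powr 2) \<partial>lborel) \<le> pol (\<lambda>z. ennreal ((z * v z) powr 2))"
    proof -
      have "?n - 2 * m = 2" by (simp add: m_def field_simps)
      thus ?thesis using polp[of 2] nn_integral_weight_le_rearrangement[of 2 2] by simp
    qed
    moreover have "(\<integral>\<^sup>+x. ennreal (norm x powr (- (?n - q * m))) * ennreal (u x powr q) \<partial>lborel) \<le> pol (\<lambda>z. ennreal ((z * v z) powr q))"
      using polp[of q] nn_integral_weight_le_rearrangement[of "?n - q * m" q] q by simp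
    ultimately show ?thesis unfolding rest_def \<sigma>_def by (intro add_mono mult_left_mono) auto
  qed
  ultimately show ?thesis unfolding G2_def by (rule order_trans[rotated])
qed

end

section \<open>The sharp constant\<close>

text \<open>This is y S(y) for lam = M = 1. Rescaling by M turns the boundary term into lam M^2
  times its integral.\<close>

definition profile_fn :: "real \<Rightarrow> real \<Rightarrow> real" where
  "profile_fn q y = y * sqrt (1 - y powr (q - 2))"

lemma profile_fn_measurable [measurable]: "profile_fn q \<in> borel_measurable borel"
  unfolding profile_fn_def[abs_def] by measurable

definition profile_integral :: "real \<Rightarrow> real \<Rightarrow> real" where
  "profile_integral q \<theta> = (\<integral>y. indicator {0<..<\<theta>} y * profile_fn q y \<partial>lborel)"

lemma Gamma_legendre_duplication_real:
  fixes z :: real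
  assumes "0 < z"
  shows "Gamma z * Gamma (z + 1/2) = 2 powr (1 - 2 * z) * sqrt pi * Gamma (2 * z)"
proof -
  have n: "complex_of_real x \<notin> \<int>\<^sub>\<le>\<^sub>0" if "0 < x" for x
  proof
    assume "complex_of_real x \<in> \<int>\<^sub>\<le>\<^sub>0"
    then obtain k :: int where "complex_of_real x = of_int k" "k \<le> 0" by (elim nonpos_Ints_cases)
    hence "x = of_int k" by (metis Re_complex_of_real of_real_of_int_eq)
    thus False using that \<open>k \<le> 0\<close> by simp
  qed
  have h: "complex_of_real z + 1/2 = complex_of_real (z + 1/2)" "2 * complex_of_real z = complex_of_real (2 * z)"
    "(1 - 2 * complex_of_real z) * of_real (ln 2) = complex_of_real ((1 - 2 * z) * ln 2)"
    by simp_all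
  have "Gamma (complex_of_real z) * Gamma (complex_of_real z + 1/2)
      = exp ((1 - 2 * complex_of_real z) * of_real (ln 2)) * of_real (sqrt pi) * Gamma (2 * complex_of_real z)"
    using n[of z] n[of "z + 1/2"] assms by (intro Gamma_legendre_duplication) (simp_all only: h, simp_all)
  hence "complex_of_real (Gamma z) * complex_of_real (Gamma (z + 1/2))
      = complex_of_real (exp ((1 - 2 * z) * ln 2)) * of_real (sqrt pi) * complex_of_real (Gamma (2 * z))"
    unfolding h(3) unfolding h(1,2) Gamma_complex_of_real exp_of_real .
  hence "complex_of_real (Gamma z * Gamma (z + 1/2)) = complex_of_real (exp ((1 - 2 * z) * ln 2) * sqrt pi * Gamma (2 * z))"
    by (simp only: of_real_mult)
  hence "Gamma z * Gamma (z + 1/2) = exp ((1 - 2 * z) * ln 2) * sqrt pi * Gamma (2 * z)"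
    by (simp only: of_real_eq_iff)
  thus ?thesis by (simp add: powr_def)
qed

section \<open>The Beta integral and Young's inequality\<close>

context
  fixes q :: real
  assumes q: "2 < q"
begin

lemma continuous_on_profile_integrand: "continuous_on {0..1} (profile_fn q)"
  unfolding profile_fn_def[abs_def] using q by (intro continuous_on_mult continuous_on_id continuous_on_real_sqrt continuous_on_diff continuous_on_const
      continuous_on_powr') auto

lemma profile_integrand_bounds:
  assumes "0 \<le> y" "y \<le> 1"
  shows "0 \<le> profile_fn q y" "profile_fn q y \<le> 1"
proof -
  have le: "y powr (q - 2) \<le> 1" using assms q powr_mono2[of "q - 2" y 1] by simp
  thus "0 \<le> profile_fn q y" using assms by (simp add: profile_fn_def)
  have "y * sqrt (1 - y powr (q - 2)) \<le> 1 * 1" using assms le by (intro mult_mono) auto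
  thus "profile_fn q y \<le> 1" by (simp add: profile_fn_def)
qed

lemma integrable_profile_integrand:
  assumes "\<theta> \<le> 1"
  shows "integrable lborel (\<lambda>y. indicator {0<..<\<theta>} y * profile_fn q y)"
proof -
  have "integrable lborel (\<lambda>y. indicator {0<..<\<theta>} y *\<^sub>R profile_fn q y)"
  proof (rule integrableI_bounded_set_indicator[where B = 1])
    show "emeasure lborel {0<..<\<theta>} < \<infinity>" by (cases "0 \<le> \<theta>") auto
    show "AE y in lborel. y \<in> {0<..<\<theta>} \<longrightarrow> norm (profile_fn q y) \<le> 1"
    proof (intro AE_I2 impI)
      fix y assume "y \<in> {0<..<\<theta>}"
      thus "norm (profile_fn q y) \<le> 1" using profile_integrand_bounds[of y] assms by auto
    qed
  qed auto
  thus ?thesis by simp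
qed

lemma profile_integral_mono:
  assumes "\<theta> \<le> \<theta>'" "\<theta>' \<le> 1"
  shows "profile_integral q \<theta> \<le> profile_integral q \<theta>'"
  unfolding profile_integral_def
proof (rule integral_mono)
  fix y :: real
  show "indicator {0<..<\<theta>} y * profile_fn q y \<le> indicator {0<..<\<theta>'} y * profile_fn q y"
    using profile_integrand_bounds[of y] assms by (auto simp: indicator_def)
qed (use assms integrable_profile_integrand in auto)

lemma profile_integral_nonneg: "\<theta> \<le> 1 \<Longrightarrow> 0 \<le> profile_integral q \<theta>"
  unfolding profile_integral_def using profile_integrand_bounds
  by (intro integral_nonneg_AE AE_I2) (auto simp: indicator_def)

text \<open>The integrand lies between 0 and 1, so shortening the interval from 1 to \<theta> costs
  at most 1 - \<theta>.\<close>

lemma profile_integral_tendsto: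
  assumes "\<theta> \<longlonglongrightarrow> 1" "\<And>k. \<theta> k \<le> 1" "\<And>k. 0 \<le> \<theta> k"
  shows "(\<lambda>k. profile_integral q (\<theta> k)) \<longlonglongrightarrow> profile_integral q 1"
proof (rule tendsto_sandwich)
  have le: "profile_integral q 1 - (1 - \<theta> k) \<le> profile_integral q (\<theta> k)" for k
  proof -
    have "profile_integral q 1 - profile_integral q (\<theta> k)
        = (\<integral>y. indicator {0<..<1} y * profile_fn q y - indicator {0<..<\<theta> k} y * profile_fn q y \<partial>lborel)"
      unfolding profile_integral_def using assms integrable_profile_integrand by simp
    also have "\<dots> \<le> (\<integral>y. indicator {\<theta> k..1} y \<partial>lborel)"
    proof (rule integral_mono)
      fix y :: real
      show "indicator {0<..<1} y * profile_fn q y - indicator {0<..<\<theta> k} y * profile_fn q y \<le> indicator {\<theta> k..1} y"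
        using profile_integrand_bounds[of y] assms(2)[of k] by (auto simp: indicator_def)
    qed (use assms integrable_profile_integrand in auto)
    also have "\<dots> = 1 - \<theta> k" using assms(2)[of k] by simp
    finally show ?thesis by simp
  qed
  thus "\<forall>\<^sub>F k in sequentially. profile_integral q 1 - (1 - \<theta> k) \<le> profile_integral q (\<theta> k)" by simp
  show "\<forall>\<^sub>F k in sequentially. profile_integral q (\<theta> k) \<le> profile_integral q 1"
    using assms by (intro always_eventually allI profile_integral_mono) auto
  have "(\<lambda>k. profile_integral q 1 - (1 - \<theta> k)) \<longlonglongrightarrow> profile_integral q 1 - (1 - 1)"
    using assms(1) by (intro tendsto_intros)
  thus "(\<lambda>k. profile_integral q 1 - (1 - \<theta> k)) \<longlonglongrightarrow> profile_integral q 1" by simp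
qed auto

text \<open>The substitution x = y^(q-2) produces Beta(\<alpha> - 1, 3/2), since 2/(q-2) = \<alpha>
  - 1. The resulting Gamma(\<alpha> + 1/2) is traded for Gamma(2 \<alpha>) by the duplication
  formula, which is where the power of 2 comes from.\<close>

lemma profile_integral_one:
  defines "\<alpha> \<equiv> q / (q - 2)"
  shows "4 * \<alpha> * profile_integral q 1 = 2 powr (2 * \<alpha> - 1) * (Gamma \<alpha> * Gamma (\<alpha> + 1) / Gamma (2 * \<alpha>))"
proof -
  let ?f = "profile_fn q" and ?g = "\<lambda>x. x powr (1 / (q - 2))"
  have \<alpha>: "1 < \<alpha>" "2 / (q - 2) = \<alpha> - 1" using q by (auto simp: \<alpha>_def field_simps)
  have "((\<lambda>x. (1 / (q - 2) * x powr (1 / (q - 2) - 1)) *\<^sub>R ?f (?g x)) has_integral integral {?g 0..?g 1} ?f) {0..1}"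
  proof (rule has_integral_substitution_strong[where s = "{0}" and c = 0 and d = 1])
    show "?g ` {0..1} \<subseteq> {0..1}"
    proof
      fix y assume "y \<in> ?g ` {0..1}"
      then obtain x where x: "0 \<le> x" "x \<le> 1" "y = ?g x" by auto
      have "?g x \<le> 1 powr (1 / (q - 2))" using x q by (intro powr_mono2) auto
      thus "y \<in> {0..1}" using x by simp
    qed
    show "continuous_on {0..1} ?g" using q by (intro continuous_on_powr') (auto intro!: continuous_intros)
    fix x :: real assume "x \<in> {0..1} - {0}"
    hence "0 < x" by simp
    thus "(?g has_real_derivative 1 / (q - 2) * x powr (1 / (q - 2) - 1)) (at x within {0..1})"
      by (intro has_field_derivative_at_within[OF has_real_derivative_powr])
  qed (use continuous_on_profile_integrand in auto)
  hence "((\<lambda>x. (1 / (q - 2) * x powr (1 / (q - 2) - 1)) * ?f (?g x)) has_integral integral {0..1} ?f) {0..1}"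
    by simp
  moreover have "(1 / (q - 2) * x powr (1 / (q - 2) - 1)) * ?f (?g x)
      = 1 / (q - 2) * (x powr (\<alpha> - 1 - 1) * (1 - x) powr (3 / 2 - 1))" if "x \<in> {0..1}" for x
  proof (cases "x = 0")
    case False
    hence x: "0 < x" "x \<le> 1" using that by auto
    have 1: "(?g x) powr (q - 2) = x" using x q by (simp add: powr_powr)
    have 2: "x powr (1 / (q - 2) - 1) * ?g x = x powr (\<alpha> - 1 - 1)"
    proof -
      have "x powr (1 / (q - 2) - 1) * ?g x = x powr ((1 / (q - 2) - 1) + 1 / (q - 2))" by (simp only: powr_add)
      also have "(1 / (q - 2) - 1) + 1 / (q - 2) = \<alpha> - 1 - 1" using \<alpha>(2) by (simp add: field_simps)
      finally show ?thesis .
    qed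
    have 3: "sqrt (1 - x) = (1 - x) powr (3 / 2 - 1)" using x by (simp add: powr_half_sqrt)
    show ?thesis unfolding profile_fn_def 1 3 2[symmetric] by (simp only: mult.assoc)
  qed (use q in \<open>simp add: profile_fn_def\<close>)
  ultimately have i1: "((\<lambda>x. 1 / (q - 2) * (x powr (\<alpha> - 1 - 1) * (1 - x) powr (3 / 2 - 1))) has_integral integral {0..1} ?f) {0..1}"
    by (rule has_integral_eq[rotated])
  have i2: "((\<lambda>x. 1 / (q - 2) * (x powr (\<alpha> - 1 - 1) * (1 - x) powr (3 / 2 - 1))) has_integral 1 / (q - 2) * Beta (\<alpha> - 1) (3 / 2)) {0..1}"
    using \<alpha> by (intro has_integral_mult_right has_integral_Beta_real) auto
  have "integral {0..1} ?f = 1 / (q - 2) * Beta (\<alpha> - 1) (3 / 2)" using i1 i2 by (rule has_integral_unique)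
  also have "1 / (q - 2) = (\<alpha> - 1) / 2" using \<alpha>(2) by simp
  also have "(\<alpha> - 1) / 2 * Beta (\<alpha> - 1) (3 / 2) = Gamma \<alpha> * sqrt pi / (4 * Gamma (\<alpha> + 1/2))"
  proof -
    have "Gamma (1/2 + 1 :: real) = 1/2 * Gamma (1/2)" by (intro Gamma_plus1) auto
    hence G: "Gamma (3/2 :: real) = sqrt pi / 2" by (simp add: Gamma_one_half_real)
    have "Gamma (\<alpha> - 1 + 1) = (\<alpha> - 1) * Gamma (\<alpha> - 1)" using \<alpha> by (intro Gamma_plus1) (auto elim!: nonpos_Ints_cases)
    hence "(\<alpha> - 1) * Gamma (\<alpha> - 1) = Gamma \<alpha>" by simp
    moreover have e: "\<alpha> - 1 + 3 / 2 = \<alpha> + 1 / 2" by simp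
    moreover have "(\<alpha> - 1) / 2 * (Gamma (\<alpha> - 1) * (sqrt pi / 2) / D) = ((\<alpha> - 1) * Gamma (\<alpha> - 1)) * sqrt pi / (4 * D)" for D
      by simp
    ultimately show ?thesis unfolding Beta_def G e by simp
  qed
  finally have I: "integral {0..1} ?f = Gamma \<alpha> * sqrt pi / (4 * Gamma (\<alpha> + 1/2))" .
  have "profile_integral q 1 = (\<integral>y. indicator {0..1} y *\<^sub>R ?f y \<partial>lborel)"
    unfolding profile_integral_def
  proof (rule integral_cong_AE)
    show "AE y in lborel. indicator {0<..<1} y * ?f y = indicator {0..1} y *\<^sub>R ?f y"
      using AE_lborel_singleton[of 0] AE_lborel_singleton[of 1] by eventually_elim (auto simp: indicator_def)
  qed measurable
  also have "\<dots> = integral {0..1} ?f"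
    unfolding set_lebesgue_integral_def[symmetric]
    by (intro set_borel_integral_eq_integral borel_integrable_atLeastAtMost' continuous_on_profile_integrand)
  finally have P: "profile_integral q 1 = Gamma \<alpha> * sqrt pi / (4 * Gamma (\<alpha> + 1/2))" using I by simp
  have pos: "0 < Gamma \<alpha>" "0 < Gamma (\<alpha> + 1/2)" "0 < Gamma (2 * \<alpha>)" using \<alpha> by auto
  have dup: "Gamma \<alpha> * Gamma (\<alpha> + 1/2) * 2 powr (2 * \<alpha> - 1) = sqrt pi * Gamma (2 * \<alpha>)"
  proof -
    have "(2::real) powr (1 - 2 * \<alpha>) * 2 powr (2 * \<alpha> - 1) = 1" by (simp add: powr_add[symmetric])
    thus ?thesis using Gamma_legendre_duplication_real[of \<alpha>] \<alpha> by simp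
  qed
  have "Gamma (\<alpha> + 1) = \<alpha> * Gamma \<alpha>" using \<alpha> by (intro Gamma_plus1) (auto elim!: nonpos_Ints_cases)
  hence "2 powr (2 * \<alpha> - 1) * (Gamma \<alpha> * Gamma (\<alpha> + 1) / Gamma (2 * \<alpha>))
      = \<alpha> * Gamma \<alpha> * (Gamma \<alpha> * Gamma (\<alpha> + 1/2) * 2 powr (2 * \<alpha> - 1)) / (Gamma (\<alpha> + 1/2) * Gamma (2 * \<alpha>))"
    using pos by simp
  also have "\<dots> = \<alpha> * Gamma \<alpha> * sqrt pi / Gamma (\<alpha> + 1/2)" unfolding dup using pos by simp
  also have "\<dots> = 4 * \<alpha> * profile_integral q 1" unfolding P by simp
  finally show ?thesis by simp
qed

text \<open>Young's inequality with weights 2/q and (q-2)/q. These are the weights for which the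
  powers of M on the left cancel: (2 - q) (2/q) + 2 (q - 2)/q = 0.\<close>

lemma Young_scaled:
  assumes "0 \<le> A" "0 \<le> D" "0 < M"
  shows "(q / 2 * A) powr (2 / q) * (q / (q - 2) * D) powr ((q - 2) / q) \<le> A * M powr (2 - q) + D * M\<^sup>2"
proof (cases "A = 0 \<or> D = 0")
  case True
  thus ?thesis using assms q by auto
next
  case False
  hence AD: "0 < A" "0 < D" using assms by auto
  define x y where "x = q / 2 * (A * M powr (2 - q))" and "y = q / (q - 2) * (D * M\<^sup>2)"
  have xy: "0 < x" "0 < y" using AD q assms by (auto simp: x_def y_def)
  have "x powr (2 / q) * y powr ((q - 2) / q) \<le> 2 / q * x + (q - 2) / q * y"
    using xy q by (intro Youngs_inequality_0) (auto simp: field_simps)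
  also have "\<dots> = A * M powr (2 - q) + D * M\<^sup>2" using q by (simp add: x_def y_def)
  finally have "x powr (2 / q) * y powr ((q - 2) / q) \<le> A * M powr (2 - q) + D * M\<^sup>2" .
  moreover have "x powr (2 / q) * y powr ((q - 2) / q) = (q / 2 * A) powr (2 / q) * (q / (q - 2) * D) powr ((q - 2) / q)"
  proof -
    have "x powr (2 / q) = (q / 2 * A) powr (2 / q) * M powr ((2 - q) * (2 / q))"
    proof -
      have "x powr (2 / q) = ((q / 2 * A) * M powr (2 - q)) powr (2 / q)" by (simp only: x_def mult.assoc)
      also have "\<dots> = (q / 2 * A) powr (2 / q) * (M powr (2 - q)) powr (2 / q)" by (rule powr_mult)
      finally show ?thesis by (simp only: powr_powr)
    qed
    moreover have "y powr ((q - 2) / q) = (q / (q - 2) * D) powr ((q - 2) / q) * M powr (2 * ((q - 2) / q))"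
    proof -
      have "M\<^sup>2 = M powr 2" using assms by (simp add: powr_numeral)
      hence "y powr ((q - 2) / q) = ((q / (q - 2) * D) * M powr 2) powr ((q - 2) / q)" by (simp only: y_def mult.assoc)
      also have "\<dots> = (q / (q - 2) * D) powr ((q - 2) / q) * (M powr 2) powr ((q - 2) / q)" by (rule powr_mult)
      finally show ?thesis by (simp only: powr_powr)
    qed
    moreover have "M powr ((2 - q) * (2 / q)) * M powr (2 * ((q - 2) / q)) = 1"
    proof -
      have "(2 - q) * (2 / q) + 2 * ((q - 2) / q) = 0" using q by (simp add: field_simps)
      thus ?thesis using assms by (simp add: powr_add[symmetric])
    qed
    ultimately show ?thesis by simp
  qed
  ultimately show ?thesis by simp
qed

end

section \<open>Elimination of the scale and limit to the sharp constant\<close>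

context decaying_function_slope
begin

text \<open>Each \<eta> < 1 gives a bound with the incomplete integral
  \<open>profile_integral q (\<eta>\<^sup>2)\<close>. Young's inequality removes M, which is tied to
  the supremum of G, so that \<eta> survives only in a constant, and this constant converges as
  \<eta> tends to 1.\<close>

theorem sharp_energy_bound:
  fixes lam q :: real
  assumes lam: "0 < lam" "lam \<le> m" and q: "2 < q" "q * m \<le> real DIM('a)"
    and fin: "(\<integral>\<^sup>+x. ennreal ((g x)\<^sup>2) \<partial>lborel) < \<infinity>"
  defines "\<alpha> \<equiv> q / (q - 2)"
  defines "X \<equiv> enn2real (\<integral>\<^sup>+x. ennreal (norm x powr (- (real DIM('a) - q * m))) * ennreal (u x powr q) \<partial>lborel)"
  shows "(m\<^sup>2 - lam\<^sup>2) * enn2real (\<integral>\<^sup>+x. ennreal (norm x powr (- 2)) * ennreal (u x powr 2) \<partial>lborel)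
       + (2 * lam) powr (2 / q + 1) * ((real DIM('a) * w) powr (1 / \<alpha>) * (q / 2) powr (2 / q)
           * (Gamma \<alpha> * Gamma (\<alpha> + 1) / Gamma (2 * \<alpha>)) powr (1 / \<alpha>)) * X powr (2 / q)
       \<le> enn2real (\<integral>\<^sup>+x. ennreal ((g x)\<^sup>2) \<partial>lborel)"
proof -
  let ?n = "real DIM('a)"
  define I3 where "I3 = (\<integral>\<^sup>+x. ennreal (norm x powr (- 2)) * ennreal (u x powr 2) \<partial>lborel)"
  define IX where "IX = (\<integral>\<^sup>+x. ennreal (norm x powr (- (?n - q * m))) * ennreal (u x powr q) \<partial>lborel)"
  define IG where "IG = (\<integral>\<^sup>+x. ennreal ((g x)\<^sup>2) \<partial>lborel)"
  define \<sigma> where "\<sigma> = ?n * w"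
  have \<sigma>: "0 < \<sigma>" using w_pos by (simp add: \<sigma>_def)
  have \<alpha>: "1 < \<alpha>" using q by (simp add: \<alpha>_def field_simps)
  have ml: "0 \<le> m\<^sup>2 - lam\<^sup>2" using lam by (simp add: power_mono)
  have X: "X = enn2real IX" by (simp add: X_def IX_def)
  show ?thesis
  proof (cases "\<forall>x. u x = 0")
    case True
    hence "I3 = 0" "IX = 0" using q by (auto simp: I3_def IX_def)
    thus ?thesis using q by (simp add: X I3_def[symmetric] IG_def[symmetric])
  next
    case False
    then obtain x0 where "u x0 \<noteq> 0" by blast
    hence x0: "0 < u x0" using nonneg_u[of x0] by simp
    define G where "G = (SUP z\<in>{0<..}. z * v z)"
    obtain K where K: "0 < K" and K_le: "\<And>z. 0 < z \<Longrightarrow> z * v z \<le> K * z" "\<And>z. 0 < z \<Longrightarrow> z * v z \<le> K / z"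
      using v_decay by blast
    have bdd: "bdd_above ((\<lambda>z. z * v z) ` {0<..})"
    proof (rule bdd_aboveI2)
      fix z :: real assume z: "z \<in> {0<..}"
      show "z * v z \<le> K"
      proof (cases "z \<le> 1")
        case True
        have "K * z \<le> K * 1" using True K by (intro mult_left_mono) auto
        moreover have "z * v z \<le> K * z" using z by (intro K_le(1)) simp
        ultimately show ?thesis by linarith
      next
        case False
        have "K / z \<le> K / 1" using False K by (intro divide_left_mono) auto
        moreover have "z * v z \<le> K / z" using z by (intro K_le(2)) simp
        ultimately show ?thesis by linarith
      qed
    qed
    have leG: "z * v z \<le> G" if "0 < z" for z unfolding G_def using bdd that by (intro cSUP_upper) auto
    have G: "0 < G"
    proof -
      define t where "t = u x0 / 2"
      have t: "0 < t" "t < u x0" using x0 by (auto simp: t_def)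
      have "0 < \<mu> t"
        unfolding \<mu>_def using t(2) emeasure_superlevel[OF t(1)] open_superlevel[of t]
        by (intro measure_open_pos) auto
      hence "0 < rad t" using \<mu>_eq_rad[of t] rad_nonneg[of t] by (cases "rad t = 0") (auto simp: power_0_left)
      hence R: "0 < R t" by (simp add: R_def)
      hence "t < v (R t / 2)" using less_v_iff[of t "R t / 2"] t by simp
      hence "0 < (R t / 2) * v (R t / 2)" using R t by simp
      also have "\<dots> \<le> G" using R by (intro leG) auto
      finally show ?thesis .
    qed
    define rhs where "rhs B = (m\<^sup>2 - lam\<^sup>2) * enn2real I3 + (q / 2 * (lam\<^sup>2 * X)) powr (2 / q) * (q / (q - 2) * (4 * \<sigma> * lam * B)) powr ((q - 2) / q)" for B
    have bound: "rhs (profile_integral q (\<eta>\<^sup>2)) \<le> enn2real IG" if \<eta>: "0 < \<eta>" "\<eta> < 1" for \<eta>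
    proof -
      \<comment> \<open>M is slightly larger than the supremum of G, so that G stays within \<eta>
        M. The near-maximum point loses a second factor: z0 v(z0) > \<eta> G = \<eta>^2 M, hence
        \<eta>^2 in the incomplete integral.\<close>
      define M where "M = G / \<eta>"
      have M: "0 < M" "\<eta> * M = G" using G \<eta> by (auto simp: M_def)
      have "\<eta> * G < G" using G \<eta> by simp
      then obtain z0 where z0: "0 < z0" "\<eta> * G < z0 * v z0"
        using less_cSUP_iff[OF _ bdd, of "\<eta> * G"] unfolding G_def by auto
      define Bd where "Bd = (\<integral>t. indicator {0<..<v z0} t * (z0\<^sup>2 * t * profile lam M q (z0 * t)) \<partial>lborel)"
      define \<theta> where "\<theta> = z0 * v z0 / M"
      have \<theta>: "\<eta>\<^sup>2 \<le> \<theta>" "\<theta> \<le> 1"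
      proof -
        have "\<eta>\<^sup>2 * M = \<eta> * G" using M by (simp add: power2_eq_square)
        also have "\<dots> \<le> z0 * v z0" using z0 by simp
        finally show "\<eta>\<^sup>2 \<le> \<theta>" using M by (simp add: \<theta>_def field_simps)
        have "z0 * v z0 \<le> \<eta> * M" using leG[OF z0(1)] M by simp
        also have "\<dots> \<le> 1 * M" using \<eta> M by (intro mult_right_mono) auto
        finally show "\<theta> \<le> 1" using M by (simp add: \<theta>_def field_simps)
      qed
      have Bd: "Bd = lam * M\<^sup>2 * profile_integral q \<theta>"
      proof -
        \<comment> \<open>Substitution t = (M / z0) y, which normalises lam and M to 1.\<close>
        have "Bd = \<bar>M / z0\<bar> *\<^sub>R (\<integral>y. indicator {0<..<v z0} (0 + M / z0 * y) * (z0\<^sup>2 * (0 + M / z0 * y) * profile lam M q (z0 * (0 + M / z0 * y))) \<partial>lborel)"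
          unfolding Bd_def using M z0 by (intro lborel_integral_real_affine) auto
        also have "\<dots> = (M / z0) * (\<integral>y. (lam * M * z0) * (indicator {0<..<\<theta>} y * profile_fn q y) \<partial>lborel)"
        proof -
          have "indicator {0<..<v z0} (0 + M / z0 * y) * (z0\<^sup>2 * (0 + M / z0 * y) * profile lam M q (z0 * (0 + M / z0 * y)))
              = (lam * M * z0) * (indicator {0<..<\<theta>} y * profile_fn q y)" for y
          proof -
            have "indicator {0<..<v z0} (0 + M / z0 * y) = (indicator {0<..<\<theta>} y :: real)"
              using M z0 by (auto simp: indicator_def \<theta>_def field_simps zero_less_mult_iff zero_less_divide_iff)
            thus ?thesis using M z0 by (simp add: profile_def profile_fn_def power2_eq_square)
          qed
          thus ?thesis using M z0 by simp
        qed
        also have "\<dots> = (M / z0) * ((lam * M * z0) * profile_integral q \<theta>)"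
          unfolding profile_integral_def by simp
        finally show ?thesis using z0 by (simp add: power2_eq_square)
      qed
      have PI: "0 \<le> profile_integral q (\<eta>\<^sup>2)" "profile_integral q (\<eta>\<^sup>2) \<le> profile_integral q \<theta>"
        using \<theta> q by (auto intro!: profile_integral_nonneg profile_integral_mono)
      have B0: "0 \<le> Bd" unfolding Bd using PI lam M by simp
      have main: "ennreal (m\<^sup>2 - lam\<^sup>2) * I3 + ennreal (lam\<^sup>2 * M powr (2 - q)) * IX + ennreal (4 * \<sigma> * Bd) \<le> IG"
        unfolding I3_def IX_def IG_def \<sigma>_def Bd_def
        using lam M q \<eta> z0 leG by (intro calibrated_energy_bound) auto
      have "(m\<^sup>2 - lam\<^sup>2) * enn2real I3 + (lam\<^sup>2 * M powr (2 - q)) * enn2real IX + 4 * \<sigma> * Bd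
          = enn2real (ennreal (m\<^sup>2 - lam\<^sup>2) * I3 + ennreal (lam\<^sup>2 * M powr (2 - q)) * IX + ennreal (4 * \<sigma> * Bd))"
      proof -
        have f: "ennreal (m\<^sup>2 - lam\<^sup>2) * I3 + ennreal (lam\<^sup>2 * M powr (2 - q)) * IX + ennreal (4 * \<sigma> * Bd) < \<infinity>"
          using main fin unfolding IG_def by (rule order_le_less_trans)
        hence "ennreal (m\<^sup>2 - lam\<^sup>2) * I3 < \<infinity>" "ennreal (lam\<^sup>2 * M powr (2 - q)) * IX < \<infinity>"
          by auto
        thus ?thesis using ml B0 \<sigma> by (simp add: enn2real_plus enn2real_mult)
      qed
      also have "\<dots> \<le> enn2real IG" using main fin unfolding IG_def by (intro enn2real_mono) auto
      finally have 1: "(m\<^sup>2 - lam\<^sup>2) * enn2real I3 + (lam\<^sup>2 * M powr (2 - q)) * X + 4 * \<sigma> * Bd \<le> enn2real IG"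
        unfolding X .
      have "4 * \<sigma> * (lam * M\<^sup>2 * profile_integral q (\<eta>\<^sup>2)) \<le> 4 * \<sigma> * Bd"
        unfolding Bd using PI \<sigma> lam by (intro mult_left_mono) auto
      hence 2: "(4 * \<sigma> * lam * profile_integral q (\<eta>\<^sup>2)) * M\<^sup>2 \<le> 4 * \<sigma> * Bd" by (simp add: mult_ac)
      have "(q / 2 * (lam\<^sup>2 * X)) powr (2 / q) * (q / (q - 2) * (4 * \<sigma> * lam * profile_integral q (\<eta>\<^sup>2))) powr ((q - 2) / q)
          \<le> (lam\<^sup>2 * X) * M powr (2 - q) + (4 * \<sigma> * lam * profile_integral q (\<eta>\<^sup>2)) * M\<^sup>2"
        using q M lam \<sigma> PI(1) by (intro Young_scaled) (auto simp: X)
      moreover have "(lam\<^sup>2 * X) * M powr (2 - q) = (lam\<^sup>2 * M powr (2 - q)) * X" by simp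
      ultimately show ?thesis using 1 2 unfolding rhs_def by linarith
    qed
    define \<eta> where "\<eta> k = 1 - 1 / real (Suc (Suc k))" for k
    have \<eta>: "0 < \<eta> k" "\<eta> k < 1" for k by (auto simp: \<eta>_def field_simps)
    have "\<eta> \<longlonglongrightarrow> 1 - 0" unfolding \<eta>_def
      using LIMSEQ_Suc[OF LIMSEQ_inverse_real_of_nat] by (intro tendsto_diff tendsto_const) (simp add: inverse_eq_divide)
    hence "(\<lambda>k. (\<eta> k)\<^sup>2) \<longlonglongrightarrow> 1" using tendsto_power[of \<eta> 1 sequentially 2] by simp
    moreover have \<eta>1: "(\<eta> k)\<^sup>2 \<le> 1" for k using \<eta>[of k] by (intro power_le_one) auto
    ultimately have "(\<lambda>k. profile_integral q ((\<eta> k)\<^sup>2)) \<longlonglongrightarrow> profile_integral q 1"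
      using q by (intro profile_integral_tendsto) auto
    hence "(\<lambda>k. q / (q - 2) * (4 * \<sigma> * lam * profile_integral q ((\<eta> k)\<^sup>2))) \<longlonglongrightarrow> q / (q - 2) * (4 * \<sigma> * lam * profile_integral q 1)"
      by (intro tendsto_mult tendsto_const)
    moreover have "0 \<le> q / (q - 2) * (4 * \<sigma> * lam * profile_integral q ((\<eta> k)\<^sup>2))" for k
      using q \<sigma> lam profile_integral_nonneg[OF q(1) \<eta>1] by (intro mult_nonneg_nonneg divide_nonneg_nonneg) auto
    ultimately have "(\<lambda>k. (q / (q - 2) * (4 * \<sigma> * lam * profile_integral q ((\<eta> k)\<^sup>2))) powr ((q - 2) / q))
        \<longlonglongrightarrow> (q / (q - 2) * (4 * \<sigma> * lam * profile_integral q 1)) powr ((q - 2) / q)"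
      using q by (intro tendsto_powr'[OF _ tendsto_const]) auto
    hence "(\<lambda>k. rhs (profile_integral q ((\<eta> k)\<^sup>2))) \<longlonglongrightarrow> rhs (profile_integral q 1)"
      unfolding rhs_def by (intro tendsto_add tendsto_mult tendsto_const)
    hence lim: "rhs (profile_integral q 1) \<le> enn2real IG"
      using bound \<eta> by (intro LIMSEQ_le_const2[of "\<lambda>k. rhs (profile_integral q ((\<eta> k)\<^sup>2))"]) auto
    \<comment> \<open>With (q - 2)/q = 1/\<alpha>, the exponent of lam is 4/q + 1/\<alpha> and that
      of 2 is (2 \<alpha> - 1)/\<alpha>. Both equal 2/q + 1, so the two combine into a power of 2
      lam.\<close>
    have "(q / 2 * (lam\<^sup>2 * X)) powr (2 / q) * (q / (q - 2) * (4 * \<sigma> * lam * profile_integral q 1)) powr ((q - 2) / q)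
        = (2 * lam) powr (2 / q + 1) * (\<sigma> powr (1 / \<alpha>) * (q / 2) powr (2 / q) * (Gamma \<alpha> * Gamma (\<alpha> + 1) / Gamma (2 * \<alpha>)) powr (1 / \<alpha>)) * X powr (2 / q)"
    proof -
      define \<Gamma> where "\<Gamma> = Gamma \<alpha> * Gamma (\<alpha> + 1) / Gamma (2 * \<alpha>)"
      have \<Gamma>: "0 \<le> \<Gamma>" unfolding \<Gamma>_def using \<alpha> by (intro divide_nonneg_nonneg mult_nonneg_nonneg less_imp_le[OF Gamma_real_pos]) auto
      have X0: "0 \<le> X" by (simp add: X)
      have ia: "(q - 2) / q = 1 / \<alpha>" by (simp add: \<alpha>_def)
      have "q / (q - 2) * (4 * \<sigma> * lam * profile_integral q 1) = \<sigma> * lam * (4 * \<alpha> * profile_integral q 1)"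
        by (simp add: \<alpha>_def)
      also have "\<dots> = \<sigma> * lam * (2 powr (2 * \<alpha> - 1) * \<Gamma>)"
        unfolding \<Gamma>_def \<alpha>_def profile_integral_one[OF q(1)] ..
      finally have 1: "(q / (q - 2) * (4 * \<sigma> * lam * profile_integral q 1)) powr ((q - 2) / q)
          = \<sigma> powr (1 / \<alpha>) * lam powr (1 / \<alpha>) * 2 powr ((2 * \<alpha> - 1) * (1 / \<alpha>)) * \<Gamma> powr (1 / \<alpha>)"
        unfolding ia using \<sigma> lam \<Gamma> by (simp add: powr_mult powr_powr)
      have 2: "(q / 2 * (lam\<^sup>2 * X)) powr (2 / q) = (q / 2) powr (2 / q) * lam powr (2 * (2 / q)) * X powr (2 / q)"
      proof -
        have "lam\<^sup>2 = lam powr 2" using lam by (simp add: powr_numeral)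
        hence "(q / 2 * (lam\<^sup>2 * X)) powr (2 / q) = (q / 2) powr (2 / q) * ((lam powr 2) powr (2 / q) * X powr (2 / q))"
          using q lam X0 by (simp only: powr_mult powr_ge_zero mult_nonneg_nonneg)
        thus ?thesis by (simp only: powr_powr mult.assoc)
      qed
      have 3: "lam powr (2 * (2 / q)) * lam powr (1 / \<alpha>) = lam powr (2 / q + 1)"
      proof -
        have "2 * (2 / q) + 1 / \<alpha> = 2 / q + 1" using q by (simp add: \<alpha>_def field_simps)
        thus ?thesis by (simp only: powr_add[symmetric])
      qed
      have 4: "(2 * \<alpha> - 1) * (1 / \<alpha>) = 2 / q + 1" using q by (simp add: \<alpha>_def field_simps)
      have 5: "(2 * lam) powr (2 / q + 1) = 2 powr (2 / q + 1) * lam powr (2 / q + 1)"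
        by (rule powr_mult)
      show ?thesis unfolding 1 2 4 5 3[symmetric] \<Gamma>_def[symmetric] by (simp only: mult_ac)
    qed
    with lim show ?thesis unfolding rhs_def I3_def IG_def \<sigma>_def by simp
  qed
qed

end

section \<open>Schwartz functions\<close>

text \<open>Polar coordinates with exponent 1 reduce the claim to z^(n-1) / (1 + z)^(n+1) \<le> 1 /
  (1 + z)^2, which has an explicit primitive.\<close>

lemma nn_integral_inverse_power_finite:
  assumes "DIM('a::euclidean_space) \<ge> 2"
  shows "(\<integral>\<^sup>+x. ennreal (C / (1 + norm (x::'a)) ^ (DIM('a) + 1)) \<partial>lborel) < \<infinity>"
proof -
  let ?n = "DIM('a)" and ?c = "real DIM('a) * unit_ball_vol (real DIM('a))"
  define \<Phi> :: "real \<Rightarrow> real" where "\<Phi> z = z powr real ?n / (1 + z) ^ (?n + 1)" for z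
  have \<Phi>: "\<Phi> \<in> borel_measurable borel" unfolding \<Phi>_def by measurable
  have "(\<integral>\<^sup>+x. ennreal (1 / (1 + norm (x::'a)) ^ (?n + 1)) \<partial>lborel)
      = (\<integral>\<^sup>+x. ennreal (norm (x::'a) powr (- real ?n)) * ennreal (\<Phi> (norm x powr 1)) \<partial>lborel)"
  proof (rule nn_integral_cong_AE)
    have "AE x in lborel. x \<noteq> (0::'a)" by (rule AE_lborel_singleton)
    thus "AE x in lborel. ennreal (1 / (1 + norm (x::'a)) ^ (?n + 1)) = ennreal (norm x powr (- real ?n)) * ennreal (\<Phi> (norm x powr 1))"
    proof eventually_elim
      case (elim x)
      have "norm x powr (- real ?n) * \<Phi> (norm x powr 1) = 1 / (1 + norm x) ^ (?n + 1)"
        using elim by (simp add: \<Phi>_def powr_minus)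
      thus ?case by (simp add: ennreal_mult'[symmetric])
    qed
  qed
  also have "\<dots> = (\<integral>\<^sup>+z. ennreal (?c / 1 / z) * ennreal (\<Phi> z) * indicator {0<..} z \<partial>lborel)"
    using assms \<Phi> by (intro nn_integral_polar) auto
  also have "\<dots> \<le> (\<integral>\<^sup>+z. ennreal (?c) * (ennreal (1 / (1 + z)\<^sup>2) * indicator {0..} z) \<partial>lborel)"
  proof (rule nn_integral_mono)
    fix z :: real
    show "ennreal (?c / 1 / z) * ennreal (\<Phi> z) * indicator {0<..} z
        \<le> ennreal (?c) * (ennreal (1 / (1 + z)\<^sup>2) * indicator {0..} z)"
    proof (cases "0 < z")
      case True
      have "z powr real ?n = z * z ^ (?n - 1)" using True assms by (simp add: powr_realpow power_eq_if)
      hence "\<Phi> z / z = z ^ (?n - 1) / (1 + z) ^ (?n + 1)" using True by (simp add: \<Phi>_def)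
      also have "\<dots> \<le> (1 + z) ^ (?n - 1) / (1 + z) ^ (?n + 1)"
        using True by (intro divide_right_mono power_mono) auto
      also have "?n + 1 = (?n - 1) + 2" using assms by simp
      also have "(1 + z) ^ (?n - 1) / (1 + z) ^ ((?n - 1) + 2) = 1 / (1 + z)\<^sup>2"
        using True by (subst power_add) simp
      finally have le: "\<Phi> z / z \<le> 1 / (1 + z)\<^sup>2" .
      have "?c / 1 / z * \<Phi> z = ?c * (\<Phi> z / z)" by simp
      also have "\<dots> \<le> ?c * (1 / (1 + z)\<^sup>2)" using le by (intro mult_left_mono) auto
      finally have "ennreal (?c / 1 / z * \<Phi> z) \<le> ennreal (?c * (1 / (1 + z)\<^sup>2))"
        by (rule ennreal_leI)
      moreover have "ennreal (?c / 1 / z * \<Phi> z) = ennreal (?c / 1 / z) * ennreal (\<Phi> z)"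
        using True by (intro ennreal_mult'') (simp add: \<Phi>_def)
      moreover have "ennreal (?c * (1 / (1 + z)\<^sup>2)) = ennreal (?c) * ennreal (1 / (1 + z)\<^sup>2)"
        by (intro ennreal_mult'') simp
      ultimately have "ennreal (?c / 1 / z) * ennreal (\<Phi> z)
          \<le> ennreal (?c) * ennreal (1 / (1 + z)\<^sup>2)" by (simp only:)
      thus ?thesis using True by (simp only: indicator_simps greaterThan_iff atLeast_iff less_imp_le mult_1_right)
    qed simp
  qed
  also have "\<dots> = ennreal (?c) * (\<integral>\<^sup>+z. ennreal (1 / (1 + z)\<^sup>2) * indicator {0..} z \<partial>lborel)"
    by (intro nn_integral_cmult) measurable
  also have "(\<integral>\<^sup>+z. ennreal (1 / (1 + z)\<^sup>2) * indicator {0..} z \<partial>lborel) = ennreal (0 - (- (1 / (1 + 0))))"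
  proof (rule nn_integral_FTC_atLeast)
    show "((\<lambda>z::real. - (1 / (1 + z))) \<longlongrightarrow> 0) at_top"
    proof -
      have "filterlim (\<lambda>z::real. 1 + z) at_top at_top"
        by (rule filterlim_tendsto_add_at_top[OF tendsto_const filterlim_ident])
      from tendsto_minus[OF tendsto_inverse_0_at_top[OF this]] show ?thesis by (simp add: inverse_eq_divide)
    qed
    fix z :: real assume "0 \<le> z"
    thus "((\<lambda>z. - (1 / (1 + z))) has_real_derivative 1 / (1 + z)\<^sup>2) (at z)"
      by (auto intro!: derivative_eq_intros simp: power2_eq_square)
  qed auto
  finally have fin: "(\<integral>\<^sup>+x. ennreal (1 / (1 + norm (x::'a)) ^ (?n + 1)) \<partial>lborel) < \<infinity>"
    by (auto simp: ennreal_mult_less_top order_le_less_trans)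
  have "(\<integral>\<^sup>+x. ennreal (C / (1 + norm (x::'a)) ^ (?n + 1)) \<partial>lborel)
      \<le> (\<integral>\<^sup>+x. ennreal \<bar>C\<bar> * ennreal (1 / (1 + norm (x::'a)) ^ (?n + 1)) \<partial>lborel)"
  proof (rule nn_integral_mono)
    fix x :: 'a
    have "C / (1 + norm x) ^ (?n + 1) \<le> \<bar>C\<bar> / (1 + norm x) ^ (?n + 1)" by (intro divide_right_mono) auto
    hence "ennreal (C / (1 + norm x) ^ (?n + 1)) \<le> ennreal (\<bar>C\<bar> * (1 / (1 + norm x) ^ (?n + 1)))"
      by (intro ennreal_leI) simp
    moreover have "ennreal (\<bar>C\<bar> * (1 / (1 + norm x) ^ (?n + 1))) = ennreal \<bar>C\<bar> * ennreal (1 / (1 + norm x) ^ (?n + 1))"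
      by (rule ennreal_mult') simp
    ultimately show "ennreal (C / (1 + norm x) ^ (?n + 1)) \<le> ennreal \<bar>C\<bar> * ennreal (1 / (1 + norm x) ^ (?n + 1))"
      by (simp only:)
  qed
  also have "\<dots> = ennreal \<bar>C\<bar> * (\<integral>\<^sup>+x. ennreal (1 / (1 + norm (x::'a)) ^ (?n + 1)) \<partial>lborel)"
    by (intro nn_integral_cmult) measurable
  also have "\<dots> < \<infinity>" using fin by (simp add: ennreal_mult_less_top)
  finally show ?thesis .
qed

text \<open>Cauchy-Schwarz in the coordinates of \<open>y\<close>. For complex values
  \<open>sqrt (grad_sq f x)\<close> is the Hilbert-Schmidt norm of the real derivative, which
  dominates its operator norm.\<close>

lemma norm_frechet_derivative_le:
  fixes f :: "'a::euclidean_space \<Rightarrow> complex"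
  assumes "f differentiable (at x)"
  shows "norm (frechet_derivative f (at x) y) \<le> sqrt (grad_sq f x) * norm y"
proof -
  let ?L = "frechet_derivative f (at x)"
  have lin: "linear ?L" using assms by (rule linear_frechet_derivative)
  have "?L y = ?L (\<Sum>b\<in>Basis. (y \<bullet> b) *\<^sub>R b)" by (simp add: euclidean_representation)
  also have "\<dots> = (\<Sum>b\<in>Basis. (y \<bullet> b) *\<^sub>R ?L b)" using lin by (simp add: linear_sum linear_cmul)
  finally have "norm (?L y) \<le> (\<Sum>b\<in>Basis. \<bar>y \<bullet> b\<bar> * \<bar>norm (?L b)\<bar>)"
    using norm_sum[of "\<lambda>b. (y \<bullet> b) *\<^sub>R ?L b" Basis] by simp
  also have "\<dots> \<le> L2_set (\<lambda>b. y \<bullet> b) Basis * L2_set (\<lambda>b. norm (?L b)) Basis" by (rule L2_set_mult_ineq)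
  also have "L2_set (\<lambda>b. y \<bullet> b) Basis = norm y"
    unfolding L2_set_def norm_eq_sqrt_inner euclidean_inner[of y y] by (simp add: power2_eq_square)
  also have "L2_set (\<lambda>b. norm (?L b)) Basis = sqrt (grad_sq f x)" by (simp add: L2_set_def grad_sq_def)
  finally show ?thesis by (simp add: mult.commute)
qed

context
  fixes f :: "'a::euclidean_space \<Rightarrow> complex"
  assumes schwartz: "schwartz f"
begin

lemma schwartz_differentiable: "f differentiable (at x)"
  using schwartz unfolding schwartz_def by (metis empty_subsetI iter_pd.simps(1) list.set(1))

lemma schwartz_decay: "\<exists>C. \<forall>x. (1 + norm x) ^ N * cmod (f x) \<le> C"
proof -
  have "bounded (range (\<lambda>x. (1 + norm x) ^ N * norm (iter_pd f [] x)))"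
    using schwartz unfolding schwartz_def by (metis empty_subsetI list.set(1))
  then obtain C where C: "\<And>x. \<bar>(1 + norm x) ^ N * cmod (f x)\<bar> \<le> C" by (auto simp: bounded_iff)
  show ?thesis using order_trans[OF abs_ge_self C] by blast
qed

lemma schwartz_partial:
  assumes b: "b \<in> Basis"
  shows "continuous_on UNIV (\<lambda>x. frechet_derivative f (at x) b)"
    and "\<exists>C. \<forall>x. (1 + norm x) ^ N * cmod (frechet_derivative f (at x) b) \<le> C"
proof -
  have s: "set [b] \<subseteq> Basis" using b by simp
  have "\<forall>x. iter_pd f [b] differentiable (at x)" using schwartz s unfolding schwartz_def by blast
  hence "\<And>x. (\<lambda>x. frechet_derivative f (at x) b) differentiable (at x)" by simp
  thus "continuous_on UNIV (\<lambda>x. frechet_derivative f (at x) b)"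
    by (intro differentiable_imp_continuous_on) (simp add: differentiable_on_def)
  have "bounded (range (\<lambda>x. (1 + norm x) ^ N * norm (iter_pd f [b] x)))"
    using schwartz s unfolding schwartz_def by blast
  then obtain C where C: "\<And>x. \<bar>(1 + norm x) ^ N * cmod (frechet_derivative f (at x) b)\<bar> \<le> C"
    by (auto simp: bounded_iff)
  show "\<exists>C. \<forall>x. (1 + norm x) ^ N * cmod (frechet_derivative f (at x) b) \<le> C"
    using order_trans[OF abs_ge_self C] by blast
qed

lemma continuous_on_grad_sq: "continuous_on UNIV (grad_sq f)"
  unfolding grad_sq_def[abs_def] by (intro continuous_intros schwartz_partial(1))

lemma grad_decay: "\<exists>C\<ge>0. \<forall>x. sqrt (grad_sq f x) \<le> C / (1 + norm x) ^ N"
proof -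
  have "\<forall>b. b \<in> Basis \<longrightarrow> (\<exists>C. \<forall>x. (1 + norm x) ^ N * cmod (frechet_derivative f (at x) b) \<le> C)"
    using schwartz_partial(2) by blast
  then obtain C where C: "\<And>b x. b \<in> Basis \<Longrightarrow> (1 + norm x) ^ N * cmod (frechet_derivative f (at x) b) \<le> C b"
    by metis
  have le: "sqrt (grad_sq f x) \<le> (\<Sum>b\<in>Basis. C b) / (1 + norm x) ^ N" for x
  proof -
    have pos: "0 < (1 + norm x) ^ N" by (intro zero_less_power add_pos_nonneg) auto
    have "sqrt (grad_sq f x) = L2_set (\<lambda>b. cmod (frechet_derivative f (at x) b)) Basis"
      by (simp add: L2_set_def grad_sq_def)
    also have "\<dots> \<le> (\<Sum>b\<in>Basis. cmod (frechet_derivative f (at x) b))" by (rule L2_set_le_sum) auto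
    also have "\<dots> \<le> (\<Sum>b\<in>Basis. C b / (1 + norm x) ^ N)"
      using C[of _ x] pos by (intro sum_mono) (simp add: pos_le_divide_eq mult.commute)
    finally show ?thesis by (simp add: sum_divide_distrib)
  qed
  moreover have "0 \<le> (\<Sum>b\<in>Basis. C b)"
  proof (rule sum_nonneg)
    fix b :: 'a assume "b \<in> Basis"
    thus "0 \<le> C b" using C[of b 0] by (auto intro: order_trans[OF norm_ge_zero])
  qed
  ultimately show ?thesis by blast
qed

text \<open>All bounds are proved for \<open>f\<close> and pass to its modulus by the triangle
  inequality, so no derivative of the modulus is formed.\<close>

lemma schwartz_slope:
  assumes dim: "DIM('a) \<ge> 3"
  shows "\<exists>h. decaying_function_slope (\<lambda>x. cmod (f x)) (\<lambda>x. sqrt (grad_sq f x)) h"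
    and "(\<integral>\<^sup>+x. ennreal ((sqrt (grad_sq f x))\<^sup>2) \<partial>lborel) < \<infinity>"
proof -
  let ?N = "DIM('a) + 1"
  obtain C where C: "0 \<le> C" "\<And>x. sqrt (grad_sq f x) \<le> C / (1 + norm x) ^ ?N" using grad_decay by blast
  \<comment> \<open>Within distance 1 of \<open>x\<close> the factor 1 + |x| changes at most by a
    factor 2, hence 2^N. So \<open>h\<close> bounds the gradient on the whole unit ball around
    \<open>x\<close>, and the exponent n + 1 keeps it integrable.\<close>
  define h where "h x = 2 ^ ?N * C / (1 + norm x) ^ ?N" for x :: 'a
  have hz: "sqrt (grad_sq f z) \<le> h x" if "dist x z < 1" for x z
  proof -
    have "norm x \<le> norm z + norm (x - z)" by (rule norm_triangle_sub)
    moreover have "norm (x - z) < 1" using that by (simp add: dist_norm)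
    ultimately have "1 + norm x \<le> 2 * (1 + norm z)" using norm_ge_zero[of z] by argo
    hence "(1 + norm x) ^ ?N \<le> (2 * (1 + norm z)) ^ ?N" by (intro power_mono) auto
    hence p: "(1 + norm x) ^ ?N \<le> 2 ^ ?N * (1 + norm z) ^ ?N" by (simp only: power_mult_distrib)
    have pos: "0 < (1 + norm x) ^ ?N" "0 < (1 + norm z) ^ ?N" by (intro zero_less_power add_pos_nonneg; simp)+
    have "sqrt (grad_sq f z) \<le> C / (1 + norm z) ^ ?N" by (rule C)
    also have "\<dots> \<le> 2 ^ ?N * C / (1 + norm x) ^ ?N"
    proof -
      have "C * (1 + norm x) ^ ?N \<le> C * (2 ^ ?N * (1 + norm z) ^ ?N)" using p C(1) by (rule mult_left_mono)
      thus ?thesis using pos by (simp add: divide_le_eq le_divide_eq mult_ac)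
    qed
    finally show ?thesis unfolding h_def .
  qed
  have h: "(\<integral>\<^sup>+x. ennreal (h x) \<partial>lborel) < \<infinity>"
    unfolding h_def using dim by (intro nn_integral_inverse_power_finite) auto
  have der: "(f has_derivative frechet_derivative f (at x)) (at x)" for x
    using schwartz_differentiable by (simp add: frechet_derivative_works)
  have gs: "0 \<le> grad_sq f x" for x by (simp add: grad_sq_def sum_nonneg)
  show "\<exists>h. decaying_function_slope (\<lambda>x. cmod (f x)) (\<lambda>x. sqrt (grad_sq f x)) h"
  proof (intro exI[of _ h], unfold_locales)
    show "3 \<le> DIM('a)" by (rule dim)
    show "continuous_on UNIV (\<lambda>x. cmod (f x))"
      using schwartz_differentiable
      by (intro continuous_on_norm differentiable_imp_continuous_on) (simp add: differentiable_on_def)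
    show "\<exists>K. \<forall>x. norm x ^ (DIM('a) - 2) * cmod (f x) \<le> K"
    proof -
      obtain K where K: "\<And>x. (1 + norm x) ^ (DIM('a) - 2) * cmod (f x) \<le> K" using schwartz_decay by blast
      have "norm x ^ (DIM('a) - 2) * cmod (f x) \<le> K" for x
      proof -
        have "norm x ^ (DIM('a) - 2) * cmod (f x) \<le> (1 + norm x) ^ (DIM('a) - 2) * cmod (f x)"
          by (intro mult_right_mono power_mono) auto
        thus ?thesis using K[of x] by linarith
      qed
      thus ?thesis by blast
    qed
    show "(\<lambda>x. sqrt (grad_sq f x)) \<in> borel_measurable borel"
      using continuous_on_grad_sq by (intro borel_measurable_continuous_onI continuous_on_real_sqrt)
    show "h \<in> borel_measurable borel" unfolding h_def by measurable
    show "(\<integral>\<^sup>+x. ennreal (h x) \<partial>lborel) < \<infinity>" by (rule h)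
    fix x y :: 'a
    show "0 \<le> cmod (f x)" "0 \<le> sqrt (grad_sq f x)" using gs by auto
    show "sqrt (grad_sq f x) \<le> h x" by (rule hz) simp
    show "cmod (f y) \<le> cmod (f x) + dist x y * h x" if xy: "dist x y < 1"
    proof -
      have "norm (f y - f x) \<le> h x * norm (y - x)"
      proof (rule differentiable_bound[of "ball x 1"])
        fix z assume z: "z \<in> ball x 1"
        show "(f has_derivative frechet_derivative f (at z)) (at z within ball x 1)"
          using der by (rule has_derivative_at_withinI)
        have "onorm (frechet_derivative f (at z)) \<le> sqrt (grad_sq f z)"
          using norm_frechet_derivative_le[OF schwartz_differentiable] gs by (intro onorm_bound) auto
        also have "\<dots> \<le> h x" using z by (intro hz) simp
        finally show "onorm (frechet_derivative f (at z)) \<le> h x" .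
      qed (use xy in auto)
      moreover have "cmod (f y) \<le> cmod (f x) + norm (f y - f x)" using norm_triangle_sub by blast
      ultimately show ?thesis by (simp add: dist_norm norm_minus_commute mult.commute)
    qed
    show "\<forall>\<^sub>F e in at_right 0. \<forall>y. dist x y < e \<longrightarrow> cmod (f y) \<le> cmod (f x) + e * (sqrt (grad_sq f x) + \<delta>)"
      if \<delta>: "0 < \<delta>" for \<delta>
    proof -
      obtain d where d: "0 < d"
        "\<And>y. norm (y - x) < d \<Longrightarrow> norm (f y - f x - frechet_derivative f (at x) (y - x)) \<le> \<delta> * norm (y - x)"
        using der[of x] \<delta> unfolding has_derivative_at_alt by blast
      have "\<forall>\<^sub>F e in at_right 0. e \<in> {0<..<d}" using d(1) by (rule eventually_at_right_real)
      thus ?thesis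
      proof eventually_elim
        case (elim e)
        show ?case
        proof (intro allI impI)
          fix y assume y: "dist x y < e"
          hence n: "norm (y - x) < e" by (simp add: dist_norm norm_minus_commute)
          hence "norm (y - x) < d" using elim by simp
          note d(2)[OF this]
          moreover have "norm (frechet_derivative f (at x) (y - x)) \<le> sqrt (grad_sq f x) * norm (y - x)"
            by (rule norm_frechet_derivative_le[OF schwartz_differentiable])
          moreover have "cmod (f y) \<le> cmod (f x) + (norm (f y - f x - frechet_derivative f (at x) (y - x)) + norm (frechet_derivative f (at x) (y - x)))"
          proof -
            have "cmod (f y) \<le> cmod (f x) + norm (f y - f x)" by (rule norm_triangle_sub)
            moreover have "norm (f y - f x) \<le> norm (f y - f x - frechet_derivative f (at x) (y - x)) + norm (frechet_derivative f (at x) (y - x))"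
              by (metis add.commute norm_triangle_sub)
            ultimately show ?thesis by linarith
          qed
          moreover have "norm (y - x) * (sqrt (grad_sq f x) + \<delta>) \<le> e * (sqrt (grad_sq f x) + \<delta>)"
            using n \<delta> gs[of x] by (intro mult_right_mono) auto
          ultimately show "cmod (f y) \<le> cmod (f x) + e * (sqrt (grad_sq f x) + \<delta>)"
            by (simp add: algebra_simps)
        qed
      qed
    qed
  qed
  \<comment> \<open>One factor of the squared gradient norm is bounded by \<open>C\<close>; the
    decay of the other is enough.\<close>
  have "(\<integral>\<^sup>+x. ennreal ((sqrt (grad_sq f x))\<^sup>2) \<partial>lborel) \<le> (\<integral>\<^sup>+x. ennreal (C * C / (1 + norm (x::'a)) ^ ?N) \<partial>lborel)"
  proof (intro nn_integral_mono ennreal_leI)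
    fix x :: 'a
    have "1 \<le> (1 + norm x) ^ ?N" by (rule one_le_power) simp
    hence "C / (1 + norm x) ^ ?N \<le> C / 1" using C(1) by (intro divide_left_mono) auto
    hence "sqrt (grad_sq f x) \<le> C" using C(2)[of x] by simp
    hence "sqrt (grad_sq f x) * sqrt (grad_sq f x) \<le> C * (C / (1 + norm x) ^ ?N)"
      using C gs[of x] by (intro mult_mono) auto
    thus "(sqrt (grad_sq f x))\<^sup>2 \<le> C * C / (1 + norm x) ^ ?N" by (simp add: power2_eq_square)
  qed
  also have "\<dots> < \<infinity>" using dim by (intro nn_integral_inverse_power_finite) auto
  finally show "(\<integral>\<^sup>+x. ennreal ((sqrt (grad_sq f x))\<^sup>2) \<partial>lborel) < \<infinity>" .
qed

end

theorem theorem2: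
  fixes f :: "'a::euclidean_space \<Rightarrow> complex"
    and q a :: real
  defines "n \<equiv> real DIM('a)"
  defines "qs \<equiv> 2 * n / (n - 2)"
  defines "\<alpha> \<equiv> q / (q - 2)"
  defines "Cq \<equiv> (2 * pi powr (n / 2) / Gamma (n / 2)) powr (1 / \<alpha>)
                * (q / 2) powr (2 / q)
                * (Gamma \<alpha> * Gamma (\<alpha> + 1) / Gamma (2 * \<alpha>)) powr (1 / \<alpha>)"
  defines "Dqa \<equiv> (n - 2 - 2 * a) powr (2 / q + 1) * Cq"
  assumes "DIM('a) \<ge> 3"
    and "2 < q" and "q \<le> qs"
    and "0 < a" and "a < (n - 2) / 2"
    and "schwartz f"
  shows "(\<integral>x. grad_sq f x \<partial>lborel)
           \<ge> a * (n - 2 - a) * (\<integral>x. (cmod (f x))\<^sup>2 / (norm x)\<^sup>2 \<partial>lborel)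
             + Dqa * (\<integral>x. norm x powr (- n * (qs - q) / qs) * cmod (f x) powr q \<partial>lborel) powr (2 / q)"
proof -
  obtain h where "decaying_function_slope (\<lambda>x. cmod (f x)) (\<lambda>x. sqrt (grad_sq f x)) h"
    using schwartz_slope(1)[OF \<open>schwartz f\<close> \<open>DIM('a) \<ge> 3\<close>] by blast
  then interpret decaying_function_slope "\<lambda>x. cmod (f x)" "\<lambda>x. sqrt (grad_sq f x)" h .
  \<comment> \<open>With this choice 2 lam = n - 2 - 2 a and m^2 - lam^2 = a (n - 2 - a), the two
    constants of the statement.\<close>
  define lam where "lam = m - a"
  have n: "3 \<le> n" using \<open>DIM('a) \<ge> 3\<close> by (simp add: n_def)
  have m: "m = (n - 2) / 2" by (simp add: m_def n_def)
  have lam: "0 < lam" "lam \<le> m" using \<open>0 < a\<close> \<open>a < (n - 2) / 2\<close> unfolding lam_def m by linarith+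
  have gs: "0 \<le> grad_sq f x" for x by (simp add: grad_sq_def sum_nonneg)
  have [measurable]: "grad_sq f \<in> borel_measurable borel"
    using continuous_on_grad_sq[OF \<open>schwartz f\<close>] by (rule borel_measurable_continuous_onI)
  \<comment> \<open>Since qs = n / m, the weight exponent is n - q m, and q \<le> qs says that it is
    nonnegative, as the rearrangement of the weighted integral requires.\<close>
  have s: "n * (qs - q) / qs = n - q * m"
    using n by (simp add: qs_def m field_simps)
  have qm: "q * m \<le> real DIM('a)"
  proof -
    have "q * m \<le> qs * m" using \<open>q \<le> qs\<close> m_pos by (intro mult_right_mono) auto
    also have "\<dots> = n" using n by (simp add: qs_def m)
    finally show ?thesis by (simp add: n_def)
  qed
  \<comment> \<open>The Bochner integral of a nonintegrable function and \<open>enn2real\<close> of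
    infinity are both 0, so for measurable nonnegative integrands the two kinds of integral agree in
    every case.\<close>
  have G: "(\<integral>x. grad_sq f x \<partial>lborel) = enn2real (\<integral>\<^sup>+x. ennreal ((sqrt (grad_sq f x))\<^sup>2) \<partial>lborel)"
    using gs by (subst integral_eq_nn_integral) auto
  have T: "(\<integral>x. (cmod (f x))\<^sup>2 / (norm x)\<^sup>2 \<partial>lborel)
      = enn2real (\<integral>\<^sup>+x. ennreal (norm x powr (- 2)) * ennreal (cmod (f x) powr 2) \<partial>lborel)"
  proof (subst integral_eq_nn_integral)
    have "ennreal ((cmod (f x))\<^sup>2 / (norm x)\<^sup>2) = ennreal (norm x powr (- 2)) * ennreal (cmod (f x) powr 2)" for x
    proof -
      \<comment> \<open>At the origin both expressions default to 0, by division by zero and by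
        \<open>0 powr (- 2) = 0\<close>.\<close>
      have "(cmod (f x))\<^sup>2 / (norm x)\<^sup>2 = norm x powr (- 2) * cmod (f x) powr 2"
        by (cases "x = 0") (auto simp: powr_minus powr_numeral field_simps)
      thus ?thesis by (simp add: ennreal_mult')
    qed
    thus "enn2real (\<integral>\<^sup>+x. ennreal ((cmod (f x))\<^sup>2 / (norm x)\<^sup>2) \<partial>lborel)
        = enn2real (\<integral>\<^sup>+x. ennreal (norm x powr (- 2)) * ennreal (cmod (f x) powr 2) \<partial>lborel)" by simp
    have "(\<lambda>x. (cmod (f x))\<^sup>2 / (norm x)\<^sup>2) \<in> borel_measurable borel" by measurable
    thus "(\<lambda>x. (cmod (f x))\<^sup>2 / (norm x)\<^sup>2) \<in> borel_measurable lborel" by simp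
  qed auto
  have X: "(\<integral>x. norm x powr (- n * (qs - q) / qs) * cmod (f x) powr q \<partial>lborel)
      = enn2real (\<integral>\<^sup>+x. ennreal (norm x powr (- (real DIM('a) - q * m))) * ennreal (cmod (f x) powr q) \<partial>lborel)"
  proof -
    have e: "- n * (qs - q) / qs = - (real DIM('a) - q * m)" using s by (simp add: n_def)
    show ?thesis unfolding e by (subst integral_eq_nn_integral) (auto simp: ennreal_mult')
  qed
  \<comment> \<open>n times the volume of the unit ball is the area of the unit sphere, the bracket
    in the constant of the statement.\<close>
  have \<sigma>: "real DIM('a) * w = 2 * pi powr (n / 2) / Gamma (n / 2)"
  proof -
    have Gamma_n: "Gamma (n / 2 + 1) = n / 2 * Gamma (n / 2)" using n by (intro Gamma_plus1) (auto elim!: nonpos_Ints_cases)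
    show ?thesis unfolding w_def unit_ball_vol_def n_def[symmetric] Gamma_n using n by simp
  qed
  have ml: "m\<^sup>2 - lam\<^sup>2 = a * (n - 2 - a)" by (simp add: lam_def m power2_eq_square field_simps)
  have l2: "2 * lam = n - 2 - 2 * a" by (simp add: lam_def m)
  show ?thesis
    using sharp_energy_bound[OF lam \<open>2 < q\<close> qm schwartz_slope(2)[OF \<open>schwartz f\<close> \<open>DIM('a) \<ge> 3\<close>]]
    unfolding G T X \<sigma> ml l2 Dqa_def Cq_def \<alpha>_def by simp
qed

end
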